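(* Let $G=K(H,T)$ be a kite graph whose tail consists of $s\ge 2$ paths $v,v_{i1},v_{i2},\dots,v_{ir}$ ($i=1,\dots,s$) of length $r$ attached at $v\in V(H)$. Let $K(H,T^+)$ be a graph obtained from $G$ by adding some edges among the vertices $v_{1j},v_{2j},\dots,v_{sj}$ for each $j=1,\dots,r$, and let $K^+(H,T)$ be a graph obtained from $G$ by adding some edges to $H$ and some edges among the vertices $v_{2j},\dots,v_{sj}$ for $1\le j\le r$. Let $k$ be an integer with $1\le k\le |V(H)|-1$ and suppose $\alpha(H)=\alpha(F_k(H))$. Then: (i) if $\alpha(G)\ne 2+2\cos\left(\frac{2r\pi}{2r+1}\right)$, then $\alpha(F_k(K(H,T^+)))=\alpha(K(H,T^+))=\alpha(G)$; (ii) if $\alpha(G)=2+2\cos\left(\frac{2r\pi}{2r+1}\right)$, then $\alpha(F_k(K^+(H,T)))=\alpha(K^+(H,T))=\alpha(G)=2+2\cos\left(\frac{2r\pi}{2r+1}\right)$.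
   Context: A kite graph $K(H,T)$ consists of a head $H$, which is an arbitrary graph, and a tail $T$ consisting of $s\ge 2$ paths, each of length $r$ (i.e. $r$ edges), pairwise sharing only a common end-vertex $v\in V(H)$ and otherwise disjoint from $H$. $\alpha(G)$ denotes the algebraic connectivity of $G$, i.e. the second smallest eigenvalue of its Laplacian matrix. For a graph $G=(V,E)$ on $n$ vertices and $1\le k\le n-1$, the $k$-token graph $F_k(G)$ has as vertices the $k$-subsets of $V$, two $k$-subsets being adjacent iff their symmetric difference is $\{a,b\}$ with $ab\in E$. *)

theory Defs
  imports
    Complex_Main
    "HOL-Library.Multiset"
    "Graph_Theory.Pair_Digraph"
    "Jordan_Normal_Form.Char_Poly"
begin

text \<open>
  Finite simple graphs are records satisfying the locale predicate \<open>pair_graph\<close>: an undirected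
  edge is represented by its two opposite arcs, so \<open>out_degree\<close> is the usual vertex degree.
\<close>

definition laplacian_mat :: "'a pair_pre_digraph \<Rightarrow> 'a list \<Rightarrow> real mat" where
  "laplacian_mat G xs = mat (length xs) (length xs) (\<lambda>(i, j).
     if i = j then real (out_degree (with_proj G) (xs ! i))
     else if (xs ! i, xs ! j) \<in> parcs G then - 1 else 0)"

text \<open>
  The vertices are enumerated by an arbitrary list; the choice is immaterial by
  \<open>char_poly_laplacian_mat_enum\<close> below. Eigenvalues are listed in increasing order and with
  multiplicity, so index 1 is the second smallest one. The value is meaningful for graphs with
  at least two vertices.
\<close>

definition laplacian_eigenvalues :: "'a pair_pre_digraph \<Rightarrow> real list" where
  "laplacian_eigenvalues G = sorted_list_of_multiset (proots (char_poly
     (laplacian_mat G (SOME xs. distinct xs \<and> set xs = pverts G))))"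

definition algebraic_connectivity :: "'a pair_pre_digraph \<Rightarrow> real" where
  "algebraic_connectivity G = laplacian_eigenvalues G ! 1"

definition token_graph :: "nat \<Rightarrow> 'a pair_pre_digraph \<Rightarrow> 'a set pair_pre_digraph" where
  "token_graph k G =
     (let W = {A. A \<subseteq> pverts G \<and> card A = k} in
      \<lparr> pverts = W,
        parcs = {(A, B). A \<in> W \<and> B \<in> W \<and> (\<exists>a b. (a, b) \<in> parcs G \<and> sym_diff A B = {a, b})} \<rparr>)"

text \<open>
  The \<open>i\<close>-th tail path is \<open>v, w i 1, \<dots>, w i r\<close> for \<open>1 \<le> i \<le> s\<close>.
\<close>

definition kite_labelling ::
  "'a pair_pre_digraph \<Rightarrow> 'a \<Rightarrow> (nat \<Rightarrow> nat \<Rightarrow> 'a) \<Rightarrow> nat \<Rightarrow> nat \<Rightarrow> bool" where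
  "kite_labelling H v w s r \<longleftrightarrow>
     v \<in> pverts H \<and>
     inj_on (\<lambda>(i, j). w i j) ({1..s} \<times> {1..r}) \<and>
     (\<forall>i\<in>{1..s}. \<forall>j\<in>{1..r}. w i j \<notin> pverts H)"

definition kite ::
  "'a pair_pre_digraph \<Rightarrow> 'a \<Rightarrow> (nat \<Rightarrow> nat \<Rightarrow> 'a) \<Rightarrow> nat \<Rightarrow> nat \<Rightarrow> 'a pair_pre_digraph" where
  "kite H v w s r =
     \<lparr> pverts = pverts H \<union> {w i j | i j. i \<in> {1..s} \<and> j \<in> {1..r}},
       parcs = parcs H \<union>
         symcl ({(v, w i 1) | i. i \<in> {1..s} \<and> 1 \<le> r} \<union>
                {(w i j, w i (j + 1)) | i j. i \<in> {1..s} \<and> j \<in> {1..<r}}) \<rparr>"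

definition adds_edges_within ::
  "'a pair_pre_digraph \<Rightarrow> 'a rel \<Rightarrow> 'a pair_pre_digraph \<Rightarrow> bool" where
  "adds_edges_within G S G' \<longleftrightarrow>
     pair_graph G' \<and> pverts G' = pverts G \<and>
     parcs G \<subseteq> parcs G' \<and> parcs G' \<subseteq> parcs G \<union> S"

definition level_pairs :: "(nat \<Rightarrow> nat \<Rightarrow> 'a) \<Rightarrow> nat set \<Rightarrow> nat \<Rightarrow> 'a rel" where
  "level_pairs w I r = {(w i j, w i' j) | i i' j. i \<in> I \<and> i' \<in> I \<and> j \<in> {1..r}}"

definition is_kite_tail_plus ::
  "'a pair_pre_digraph \<Rightarrow> 'a \<Rightarrow> (nat \<Rightarrow> nat \<Rightarrow> 'a) \<Rightarrow> nat \<Rightarrow> nat \<Rightarrow> 'a pair_pre_digraph \<Rightarrow> bool" where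
  "is_kite_tail_plus H v w s r G' \<longleftrightarrow>
     adds_edges_within (kite H v w s r) (level_pairs w {1..s} r) G'"

definition is_kite_plus ::
  "'a pair_pre_digraph \<Rightarrow> 'a \<Rightarrow> (nat \<Rightarrow> nat \<Rightarrow> 'a) \<Rightarrow> nat \<Rightarrow> nat \<Rightarrow> 'a pair_pre_digraph \<Rightarrow> bool" where
  "is_kite_plus H v w s r G' \<longleftrightarrow>
     adds_edges_within (kite H v w s r)
       (pverts H \<times> pverts H \<union> level_pairs w {2..s} r) G'"

lemma char_poly_laplacian_mat_enum:
  assumes "distinct xs" "distinct ys" "set xs = set ys"
  shows "char_poly (laplacian_mat G xs) = char_poly (laplacian_mat G ys)"
proof -
  define n where "n = length xs"
  have n: "length xs = n" "length ys = n"
    using assms by (auto simp: n_def dest!: distinct_card)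
  define P :: "real mat" where "P = mat n n (\<lambda>(i, j). if xs ! i = ys ! j then 1 else 0)"
  define Q :: "real mat" where "Q = mat n n (\<lambda>(i, j). if ys ! i = xs ! j then 1 else 0)"
  have one: "(\<Sum>k = 0..<n. (if zs ! k = x then 1 else 0) * f k) = f l"
    if "distinct zs" "length zs = n" "l < n" "zs ! l = x" for zs :: "'a list" and x and f :: "nat \<Rightarrow> real" and l
  proof -
    have "(\<Sum>k = 0..<n. (if zs ! k = x then 1 else 0) * f k) =
          (\<Sum>k = 0..<n. if k = l then f k else 0)"
      using that by (intro sum.cong) (auto simp: nth_eq_iff_index_eq)
    then show ?thesis using that by simp
  qed
  have inv: "mat n n (\<lambda>(i, j). if as ! i = bs ! j then 1 else (0::real)) *
             mat n n (\<lambda>(i, j). if bs ! i = as ! j then 1 else 0) = 1\<^sub>m n"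
    if ab: "distinct as" "distinct bs" "set as = set bs" "length as = n" "length bs = n" for as bs :: "'a list"
  proof (rule eq_matI)
    fix i j assume ij: "i < dim_row (1\<^sub>m n :: real mat)" "j < dim_col (1\<^sub>m n :: real mat)"
    then have "as ! i \<in> set bs" using ab by (auto simp flip: ab(3))
    then obtain l where l: "l < n" "bs ! l = as ! i"
      using ab by (auto simp: in_set_conv_nth)
    have "(\<Sum>k = 0..<n. (if bs ! k = as ! i then 1 else (0::real)) * (if bs ! k = as ! j then 1 else 0)) =
        (if bs ! l = as ! j then 1 else 0)"
      by (rule one) (use l ab in auto)
    moreover have "(mat n n (\<lambda>(i, j). if as ! i = bs ! j then 1 else (0::real)) *
             mat n n (\<lambda>(i, j). if bs ! i = as ! j then 1 else 0)) $$ (i, j) =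
        (\<Sum>k = 0..<n. (if bs ! k = as ! i then 1 else (0::real)) * (if bs ! k = as ! j then 1 else 0))"
      using ij by (auto simp: scalar_prod_def intro!: sum.cong)
    moreover have "bs ! l = as ! j \<longleftrightarrow> i = j"
      unfolding l(2) using ij ab by (simp add: nth_eq_iff_index_eq)
    ultimately show "(mat n n (\<lambda>(i, j). if as ! i = bs ! j then 1 else (0::real)) *
             mat n n (\<lambda>(i, j). if bs ! i = as ! j then 1 else 0)) $$ (i, j) = 1\<^sub>m n $$ (i, j)"
      using ij by simp
  qed auto
  have PQ: "P * Q = 1\<^sub>m n" and QP: "Q * P = 1\<^sub>m n"
    unfolding P_def Q_def by (rule inv; use assms n in auto)+
  have LP: "laplacian_mat G xs * P = P * laplacian_mat G ys"
  proof (rule eq_matI)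
    fix i j assume "i < dim_row (P * laplacian_mat G ys)" "j < dim_col (P * laplacian_mat G ys)"
    then have ij: "i < n" "j < n" by (auto simp: P_def laplacian_mat_def n)
    have "xs ! i \<in> set ys" using ij n by (auto simp flip: assms(3))
    then obtain l where l: "l < n" "ys ! l = xs ! i"
      using n by (auto simp: in_set_conv_nth)
    have "ys ! j \<in> set xs" using ij n by (auto simp: assms(3))
    then obtain m where m: "m < n" "xs ! m = ys ! j"
      using n by (auto simp: in_set_conv_nth)
    have "(\<Sum>k = 0..<n. (if ys ! k = xs ! i then 1 else 0) * laplacian_mat G ys $$ (k, j)) =
        laplacian_mat G ys $$ (l, j)"
      by (rule one) (use l n assms in auto)
    moreover have "(\<Sum>k = 0..<n. (if xs ! k = ys ! j then 1 else 0) * laplacian_mat G xs $$ (i, k)) =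
        laplacian_mat G xs $$ (i, m)"
      by (rule one) (use m n assms in auto)
    moreover have "laplacian_mat G ys $$ (l, j) = laplacian_mat G xs $$ (i, m)"
    proof -
      have "l = j \<longleftrightarrow> i = m"
        using l m ij assms n by (metis nth_eq_iff_index_eq)
      then show ?thesis using l m ij n by (simp add: laplacian_mat_def)
    qed
    moreover have "(P * laplacian_mat G ys) $$ (i, j) =
        (\<Sum>k = 0..<n. (if ys ! k = xs ! i then 1 else 0) * laplacian_mat G ys $$ (k, j))"
      using ij n by (auto simp: P_def laplacian_mat_def scalar_prod_def intro!: sum.cong)
    moreover have "(laplacian_mat G xs * P) $$ (i, j) =
        (\<Sum>k = 0..<n. (if xs ! k = ys ! j then 1 else 0) * laplacian_mat G xs $$ (i, k))"
      using ij n by (auto simp: P_def laplacian_mat_def scalar_prod_def intro!: sum.cong)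
    ultimately show "(laplacian_mat G xs * P) $$ (i, j) = (P * laplacian_mat G ys) $$ (i, j)"
      by simp
  qed (auto simp: P_def laplacian_mat_def n)
  have car: "laplacian_mat G xs \<in> carrier_mat n n" "laplacian_mat G ys \<in> carrier_mat n n"
      "P \<in> carrier_mat n n" "Q \<in> carrier_mat n n"
    by (auto simp: laplacian_mat_def P_def Q_def n)
  have "P * laplacian_mat G ys * Q = laplacian_mat G xs * (P * Q)"
    unfolding LP[symmetric] using car by (simp add: assoc_mult_mat)
  then have "laplacian_mat G xs = P * laplacian_mat G ys * Q"
    using PQ car by simp
  then have "similar_mat (laplacian_mat G xs) (laplacian_mat G ys)"
    using car PQ QP unfolding similar_mat_def
    by (intro exI[of _ P] exI[of _ Q] similar_mat_witI[of _ _ n]) auto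
  then show ?thesis by (rule char_poly_similar)
qed

lemma pair_graph_kite:
  assumes "pair_graph H" "kite_labelling H v w s r"
  shows "pair_graph (kite H v w s r)"
proof -
  interpret H: pair_graph H by fact
  define R where "R = {(v, w i 1) | i. i \<in> {1..s} \<and> 1 \<le> r} \<union>
            {(w i j, w i (j + 1)) | i j. i \<in> {1..s} \<and> j \<in> {1..<r}}"
  have sub: "R \<subseteq> pverts (kite H v w s r) \<times> pverts (kite H v w s r)"
  proof -
    have "w i 1 \<in> pverts (kite H v w s r)" if "i \<in> {1..s}" "1 \<le> r" for i
      using that by (auto simp: kite_def)
    moreover have "w i j \<in> pverts (kite H v w s r)" "w i (j + 1) \<in> pverts (kite H v w s r)"
      if "i \<in> {1..s}" "j \<in> {1..<r}" for i j
    proof -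
      have "j \<in> {1..r}" "j + 1 \<in> {1..r}" using that by auto
      with that show "w i j \<in> pverts (kite H v w s r)" "w i (j + 1) \<in> pverts (kite H v w s r)"
        by (auto simp: kite_def simp del: atLeastAtMost_iff)
    qed
    moreover have "v \<in> pverts (kite H v w s r)"
      using assms by (auto simp: kite_def kite_labelling_def)
    ultimately show ?thesis unfolding R_def by blast
  qed
  have arcs: "parcs (kite H v w s r) = parcs H \<union> symcl R"
    by (simp add: kite_def R_def)
  have loops: "a \<noteq> b" if "(a, b) \<in> R" for a b
  proof -
    have "w i j \<noteq> w i (j + 1)" if "i \<in> {1..s}" "j \<in> {1..<r}" for i j
    proof
      assume "w i j = w i (j + 1)"
      moreover have "(i, j) \<in> {1..s} \<times> {1..r}" "(i, j + 1) \<in> {1..s} \<times> {1..r}"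
        using that by auto
      moreover have "inj_on (\<lambda>(i, j). w i j) ({1..s} \<times> {1..r})"
        using assms(2) by (simp add: kite_labelling_def)
      ultimately have "(i, j) = (i, j + 1)"
        by (intro inj_onD[of "\<lambda>(i, j). w i j" "{1..s} \<times> {1..r}"]) simp_all
      then show False by simp
    qed
    moreover have "v \<noteq> w i 1" if "i \<in> {1..s}" "1 \<le> r" for i
      using that assms by (auto simp: kite_labelling_def)
    ultimately show ?thesis using that unfolding R_def by blast
  qed
  have fin: "finite (pverts (kite H v w s r))"
  proof -
    have "{w i j | i j. i \<in> {1..s} \<and> j \<in> {1..r}} = (\<lambda>(i, j). w i j) ` ({1..s} \<times> {1..r})"
      by (auto simp del: atLeastAtMost_iff)
    then show ?thesis using H.pair_finite_verts by (simp add: kite_def)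
  qed
  have wf: "parcs (kite H v w s r) \<subseteq> pverts (kite H v w s r) \<times> pverts (kite H v w s r)"
  proof -
    have "parcs H \<subseteq> pverts (kite H v w s r) \<times> pverts (kite H v w s r)"
      by (auto simp: kite_def dest: H.in_arcsD1 H.in_arcsD2)
    moreover have "symcl R \<subseteq> pverts (kite H v w s r) \<times> pverts (kite H v w s r)"
      using sub by (auto simp: symcl_def)
    ultimately show ?thesis unfolding arcs by blast
  qed
  have "sym (parcs H)"
    using H.pair_sym_arcs by (simp add: symmetric_def)
  moreover have "sym (symcl R)"
    by (auto simp: symcl_def sym_def)
  ultimately have sy: "sym (parcs (kite H v w s r))"
    unfolding arcs by (rule sym_Un)
  have nl: "a \<noteq> b" if "(a, b) \<in> parcs (kite H v w s r)" for a b
    using that loops unfolding arcs by (auto simp: symcl_def dest: H.no_loops')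
  show ?thesis
  proof
    show "finite (parcs (kite H v w s r))"
      by (rule finite_subset[OF wf]) (use fin in simp)
  qed (use wf fin sy nl in \<open>auto simp: symmetric_def\<close>)
qed

lemma pair_graph_token_graph:
  assumes "pair_graph G"
  shows "pair_graph (token_graph k G)"
proof -
  interpret G: pair_graph G by fact
  have fin: "finite (pverts (token_graph k G))"
    using G.pair_finite_verts by (simp add: token_graph_def)
  have wf: "parcs (token_graph k G) \<subseteq> pverts (token_graph k G) \<times> pverts (token_graph k G)"
    by (auto simp: token_graph_def Let_def)
  have sy: "sym (parcs (token_graph k G))"
    unfolding sym_def by (simp add: token_graph_def Let_def Un_commute)
  have nl: "A \<noteq> B" if "(A, B) \<in> parcs (token_graph k G)" for A B
    using that by (auto simp: token_graph_def Let_def)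
  show ?thesis
  proof
    show "finite (parcs (token_graph k G))"
      by (rule finite_subset[OF wf]) (use fin in simp)
  qed (use wf fin sy nl in \<open>auto simp: symmetric_def\<close>)
qed

end

theory Submission
  imports
    Defs
    "HOL-Combinatorics.Transposition"
    "Jordan_Normal_Form.Schur_Decomposition"
    "Jordan_Normal_Form.Spectral_Radius"
begin

text \<open>
  The equality of the algebraic connectivities of a graph and its token graphs is the exclusion-process
  case of Aldous' spectral gap conjecture, proved along the lines of Caputo, Liggett and
  Richthammer. Functions on \<open>k\<close>-sets split into lifts of functions on vertices, where the spectral gap is that
  of the graph, and functions whose sum over the sets containing a given vertex vanishes. For the latter
  a vertex \<open>z\<close> is removed by a star-mesh transformation. This does not decrease the gap of the graph,
  and by the octopus inequality it does not increase the energy of a function on \<open>k\<close>-sets, so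
  that induction applies separately to the sets containing and to the sets avoiding \<open>z\<close>.

  For the octopus inequality let \<open>R\<close> be the sum of \<open>c i * c j\<close> times the transposition \<open>(i j)\<close> over all pairs, where
  the weights \<open>c\<close> have sum zero and only \<open>c z\<close> is negative, and let \<open>N\<close> be the sum of the \<open>(c i)\<^sup>2\<close>. One has to
  show that \<open>R\<close> is positive semidefinite. Because the weights have sum zero, \<open>2 N R - R\<^sup>2\<close>
  is a combination of projections, one for each set of four vertices, and it is nonnegative by an inequality
  on five points.

  In a kite, the vectors that are proportional to \<open>sin (j * pi / (2 r + 1))\<close> along the tails, vanish on the
  head and have sum zero give the upper bound \<open>2 + 2 cos (2 r pi / (2 r + 1))\<close>. If the
  algebraic connectivity is smaller, the Poincare inequality on a tail forces a minimising vector to be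
  constant on the levels, so that edges within levels do not change its energy. If it is
  equal, one of the above vectors takes equal values at the ends of every added edge.
\<close>

section \<open>The octopus inequality for functions on sets\<close>

definition swap_tokens :: "'a \<Rightarrow> 'a \<Rightarrow> 'a set \<Rightarrow> 'a set" where
  "swap_tokens i j A = transpose i j ` A"

lemma swap_tokens_same [simp]: "swap_tokens i i A = A"
  by (simp add: swap_tokens_def)

lemma swap_tokens_commute: "swap_tokens i j = swap_tokens j i"
  by (rule ext) (simp add: swap_tokens_def transpose_commute)

lemma swap_tokens_involutory [simp]: "swap_tokens i j (swap_tokens i j A) = A"
  by (simp add: swap_tokens_def image_comp)

lemma swap_tokens_insert [simp]:
  "swap_tokens i j (insert x A) = insert (transpose i j x) (swap_tokens i j A)"
  by (simp add: swap_tokens_def)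

lemma swap_tokens_outside [simp]: "i \<notin> A \<Longrightarrow> j \<notin> A \<Longrightarrow> swap_tokens i j A = A"
  unfolding swap_tokens_def
  by (metis (no_types, lifting) image_cong image_ident transpose_apply_other)

lemma swap_tokens_inside: "i \<in> A \<Longrightarrow> j \<in> A \<Longrightarrow> swap_tokens i j A = A"
  unfolding swap_tokens_def by simp

lemma swap_tokens_move:
  assumes "i \<in> A" "j \<notin> A"
  shows "swap_tokens i j A = insert j (A - {i})"
proof -
  have "swap_tokens i j A = swap_tokens i j (insert i (A - {i}))"
    using assms by (simp add: insert_absorb)
  also have "\<dots> = insert j (A - {i})"
    unfolding swap_tokens_insert using assms by simp
  finally show ?thesis .
qed

lemma card_swap_tokens [simp]: "card (swap_tokens i j A) = card A"
  unfolding swap_tokens_def by (intro card_image inj_on_subset[OF inj_transpose]) auto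

lemma swap_tokens_subset_iff: "i \<in> V \<Longrightarrow> j \<in> V \<Longrightarrow> swap_tokens i j A \<subseteq> V \<longleftrightarrow> A \<subseteq> V"
  unfolding swap_tokens_def by (metis image_mono swap_tokens_def swap_tokens_inside swap_tokens_involutory)

lemma sum_Pow_swap_tokens:
  assumes "i \<in> V" "j \<in> V"
  shows "(\<Sum>A\<in>Pow V. g (swap_tokens i j A)) = (\<Sum>A\<in>Pow V. g A)"
  by (rule sum.reindex_bij_witness[of _ "swap_tokens i j" "swap_tokens i j"])
     (use assms in \<open>auto simp: swap_tokens_subset_iff\<close>)

lemma sum_Pow_insert:
  fixes g :: "'a set \<Rightarrow> 'b::comm_monoid_add"
  assumes "finite V" "i \<notin> V"
  shows "(\<Sum>A\<in>Pow (insert i V). g A) = (\<Sum>A\<in>Pow V. g A + g (insert i A))"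
proof -
  have "inj_on (insert i) (Pow V)"
    using assms by (intro inj_onI) (auto simp: insert_ident)
  moreover have "Pow V \<inter> insert i ` Pow V = {}" using assms by auto
  ultimately show ?thesis
    using assms by (simp add: Pow_insert sum.union_disjoint sum.reindex sum.distrib)
qed

text \<open>The inner product of \<open>f\<close> composed with two transpositions. For indices in
  \<open>V\<close> these act as self-adjoint involutions, so this is the quadratic form of their
  product at \<open>f\<close>; expanding \<open>R^2\<close> produces exactly such terms.\<close>

definition corr :: "'a set \<Rightarrow> ('a set \<Rightarrow> real) \<Rightarrow> 'a \<Rightarrow> 'a \<Rightarrow> 'a \<Rightarrow> 'a \<Rightarrow> real" where
  "corr V f i j k l = (\<Sum>A\<in>Pow V. f (swap_tokens i j A) * f (swap_tokens k l A))"

lemma corr_commute: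
  "corr V f i j k l = corr V f j i k l" "corr V f i j k l = corr V f i j l k"
  "corr V f i j k l = corr V f k l i j"
  unfolding corr_def by (simp_all add: swap_tokens_commute mult.commute)

lemma corr_same: "i \<in> V \<Longrightarrow> j \<in> V \<Longrightarrow> corr V f i j i j = (\<Sum>A\<in>Pow V. f A * f A)"
  unfolding corr_def using sum_Pow_swap_tokens[of i V j "\<lambda>A. f A * f A"] by simp

text \<open>A set treats two of the three points alike, so the alternating sum over the permutations
  of \<open>i, j, k\<close> annihilates every function on sets. Hence a 3-cycle plus its inverse
  acts as the three transpositions minus the identity, and a 3-cycle and its inverse have the same
  quadratic form.\<close>

lemma corr_three_cycle:
  assumes "finite V" "i \<in> V" "j \<in> V" "k \<in> V" "distinct [i, j, k]"
  shows "corr V f i j j k =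
    (corr V f i j i i + corr V f j k i i + corr V f i k i i - corr V f i i i i) / 2"
proof -
  define W where "W = V - {i, j, k}"
  have V: "V = insert i (insert j (insert k W))" and W: "finite W" "i \<notin> W" "j \<notin> W" "k \<notin> W"
    using assms by (auto simp: W_def)
  have *: "i \<notin> insert j (insert k W)" "j \<notin> insert k W" "i \<noteq> j" "i \<noteq> k" "j \<noteq> k" "j \<noteq> i" "k \<noteq> i" "k \<noteq> j"
    using assms W by auto
  have expand: "(\<Sum>A\<in>Pow V. g A) = (\<Sum>E\<in>Pow W.
     g E + g (insert k E) + g (insert j E) + g (insert j (insert k E)) +
     g (insert i E) + g (insert i (insert k E)) + g (insert i (insert j E)) + g (insert i (insert j (insert k E))))"
    for g :: "'a set \<Rightarrow> real"
    unfolding V using * W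
    by (subst sum_Pow_insert, simp, simp)+ (simp add: ac_simps)
  have "2 * corr V f i j j k =
      corr V f i j i i + corr V f j k i i + corr V f i k i i - corr V f i i i i"
    unfolding corr_def expand sum_distrib_left sum.distrib[symmetric] sum_subtractf[symmetric]
  proof (rule sum.cong[OF refl], goal_cases)
    case (1 E)
    then have "i \<notin> E" "j \<notin> E" "k \<notin> E" using W by auto
    with * show ?case by (simp add: insert_commute algebra_simps)
  qed
  then show ?thesis by simp
qed

text \<open>\<open>P\<close>, \<open>Q\<close> and \<open>R\<close> belong to the three ways of
  splitting four points into two pairs. The squared differences measure the component of
  \<open>f\<close> in the two-dimensional irreducible representation of the symmetric group on these
  points.\<close>

definition pairing_gap :: "('a set \<Rightarrow> real) \<Rightarrow> 'a set \<Rightarrow> 'a \<Rightarrow> 'a \<Rightarrow> 'a \<Rightarrow> 'a \<Rightarrow> real" where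
  "pairing_gap f E i j k l =
     (let P = f (insert i (insert j E)) + f (insert k (insert l E));
          Q = f (insert i (insert k E)) + f (insert j (insert l E));
          R = f (insert i (insert l E)) + f (insert j (insert k E))
      in (P - Q)\<^sup>2 + (P - R)\<^sup>2 + (Q - R)\<^sup>2)"

text \<open>The coefficients follow the character of that representation: 2 on the identity and on
  double transpositions, -1 on 3-cycles, 0 elsewhere. So the right-hand side is a multiple of the
  projection, and only sets meeting the four points in two elements contribute. A 3-cycle and its
  inverse have the same form, so four terms stand for eight.\<close>

lemma sum_pairing_gap:
  assumes W: "finite W" "i \<notin> W" "j \<notin> W" "k \<notin> W" "l \<notin> W" "distinct [i, j, k, l]"
    and V: "V = insert i (insert j (insert k (insert l W)))"
  shows "(\<Sum>E\<in>Pow W. pairing_gap f E i j k l) =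
     corr V f i i i i + (corr V f i j k l + corr V f i k j l + corr V f i l j k)
     - (corr V f i j j k + corr V f i j j l + corr V f i k k l + corr V f j k k l)"
proof -
  have *: "i \<notin> insert j (insert k (insert l W))" "j \<notin> insert k (insert l W)" "k \<notin> insert l W"
    using assms by auto
  have expand: "(\<Sum>A\<in>Pow V. g A) = (\<Sum>E\<in>Pow W. 
     g E + g (insert l E) + g (insert k E) + g (insert k (insert l E)) +
     g (insert j E) + g (insert j (insert l E)) + g (insert j (insert k E)) + g (insert j (insert k (insert l E))) +
     g (insert i E) + g (insert i (insert l E)) + g (insert i (insert k E)) + g (insert i (insert k (insert l E))) +
     g (insert i (insert j E)) + g (insert i (insert j (insert l E))) + g (insert i (insert j (insert k E))) + g (insert i (insert j (insert k (insert l E)))))"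
    for g :: "'a set \<Rightarrow> real"
    unfolding V using * W
    by (subst sum_Pow_insert, simp, simp)+ (simp add: ac_simps)
  show ?thesis
    unfolding corr_def expand sum.distrib[symmetric] sum_subtractf[symmetric]
  proof (rule sum.cong[OF refl], goal_cases)
    case (1 E)
    then have "i \<notin> E" "j \<notin> E" "k \<notin> E" "l \<notin> E" using W by auto
    moreover have "i \<noteq> j" "i \<noteq> k" "i \<noteq> l" "j \<noteq> k" "j \<noteq> l" "k \<noteq> l" "j \<noteq> i" "k \<noteq> i" "l \<noteq> i" "k \<noteq> j" "l \<noteq> j" "l \<noteq> k"
      using W by auto
    ultimately show ?case
      by (simp add: pairing_gap_def Let_def insert_commute power2_eq_square algebra_simps)
  qed
qed

lemma pairing_gap_nonneg: "pairing_gap f E i j k l \<ge> 0"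
  by (simp add: pairing_gap_def Let_def)

text \<open>
  The ten variables are the values of a function on the edges of a complete graph on five vertices,
  \<open>a, b, c, d\<close> belonging to the edges at one distinguished vertex. The sum of squares
  comes from the fact that the difference of both sides is supported on a three-dimensional
  irreducible representation of the symmetric group on the other four vertices.
\<close>

lemma five_point_sum_of_squares:
  fixes a b c d ab ac ad bc bd cd :: real
  defines "z \<equiv> \<lambda>x y z x' y' z'. (x + x' - (y + y'))\<^sup>2 + (x + x' - (z + z'))\<^sup>2 + (y + y' - (z + z'))\<^sup>2"
  shows "z ab ac ad cd bd bc \<le> z a b c bc ac ab + z a b d bd ad ab + z a c d cd ad ac + z b c d cd bd bc"
proof -
  have le: "Y \<le> X" if "2 * (X - Y) = R" "R \<ge> 0" for X Y R :: real
    using that by simp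
  show ?thesis
  proof (rule le)
    show "2 * (z a b c bc ac ab + z a b d bd ad ab + z a c d cd ad ac + z b c d cd bd bc - z ab ac ad cd bd bc) =
      (3 * a - (b + c + d) - (ab + ac + ad) + (bc + bd + cd))\<^sup>2
    + (3 * b - (a + c + d) - (ab + bc + bd) + (ac + ad + cd))\<^sup>2
    + (3 * c - (a + b + d) - (ac + bc + cd) + (ab + ad + bd))\<^sup>2
    + (3 * d - (a + b + c) - (ad + bd + cd) + (ab + ac + bc))\<^sup>2"
      unfolding z_def by Groebner_Basis.algebra
  qed simp
qed

section \<open>The symmetrised kernel of \<open>R^2 - 2 N R\<close>\<close>

definition swap_corr :: "'a set \<Rightarrow> ('a set \<Rightarrow> real) \<Rightarrow> 'a \<Rightarrow> 'a \<Rightarrow> real" where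
  "swap_corr V f i j = (\<Sum>A\<in>Pow V. f (swap_tokens i j A) * f A)"

lemma swap_corr_commute: "swap_corr V f i j = swap_corr V f j i"
  by (simp add: swap_corr_def swap_tokens_commute)

lemma swap_corr_same: "swap_corr V f i i = (\<Sum>A\<in>Pow V. (f A)\<^sup>2)"
  by (simp add: swap_corr_def power2_eq_square)

lemma corr_trivial [simp]:
  "corr V f i j k k = swap_corr V f i j" "corr V f k k i j = swap_corr V f i j"
  by (simp_all add: corr_def swap_corr_def mult.commute)

lemma corr_shared:
  fixes f :: "'a set \<Rightarrow> real"
  assumes "finite V" "i \<in> V" "j \<in> V" "k \<in> V" "distinct [i, j, k]"
  defines "t \<equiv> (swap_corr V f i j + swap_corr V f j k + swap_corr V f i k - (\<Sum>A\<in>Pow V. (f A)\<^sup>2)) / 2"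
  shows "corr V f i j j k = t" "corr V f j i j k = t" "corr V f i j k j = t" "corr V f j i k j = t"
proof -
  show "corr V f i j j k = t"
    using corr_three_cycle[of V i j k f] assms by (simp add: swap_corr_same)
  then show "corr V f j i j k = t" "corr V f i j k j = t" "corr V f j i k j = t"
    by (metis corr_commute)+
qed

text \<open>
  Sums of \<open>cycle_term\<close> against weights of sum zero vanish, since one of the four indices is free. The values on
  repeated indices are chosen such that \<open>octopus_kernel\<close> below, the symmetrisation of
  the coefficients of \<open>R\<^sup>2 - 2 N R\<close>, vanishes as soon as two indices coincide.
\<close>

definition cycle_term :: "'a set \<Rightarrow> ('a set \<Rightarrow> real) \<Rightarrow> 'a \<Rightarrow> 'a \<Rightarrow> 'a \<Rightarrow> real" where
  "cycle_term V f i j k =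
     (if distinct [i, j, k] then 4 * corr V f i j j k - (\<Sum>A\<in>Pow V. (f A)\<^sup>2)
      else if i = j \<and> j = k then - 3 * (\<Sum>A\<in>Pow V. (f A)\<^sup>2)
      else (\<Sum>A\<in>Pow V. (f A)\<^sup>2)) / 3"

lemma cycle_term_perm:
  assumes "finite V" "i \<in> V" "j \<in> V" "k \<in> V"
  shows "cycle_term V f j i k = cycle_term V f i j k" "cycle_term V f i k j = cycle_term V f i j k"
proof -
  have "corr V f j i i k = corr V f i j j k" "corr V f i k k j = corr V f i j j k" if "distinct [i, j, k]"
    using corr_shared(1)[of V i j k f] corr_shared(1)[of V j i k f] corr_shared(1)[of V i k j f] that assms
    by (auto simp: swap_corr_commute)
  then show "cycle_term V f j i k = cycle_term V f i j k" "cycle_term V f i k j = cycle_term V f i j k"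
    unfolding cycle_term_def by auto
qed

definition octopus_kernel :: "'a set \<Rightarrow> ('a set \<Rightarrow> real) \<Rightarrow> 'a \<Rightarrow> 'a \<Rightarrow> 'a \<Rightarrow> 'a \<Rightarrow> real" where
  "octopus_kernel V f i j k l =
     (corr V f i j k l + corr V f i k j l + corr V f i l j k) / 3
     - (of_bool (k = l) * swap_corr V f i j + of_bool (i = j) * swap_corr V f k l
        + of_bool (j = l) * swap_corr V f i k + of_bool (i = k) * swap_corr V f j l
        + of_bool (j = k) * swap_corr V f i l + of_bool (i = l) * swap_corr V f j k) / 3
     - (cycle_term V f i j k + cycle_term V f i j l + cycle_term V f i k l + cycle_term V f j k l) / 4"

text \<open>The three adjacent exchanges generate all permutations of the indices.\<close>

lemma octopus_kernel_perm:
  assumes V: "finite V" "i \<in> V" "j \<in> V" "k \<in> V" "l \<in> V"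
  shows "octopus_kernel V f j i k l = octopus_kernel V f i j k l"
    "octopus_kernel V f i k j l = octopus_kernel V f i j k l"
    "octopus_kernel V f i j l k = octopus_kernel V f i j k l"
proof -
  have corr: "corr V f j i k l = corr V f i j k l" "corr V f j k i l = corr V f i l j k" "corr V f j l i k = corr V f i k j l"
    "corr V f i l k j = corr V f i l j k" "corr V f i j l k = corr V f i j k l"
    by (metis corr_commute)+
  have swp: "swap_corr V f a b = swap_corr V f b a" for a b by (rule swap_corr_commute)
  note cyc = cycle_term_perm[OF V(1)]
  have c1: "cycle_term V f j i k = cycle_term V f i j k" "cycle_term V f j i l = cycle_term V f i j l"
    "cycle_term V f i k j = cycle_term V f i j k" "cycle_term V f k j l = cycle_term V f j k l"
    "cycle_term V f i l k = cycle_term V f i k l" "cycle_term V f j l k = cycle_term V f j k l"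
    using V by (simp_all only: cyc)
  show "octopus_kernel V f j i k l = octopus_kernel V f i j k l"
    unfolding octopus_kernel_def corr c1 swp[of j i]
    by (simp only: eq_commute[of j i] add_ac)
  show "octopus_kernel V f i k j l = octopus_kernel V f i j k l"
    unfolding octopus_kernel_def corr c1 swp[of k j]
    by (simp only: eq_commute[of k j] add_ac)
  show "octopus_kernel V f i j l k = octopus_kernel V f i j k l"
    unfolding octopus_kernel_def corr c1 swp[of l k]
    by (simp only: eq_commute[of l k] add_ac)
qed

text \<open>By symmetry the coinciding pair may be moved to the front; there the values given to
  \<open>cycle_term\<close> make everything cancel.\<close>

lemma octopus_kernel_not_distinct:
  assumes V: "finite V" "i \<in> V" "j \<in> V" "k \<in> V" "l \<in> V" and nd: "\<not> distinct [i, j, k, l]"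
  shows "octopus_kernel V f i j k l = 0"
proof -
  have same: "corr V f a b a b = (\<Sum>A\<in>Pow V. (f A)\<^sup>2)" if "a \<in> V" "b \<in> V" for a b
    using corr_same[OF that, of f] by (simp add: power2_eq_square)
  have *: "octopus_kernel V f a a b c = 0" if abc: "a \<in> V" "b \<in> V" "c \<in> V" for a b c
  proof -
    define n where "n = (\<Sum>A\<in>Pow V. (f A)\<^sup>2)"
    consider "distinct [a, b, c]" | "b = c" "a \<noteq> b" | "a = b" "a \<noteq> c" | "a = c" "a \<noteq> b" | "a = b" "b = c"
      by auto
    then show ?thesis
    proof cases
      case 1
      have "corr V f a b a c = corr V f a b b c" "corr V f a c a b = corr V f a b b c"
        using corr_shared(1)[of V a b c f] corr_shared(2)[of V b a c f] corr_shared(2)[of V c a b f] 1 abc V(1)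
        by (auto simp: swap_corr_commute)
      with 1 show ?thesis
        by (simp add: octopus_kernel_def cycle_term_def swap_corr_same n_def[symmetric]
            add_divide_distrib diff_divide_distrib)
    qed (simp_all add: octopus_kernel_def cycle_term_def same abc swap_corr_same n_def[symmetric])
  qed
  consider "i = j" | "i = k" | "i = l" | "j = k" | "j = l" | "k = l" using nd by auto
  then show ?thesis
    by cases (use V * octopus_kernel_perm[OF V(1)] in \<open>metis\<close>)+
qed

lemma octopus_kernel_distinct:
  assumes V: "finite V" "i \<in> V" "j \<in> V" "k \<in> V" "l \<in> V" and d: "distinct [i, j, k, l]"
  shows "octopus_kernel V f i j k l = (\<Sum>E\<in>Pow (V - {i, j, k, l}). pairing_gap f E i j k l) / 3"
proof -
  have "(\<Sum>E\<in>Pow (V - {i, j, k, l}). pairing_gap f E i j k l) =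
     corr V f i i i i + (corr V f i j k l + corr V f i k j l + corr V f i l j k)
     - (corr V f i j j k + corr V f i j j l + corr V f i k k l + corr V f j k k l)"
    by (rule sum_pairing_gap) (use assms in auto)
  then show ?thesis using d
    by (simp add: octopus_kernel_def cycle_term_def swap_corr_same field_simps)
qed

lemma octopus_kernel_nonneg:
  assumes "finite V" "i \<in> V" "j \<in> V" "k \<in> V" "l \<in> V"
  shows "octopus_kernel V f i j k l \<ge> 0"
proof (cases "distinct [i, j, k, l]")
  case True
  show ?thesis
    unfolding octopus_kernel_distinct[OF assms True] by (simp add: sum_nonneg pairing_gap_nonneg)
qed (simp add: octopus_kernel_not_distinct[OF assms])

text \<open>The five-point inequality is summed over the part \<open>E\<close> of a set outside the
  five points. The kernel of \<open>i, j, k, l\<close> also runs over sets containing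
  \<open>z\<close>, so that sets with two and with three of the five points occur.\<close>

lemma octopus_kernel_five_points:
  assumes V: "finite V" "z \<in> V" "i \<in> V" "j \<in> V" "k \<in> V" "l \<in> V" and z: "z \<notin> {i, j, k, l}"
  shows "octopus_kernel V f i j k l \<le> octopus_kernel V f z i j k + octopus_kernel V f z i j l
     + octopus_kernel V f z i k l + octopus_kernel V f z j k l"
proof (cases "distinct [i, j, k, l]")
  case False
  then show ?thesis
    using V by (simp add: octopus_kernel_not_distinct[OF V(1,3-6) False] octopus_kernel_nonneg add_nonneg_nonneg)
next
  case True
  define W where "W = V - {z, i, j, k, l}"
  have W: "finite W" "z \<notin> W" "i \<notin> W" "j \<notin> W" "k \<notin> W" "l \<notin> W" using V by (auto simp: W_def)
  have sets: "V - {i, j, k, l} = insert z W" "V - {z, i, j, k} = insert l W" "V - {z, i, j, l} = insert k W"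
    "V - {z, i, k, l} = insert j W" "V - {z, j, k, l} = insert i W"
    using V z True by (auto simp: W_def)
  have d: "distinct [z, i, j, k]" "distinct [z, i, j, l]" "distinct [z, i, k, l]" "distinct [z, j, k, l]"
    using True z by auto
  have two: "pairing_gap f E i j k l \<le> pairing_gap f E z i j k + pairing_gap f E z i j l
      + pairing_gap f E z i k l + pairing_gap f E z j k l" for E
    using five_point_sum_of_squares[where
        ab = "f (insert i (insert j E))" and ac = "f (insert i (insert k E))" and ad = "f (insert i (insert l E))" and
        cd = "f (insert k (insert l E))" and bd = "f (insert j (insert l E))" and bc = "f (insert j (insert k E))" and
        a = "f (insert z (insert i E))" and b = "f (insert z (insert j E))" and
        c = "f (insert z (insert k E))" and d = "f (insert z (insert l E))"]
    unfolding pairing_gap_def Let_def by (simp add: insert_commute)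
  \<comment> \<open>A set with three of the five points is named by the two points that it misses;
    in these variables the inequality is the same.\<close>
  have three: "pairing_gap f (insert z E) i j k l \<le> pairing_gap f (insert l E) z i j k + pairing_gap f (insert k E) z i j l
      + pairing_gap f (insert j E) z i k l + pairing_gap f (insert i E) z j k l" for E
    using five_point_sum_of_squares[where
        ab = "f (insert k (insert l (insert z E)))" and ac = "f (insert j (insert l (insert z E)))" and
        ad = "f (insert j (insert k (insert z E)))" and cd = "f (insert i (insert j (insert z E)))" and
        bd = "f (insert i (insert k (insert z E)))" and bc = "f (insert i (insert l (insert z E)))" and
        a = "f (insert j (insert k (insert l E)))" and b = "f (insert i (insert k (insert l E)))" and
        c = "f (insert i (insert j (insert l E)))" and d = "f (insert i (insert j (insert k E)))"]
    unfolding pairing_gap_def Let_def by (simp add: insert_commute ac_simps)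
  have "(\<Sum>E\<in>Pow W. pairing_gap f E i j k l + pairing_gap f (insert z E) i j k l) \<le>
     (\<Sum>E\<in>Pow W. (pairing_gap f E z i j k + pairing_gap f (insert l E) z i j k)
      + (pairing_gap f E z i j l + pairing_gap f (insert k E) z i j l)
      + (pairing_gap f E z i k l + pairing_gap f (insert j E) z i k l)
      + (pairing_gap f E z j k l + pairing_gap f (insert i E) z j k l))"
    by (rule sum_mono) (use two three in \<open>smt (verit)\<close>)
  then show ?thesis
    using V True d W by (simp add: octopus_kernel_distinct sets sum_Pow_insert sum.distrib add_divide_distrib del: distinct.simps)
qed

section \<open>Fourfold sums against products of weights\<close>

definition quad_sum :: "'a set \<Rightarrow> ('a \<Rightarrow> real) \<Rightarrow> ('a \<Rightarrow> 'a \<Rightarrow> 'a \<Rightarrow> 'a \<Rightarrow> real) \<Rightarrow> real" where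
  "quad_sum V c g = (\<Sum>i\<in>V. \<Sum>j\<in>V. \<Sum>k\<in>V. \<Sum>l\<in>V. c i * c j * c k * c l * g i j k l)"

lemma quad_sum_perm:
  "quad_sum V c (\<lambda>i j k l. g j i k l) = quad_sum V c g"
  "quad_sum V c (\<lambda>i j k l. g i k j l) = quad_sum V c g"
  "quad_sum V c (\<lambda>i j k l. g i j l k) = quad_sum V c g"
proof -
  show "quad_sum V c (\<lambda>i j k l. g j i k l) = quad_sum V c g"
    unfolding quad_sum_def by (subst sum.swap) (simp add: mult_ac)
  show "quad_sum V c (\<lambda>i j k l. g i k j l) = quad_sum V c g"
    unfolding quad_sum_def by (rule sum.cong[OF refl], subst sum.swap) (simp add: mult_ac)
  show "quad_sum V c (\<lambda>i j k l. g i j l k) = quad_sum V c g"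
    unfolding quad_sum_def by (rule sum.cong[OF refl], rule sum.cong[OF refl], subst sum.swap) (simp add: mult_ac)
qed

lemma quad_sum_linear:
  "quad_sum V c (\<lambda>i j k l. g i j k l + h i j k l) = quad_sum V c g + quad_sum V c h"
  "quad_sum V c (\<lambda>i j k l. g i j k l - h i j k l) = quad_sum V c g - quad_sum V c h"
  "quad_sum V c (\<lambda>i j k l. g i j k l / r) = quad_sum V c g / r"
  unfolding quad_sum_def by (simp_all add: algebra_simps sum.distrib sum_subtractf sum_divide_distrib)

text \<open>This is used in both directions: to make terms vanish if the weights have sum zero, and
  to trade the negative weight at \<open>z\<close> for a fourth index.\<close>

lemma quad_sum_last_free:
  "quad_sum V c (\<lambda>i j k l. h i j k) =
     sum c V * (\<Sum>i\<in>V. \<Sum>j\<in>V. \<Sum>k\<in>V. c i * c j * c k * h i j k)"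
  unfolding quad_sum_def by (simp add: sum_distrib_left sum_distrib_right mult_ac)

lemma quad_sum_corr:
  "quad_sum V c (corr V f) = (\<Sum>A\<in>Pow V. (\<Sum>i\<in>V. \<Sum>j\<in>V. c i * c j * f (swap_tokens i j A))\<^sup>2)"
proof -
  have "(\<Sum>i\<in>V. \<Sum>j\<in>V. c i * c j * f (swap_tokens i j A))\<^sup>2 =
      (\<Sum>i\<in>V. \<Sum>j\<in>V. \<Sum>k\<in>V. \<Sum>l\<in>V. c i * c j * c k * c l * (f (swap_tokens i j A) * f (swap_tokens k l A)))" for A
  proof -
    have "(\<Sum>i\<in>V. \<Sum>j\<in>V. c i * c j * f (swap_tokens i j A))\<^sup>2 =
      (\<Sum>i\<in>V. \<Sum>j\<in>V. c i * c j * f (swap_tokens i j A) * (\<Sum>k\<in>V. \<Sum>l\<in>V. c k * c l * f (swap_tokens k l A)))"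
      unfolding power2_eq_square sum_distrib_right ..
    also have "\<dots> = (\<Sum>i\<in>V. \<Sum>j\<in>V. \<Sum>k\<in>V. \<Sum>l\<in>V.
        c i * c j * c k * c l * (f (swap_tokens i j A) * f (swap_tokens k l A)))"
      unfolding sum_distrib_left by (simp add: mult_ac)
    finally show ?thesis .
  qed
  then have "(\<Sum>A\<in>Pow V. (\<Sum>i\<in>V. \<Sum>j\<in>V. c i * c j * f (swap_tokens i j A))\<^sup>2) =
      (\<Sum>A\<in>Pow V. \<Sum>i\<in>V. \<Sum>j\<in>V. \<Sum>k\<in>V. \<Sum>l\<in>V. c i * c j * c k * c l * (f (swap_tokens i j A) * f (swap_tokens k l A)))"
    by simp
  also have "\<dots> = quad_sum V c (corr V f)"
    unfolding quad_sum_def corr_def sum_distrib_left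
    by (subst sum.swap, rule sum.cong[OF refl], subst sum.swap, rule sum.cong[OF refl],
        subst sum.swap, rule sum.cong[OF refl], subst sum.swap, rule refl)
  finally show ?thesis ..
qed

lemma quad_sum_diagonal:
  assumes "finite V"
  shows "quad_sum V c (\<lambda>i j k l. of_bool (k = l) * h i j) =
     (\<Sum>k\<in>V. (c k)\<^sup>2) * (\<Sum>i\<in>V. \<Sum>j\<in>V. c i * c j * h i j)"
proof -
  have "(\<Sum>l\<in>V. c i * c j * c k * c l * (of_bool (k = l) * h i j)) = (c k)\<^sup>2 * (c i * c j * h i j)"
    if "k \<in> V" for i j k
  proof -
    have "(\<Sum>l\<in>V. c i * c j * c k * c l * (of_bool (k = l) * h i j)) =
        (\<Sum>l\<in>V. if k = l then c i * c j * c k * c l * h i j else 0)"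
      by (intro sum.cong) auto
    then show ?thesis using assms that by (simp add: power2_eq_square mult_ac)
  qed
  then have "quad_sum V c (\<lambda>i j k l. of_bool (k = l) * h i j) =
      (\<Sum>i\<in>V. \<Sum>j\<in>V. \<Sum>k\<in>V. (c k)\<^sup>2 * (c i * c j * h i j))"
    unfolding quad_sum_def by (intro sum.cong refl) blast
  then show ?thesis unfolding sum_distrib_left unfolding sum_distrib_right .
qed

text \<open>Products of weights are symmetric, so symmetrising the coefficients does not change the
  sum, and the \<open>cycle_term\<close> parts have a free index. What remains is the squared norm
  of \<open>R f\<close> minus \<open>2 N\<close> times the quadratic form of
  \<open>R\<close>.\<close>

lemma quad_sum_octopus_kernel:
  assumes "finite V" "sum c V = 0"
  shows "quad_sum V c (octopus_kernel V f) =
    (\<Sum>A\<in>Pow V. (\<Sum>i\<in>V. \<Sum>j\<in>V. c i * c j * f (swap_tokens i j A))\<^sup>2)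
    - 2 * (\<Sum>k\<in>V. (c k)\<^sup>2) * (\<Sum>i\<in>V. \<Sum>j\<in>V. c i * c j * swap_corr V f i j)"
proof -
  define g where "g = corr V f"
  define d where "d = swap_corr V f"
  define u where "u = cycle_term V f"
  let ?H = "quad_sum V c"
  let ?D = "(\<Sum>k\<in>V. (c k)\<^sup>2) * (\<Sum>i\<in>V. \<Sum>j\<in>V. c i * c j * d i j)"
  have g2: "?H (\<lambda>i j k l. g i k j l) = ?H g" by (rule quad_sum_perm)
  have g3: "?H (\<lambda>i j k l. g i l j k) = ?H g"
    using quad_sum_perm(3)[of V c "\<lambda>i j k l. g i k j l"] g2 by simp
  have d1: "?H (\<lambda>i j k l. of_bool (k = l) * d i j) = ?D"
    by (rule quad_sum_diagonal) fact
  have d2: "?H (\<lambda>i j k l. of_bool (j = l) * d i k) = ?D"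
    using quad_sum_perm(2)[of V c "\<lambda>i j k l. of_bool (k = l) * d i j"] d1 by simp
  have d3: "?H (\<lambda>i j k l. of_bool (j = k) * d i l) = ?D"
    using quad_sum_perm(3)[of V c "\<lambda>i j k l. of_bool (j = l) * d i k"] d2 by simp
  have d4: "?H (\<lambda>i j k l. of_bool (i = k) * d j l) = ?D"
    using quad_sum_perm(1)[of V c "\<lambda>i j k l. of_bool (j = k) * d i l"] d3 by simp
  have d5: "?H (\<lambda>i j k l. of_bool (i = l) * d j k) = ?D"
    using quad_sum_perm(3)[of V c "\<lambda>i j k l. of_bool (i = k) * d j l"] d4 by simp
  have d6: "?H (\<lambda>i j k l. of_bool (i = j) * d k l) = ?D"
    using quad_sum_perm(2)[of V c "\<lambda>i j k l. of_bool (i = k) * d j l"] d4 by simp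
  have u1: "?H (\<lambda>i j k l. u i j k) = 0"
    by (simp add: quad_sum_last_free assms)
  have u2: "?H (\<lambda>i j k l. u i j l) = 0"
    using quad_sum_perm(3)[of V c "\<lambda>i j k l. u i j k"] u1 by simp
  have u3: "?H (\<lambda>i j k l. u i k l) = 0"
    using quad_sum_perm(2)[of V c "\<lambda>i j k l. u i j l"] u2 by simp
  have u4: "?H (\<lambda>i j k l. u j k l) = 0"
    using quad_sum_perm(1)[of V c "\<lambda>i j k l. u i k l"] u3 by simp
  have "octopus_kernel V f = (\<lambda>i j k l. (g i j k l + g i k j l + g i l j k) / 3
     - (of_bool (k = l) * d i j + of_bool (i = j) * d k l
        + of_bool (j = l) * d i k + of_bool (i = k) * d j l
        + of_bool (j = k) * d i l + of_bool (i = l) * d j k) / 3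
     - (u i j k + u i j l + u i k l + u j k l) / 4)"
    by (intro ext) (simp add: octopus_kernel_def g_def d_def u_def)
  \<comment> \<open>Six equal diagonal terms divided by 3 give the factor 2.\<close>
  then have "?H (octopus_kernel V f) = ?H g - 2 * ?D"
    by (simp only: quad_sum_linear g2 g3 d1 d2 d3 d4 d5 d6 u1 u2 u3 u4) simp
  then show ?thesis
    by (simp add: g_def d_def quad_sum_corr)
qed

lemma quad_sum_mono:
  assumes "\<And>i. i \<in> V \<Longrightarrow> c i \<ge> 0"
    and "\<And>i j k l. i \<in> V \<Longrightarrow> j \<in> V \<Longrightarrow> k \<in> V \<Longrightarrow> l \<in> V \<Longrightarrow> g i j k l \<le> h i j k l"
  shows "quad_sum V c g \<le> quad_sum V c h"
  unfolding quad_sum_def by (intro sum_mono mult_left_mono) (use assms in auto)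

text \<open>Terms in which \<open>z\<close> occurs twice vanish, and those in which it occurs once
  carry the only negative weight. By the five-point inequality they outweigh the terms on
  \<open>V\<close>.\<close>

lemma quad_sum_octopus_kernel_le_0:
  assumes V: "finite V" "z \<notin> V" and c: "\<And>i. i \<in> V \<Longrightarrow> c i \<ge> 0" and cz: "c z = - sum c V"
  shows "quad_sum (insert z V) c (octopus_kernel (insert z V) f) \<le> 0"
proof -
  define K where "K = octopus_kernel (insert z V) f"
  let ?V = "insert z V"
  have K0: "K z z k l = 0" "K z k z l = 0" "K z k l z = 0" "K k z z l = 0" "K k z l z = 0" "K k l z z = 0"
    if "k \<in> ?V" "l \<in> ?V" for k l
    unfolding K_def by (rule octopus_kernel_not_distinct; use that V in simp)+
  have Kp: "K i z k l = K z i k l" "K i k z l = K z i k l" "K i k l z = K z i k l"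
    if "i \<in> ?V" "k \<in> ?V" "l \<in> ?V" for i k l
    unfolding K_def using that V(1)
    by (metis finite_insert insertI1 octopus_kernel_perm)+
  let ?T = "(\<Sum>i\<in>V. \<Sum>j\<in>V. \<Sum>k\<in>V. c i * c j * c k * K z i j k)"
  \<comment> \<open>The factor 4 counts the positions of a single index \<open>z\<close>.\<close>
  have "quad_sum ?V c K = quad_sum V c K + 4 * (c z * ?T)"
  proof -
    define G where "G i j k l = c i * c j * c k * c l * K i j k l" for i j k l
    have G0: "G z z k l = 0" "G z k z l = 0" "G z k l z = 0" "G k z z l = 0" "G k z l z = 0" "G k l z z = 0"
      if "k \<in> ?V" "l \<in> ?V" for k l
      using that by (simp_all add: G_def K0)
    have Gp: "G i z k l = G z i k l" "G i k z l = G z i k l" "G i k l z = G z i k l"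
      if "i \<in> V" "k \<in> V" "l \<in> V" for i k l
      using that by (simp_all add: G_def Kp)
    have "(\<Sum>i\<in>?V. \<Sum>j\<in>?V. \<Sum>k\<in>?V. \<Sum>l\<in>?V. G i j k l) =
        (\<Sum>i\<in>V. \<Sum>j\<in>V. \<Sum>k\<in>V. \<Sum>l\<in>V. G i j k l) + 4 * (\<Sum>i\<in>V. \<Sum>j\<in>V. \<Sum>k\<in>V. G z i j k)"
      using V by (simp add: G0 Gp sum.distrib)
    moreover have "(\<Sum>i\<in>V. \<Sum>j\<in>V. \<Sum>k\<in>V. G z i j k) = c z * ?T"
      unfolding G_def sum_distrib_left by (simp add: mult.assoc)
    ultimately show ?thesis by (simp add: quad_sum_def G_def)
  qed
  \<comment> \<open>The weight \<open>c z = - sum c V\<close> supplies a free fourth index. Letting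
    each of the four indices be the free one then matches the right-hand side of the five-point
    inequality.\<close>
  also have "4 * (c z * ?T) = - 4 * quad_sum V c (\<lambda>i j k l. K z i j k)"
    by (simp add: quad_sum_last_free cz)
  also have "\<dots> = - quad_sum V c (\<lambda>i j k l. K z i j k + K z i j l + K z i k l + K z j k l)"
  proof -
    have 1: "quad_sum V c (\<lambda>i j k l. K z i j l) = quad_sum V c (\<lambda>i j k l. K z i j k)"
      by (rule quad_sum_perm)
    have 2: "quad_sum V c (\<lambda>i j k l. K z i k l) = quad_sum V c (\<lambda>i j k l. K z i j k)"
      using quad_sum_perm(2)[of V c "\<lambda>i j k l. K z i j l"] 1 by simp
    have 3: "quad_sum V c (\<lambda>i j k l. K z j k l) = quad_sum V c (\<lambda>i j k l. K z i j k)"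
      using quad_sum_perm(1)[of V c "\<lambda>i j k l. K z i k l"] 2 by simp
    show ?thesis by (simp add: quad_sum_linear 1 2 3)
  qed
  also have "quad_sum V c K + \<dots> \<le> 0"
  proof -
    have "quad_sum V c K \<le> quad_sum V c (\<lambda>i j k l. K z i j k + K z i j l + K z i k l + K z j k l)"
      by (rule quad_sum_mono, fact c)
         (unfold K_def, rule octopus_kernel_five_points, use V in auto)
    then show ?thesis by simp
  qed
  finally show ?thesis by (simp add: K_def)
qed

section \<open>Energies and the octopus inequality\<close>

definition swap_energy :: "'a set \<Rightarrow> ('a set \<Rightarrow> real) \<Rightarrow> 'a \<Rightarrow> 'a \<Rightarrow> real" where
  "swap_energy V f i j = (\<Sum>A\<in>Pow V. (f A - f (swap_tokens i j A))\<^sup>2)"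

lemma swap_energy_commute: "swap_energy V f i j = swap_energy V f j i"
  by (simp add: swap_energy_def swap_tokens_commute)

lemma swap_energy_nonneg [simp]: "swap_energy V f i j \<ge> 0"
  by (simp add: swap_energy_def sum_nonneg)

lemma swap_energy_same [simp]: "swap_energy V f i i = 0"
  by (simp add: swap_energy_def)

lemma swap_energy_eq_corr:
  assumes "i \<in> V" "j \<in> V"
  shows "swap_energy V f i j = 2 * (\<Sum>A\<in>Pow V. (f A)\<^sup>2) - 2 * swap_corr V f i j"
proof -
  have "swap_energy V f i j = (\<Sum>A\<in>Pow V. (f A)\<^sup>2) + (\<Sum>A\<in>Pow V. (f (swap_tokens i j A))\<^sup>2)
      - 2 * swap_corr V f i j"
    unfolding swap_energy_def swap_corr_def
    by (simp add: power2_diff sum.distrib sum_subtractf sum_distrib_left mult_ac)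
  then show ?thesis
    using sum_Pow_swap_tokens[OF assms, of "\<lambda>A. (f A)\<^sup>2"] by simp
qed

text \<open>With the weight \<open>- sum a V\<close> at \<open>z\<close> all weights sum to zero, so
  \<open>2 N R\<close> dominates \<open>R^2\<close>. As \<open>N > 0\<close>, the form of
  \<open>R\<close> is nonnegative.\<close>

theorem octopus_inequality:
  assumes V: "finite V" "z \<notin> V" and a: "\<And>i. i \<in> V \<Longrightarrow> a i \<ge> 0" and S: "sum a V > 0"
  shows "(\<Sum>i\<in>V. \<Sum>j\<in>V. a i * a j * swap_energy (insert z V) f i j)
    \<le> 2 * sum a V * (\<Sum>i\<in>V. a i * swap_energy (insert z V) f z i)"
proof -
  define U where "U = insert z V"
  define c where "c = a(z := - sum a V)"
  define n where "n = (\<Sum>A\<in>Pow U. (f A)\<^sup>2)"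
  let ?S = "sum a V"
  have ca: "c i = a i" if "i \<in> V" for i using that V by (auto simp: c_def)
  have sca: "sum c V = ?S" by (rule sum.cong) (auto simp: ca)
  have cz: "c z = - ?S" by (simp add: c_def)
  let ?R = "\<Sum>i\<in>U. \<Sum>j\<in>U. c i * c j * swap_corr U f i j"
  let ?N = "\<Sum>k\<in>U. (c k)\<^sup>2"
  have "0 \<le> 2 * ?N * ?R"
  proof -
    have "quad_sum U c (octopus_kernel U f) \<le> 0"
      unfolding U_def by (rule quad_sum_octopus_kernel_le_0) (use V a ca sca cz in auto)
    moreover have "quad_sum U c (octopus_kernel U f) =
      (\<Sum>A\<in>Pow U. (\<Sum>i\<in>U. \<Sum>j\<in>U. c i * c j * f (swap_tokens i j A))\<^sup>2) - 2 * ?N * ?R"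
      by (rule quad_sum_octopus_kernel) (use V sca cz in \<open>auto simp: U_def\<close>)
    moreover have "0 \<le> (\<Sum>A\<in>Pow U. (\<Sum>i\<in>U. \<Sum>j\<in>U. c i * c j * f (swap_tokens i j A))\<^sup>2)"
      by (simp add: sum_nonneg)
    ultimately show ?thesis by linarith
  qed
  moreover have "?N > 0"
    using V S cz by (simp add: U_def add_pos_nonneg sum_nonneg)
  ultimately have R: "0 \<le> ?R" by (simp add: zero_le_mult_iff)
  \<comment> \<open>Separating \<open>z\<close> from \<open>V\<close> shows that the difference of
    the two sides of the claim is \<open>2 * ?R\<close>, the norms \<open>n\<close> being absorbed
    in the energies.\<close>
  have Req: "?R = ?S\<^sup>2 * n - 2 * ?S * (\<Sum>i\<in>V. a i * swap_corr U f z i)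
      + (\<Sum>i\<in>V. \<Sum>j\<in>V. a i * a j * swap_corr U f i j)"
  proof -
    have "?R = c z * c z * n + (\<Sum>i\<in>V. c z * c i * swap_corr U f z i)
        + ((\<Sum>i\<in>V. c i * c z * swap_corr U f i z) + (\<Sum>i\<in>V. \<Sum>j\<in>V. c i * c j * swap_corr U f i j))"
      using V by (simp add: U_def n_def swap_corr_same sum.distrib)
    also have "(\<Sum>i\<in>V. c i * c z * swap_corr U f i z) = (\<Sum>i\<in>V. c z * c i * swap_corr U f z i)"
      by (simp add: swap_corr_commute mult_ac)
    also have "(\<Sum>i\<in>V. c z * c i * swap_corr U f z i) = - ?S * (\<Sum>i\<in>V. a i * swap_corr U f z i)"
      unfolding sum_distrib_left by (intro sum.cong refl) (simp add: ca cz)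
    also have "(\<Sum>i\<in>V. \<Sum>j\<in>V. c i * c j * swap_corr U f i j) = (\<Sum>i\<in>V. \<Sum>j\<in>V. a i * a j * swap_corr U f i j)"
      by (simp add: ca)
    finally show ?thesis by (simp add: cz power2_eq_square algebra_simps)
  qed
  have "(\<Sum>i\<in>V. \<Sum>j\<in>V. a i * a j * swap_energy U f i j) =
      (\<Sum>i\<in>V. \<Sum>j\<in>V. a i * a j * (2 * n - 2 * swap_corr U f i j))"
    by (intro sum.cong refl) (simp add: swap_energy_eq_corr U_def n_def)
  also have "\<dots> = 2 * ?S\<^sup>2 * n - 2 * (\<Sum>i\<in>V. \<Sum>j\<in>V. a i * a j * swap_corr U f i j)"
    by (simp add: right_diff_distrib sum_subtractf power2_eq_square sum_distrib_left sum_distrib_right mult_ac)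
  finally have L: "(\<Sum>i\<in>V. \<Sum>j\<in>V. a i * a j * swap_energy U f i j) =
     2 * ?S\<^sup>2 * n - 2 * (\<Sum>i\<in>V. \<Sum>j\<in>V. a i * a j * swap_corr U f i j)" .
  have "(\<Sum>i\<in>V. a i * swap_energy U f z i) = (\<Sum>i\<in>V. a i * (2 * n - 2 * swap_corr U f z i))"
    by (intro sum.cong refl) (simp add: swap_energy_eq_corr U_def n_def)
  also have "\<dots> = 2 * ?S * n - 2 * (\<Sum>i\<in>V. a i * swap_corr U f z i)"
    by (simp add: right_diff_distrib sum_subtractf sum_distrib_left sum_distrib_right mult_ac)
  finally have "2 * ?S * (\<Sum>i\<in>V. a i * swap_energy U f z i) =
      2 * ?S * (2 * ?S * n - 2 * (\<Sum>i\<in>V. a i * swap_corr U f z i))" by (rule arg_cong)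
  then have "2 * ?S * (\<Sum>i\<in>V. a i * swap_energy U f z i) =
      4 * ?S\<^sup>2 * n - 4 * ?S * (\<Sum>i\<in>V. a i * swap_corr U f z i)"
    by (simp only: power2_eq_square right_diff_distrib)
  with L R Req have "(\<Sum>i\<in>V. \<Sum>j\<in>V. a i * a j * swap_energy U f i j)
    \<le> 2 * ?S * (\<Sum>i\<in>V. a i * swap_energy U f z i)" by linarith
  then show ?thesis by (simp only: U_def)
qed

section \<open>The spectral gap of the exclusion process\<close>

text \<open>
  The double sums count every edge twice, and \<open>swap_energy\<close> counts every pair of
  configurations twice, hence the factors 2 and 4.
\<close>

definition walk_gap :: "'a set \<Rightarrow> ('a \<Rightarrow> 'a \<Rightarrow> real) \<Rightarrow> real \<Rightarrow> bool" where
  "walk_gap V c t \<longleftrightarrow> (\<forall>x. sum x V = 0 \<longrightarrow>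
     2 * t * (\<Sum>v\<in>V. (x v)\<^sup>2) \<le> (\<Sum>u\<in>V. \<Sum>v\<in>V. c u v * (x u - x v)\<^sup>2))"

definition token_energy :: "'a set \<Rightarrow> ('a \<Rightarrow> 'a \<Rightarrow> real) \<Rightarrow> ('a set \<Rightarrow> real) \<Rightarrow> real" where
  "token_energy V c f = (\<Sum>u\<in>V. \<Sum>v\<in>V. c u v * swap_energy V f u v)"

definition token_gap :: "'a set \<Rightarrow> ('a \<Rightarrow> 'a \<Rightarrow> real) \<Rightarrow> nat \<Rightarrow> real \<Rightarrow> bool" where
  "token_gap V c k t \<longleftrightarrow> (\<forall>f. (\<forall>A\<subseteq>V. card A \<noteq> k \<longrightarrow> f A = 0) \<longrightarrow> sum f (Pow V) = 0 \<longrightarrow>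
     4 * t * (\<Sum>A\<in>Pow V. (f A)\<^sup>2) \<le> token_energy V c f)"

text \<open>The adjoint of \<open>token_lift k\<close> on functions supported on sets of size
  \<open>k\<close>. Functions of mass zero everywhere are therefore orthogonal to all lifts.\<close>

definition mass :: "'a set \<Rightarrow> ('a set \<Rightarrow> real) \<Rightarrow> 'a \<Rightarrow> real" where
  "mass V f v = (\<Sum>A\<in>Pow V. of_bool (v \<in> A) * f A)"

definition token_lift :: "nat \<Rightarrow> ('a \<Rightarrow> real) \<Rightarrow> 'a set \<Rightarrow> real" where
  "token_lift k x A = (if card A = k then sum x A else 0)"

section \<open>Lifts of vertex functions\<close>

lemma sum_of_bool_mem:
  assumes "finite V" "A \<subseteq> V"
  shows "(\<Sum>v\<in>V. of_bool (v \<in> A) * x v) = (sum x A :: real)"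
proof -
  have "(\<Sum>v\<in>V. of_bool (v \<in> A) * x v) = (\<Sum>v\<in>V. if v \<in> A then x v else 0)"
    by (intro sum.cong) auto
  also have "\<dots> = sum x (V \<inter> A)" using assms by (simp add: sum.inter_restrict)
  finally show ?thesis using assms by (simp add: Int_absorb1)
qed

lemma sum_mass:
  assumes "finite V"
  shows "(\<Sum>v\<in>V. y v * mass V f v) = (\<Sum>A\<in>Pow V. f A * sum y A)"
proof -
  have "(\<Sum>v\<in>V. y v * mass V f v) = (\<Sum>A\<in>Pow V. \<Sum>v\<in>V. y v * (of_bool (v \<in> A) * f A))"
    unfolding mass_def sum_distrib_left by (rule sum.swap)
  also have "\<dots> = (\<Sum>A\<in>Pow V. f A * (\<Sum>v\<in>V. of_bool (v \<in> A) * y v))"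
    by (simp add: sum_distrib_left mult_ac)
  also have "\<dots> = (\<Sum>A\<in>Pow V. f A * sum y A)"
    by (intro sum.cong refl) (simp only: sum_of_bool_mem[OF assms PowD])
  finally show ?thesis .
qed

lemma card_subsets_separating:
  assumes "finite V" "u \<in> V" "v \<in> V" "u \<noteq> v" "k \<ge> 1"
  shows "card {A. A \<subseteq> V \<and> card A = k \<and> v \<in> A \<and> u \<notin> A} = (card V - 2) choose (k - 1)"
proof -
  have "bij_betw (insert v) {B. B \<subseteq> V - {u, v} \<and> card B = k - 1}
      {A. A \<subseteq> V \<and> card A = k \<and> v \<in> A \<and> u \<notin> A}"
  proof (rule bij_betw_byWitness[where f' = "\<lambda>A. A - {v}"])
    show "insert v ` {B. B \<subseteq> V - {u, v} \<and> card B = k - 1} \<subseteq> {A. A \<subseteq> V \<and> card A = k \<and> v \<in> A \<and> u \<notin> A}"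
      using assms by (auto simp: card_insert_if finite_subset[of _ "V - {u, v}"])
  qed (use assms in \<open>auto simp: card_Diff_singleton\<close>)
  then have "card {A. A \<subseteq> V \<and> card A = k \<and> v \<in> A \<and> u \<notin> A} = card {B. B \<subseteq> V - {u, v} \<and> card B = k - 1}"
    by (simp add: bij_betw_same_card)
  also have "\<dots> = card (V - {u, v}) choose (k - 1)"
    using assms by (intro n_subsets) auto
  also have "card (V - {u, v}) = card V - 2"
    using assms by (simp add: card_Diff_subset)
  finally show ?thesis .
qed

text \<open>The coefficient of \<open>x u\<close> counts the \<open>k\<close>-sets containing both
  \<open>u\<close> and \<open>v\<close>: those containing \<open>v\<close> minus those that also
  avoid \<open>u\<close>. The first number does not depend on \<open>u\<close> and drops out since
  \<open>x\<close> has sum zero; the second is the binomial coefficient, except for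
  \<open>u = v\<close>, where it is 0.\<close>

lemma mass_lift:
  assumes V: "finite V" "v \<in> V" and k: "k \<ge> 1" and x: "sum x V = 0"
  shows "mass V (token_lift k x) v = real ((card V - 2) choose (k - 1)) * x v"
proof -
  define K where "K = real ((card V - 2) choose (k - 1))"
  define b where "b A = (of_bool (v \<in> A \<and> card A = k) :: real)" for A
  have cnt: "(\<Sum>A\<in>Pow V. b A * of_bool (u \<notin> A)) = K - K * of_bool (u = v)" if "u \<in> V" for u
  proof -
    have "(\<Sum>A\<in>Pow V. b A * of_bool (u \<notin> A)) = (\<Sum>A\<in>Pow V. of_bool (card A = k \<and> v \<in> A \<and> u \<notin> A))"
      by (intro sum.cong) (auto simp: b_def)
    also have "\<dots> = real (card {A. A \<subseteq> V \<and> card A = k \<and> v \<in> A \<and> u \<notin> A})"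
      using V by (simp add: Int_def Pow_def)
    also have "\<dots> = K - K * of_bool (u = v)"
      using card_subsets_separating[of V u v k] that V k by (auto simp: K_def)
    finally show ?thesis .
  qed
  have "mass V (token_lift k x) v = (\<Sum>A\<in>Pow V. b A * (\<Sum>u\<in>V. of_bool (u \<in> A) * x u))"
    unfolding mass_def using V
    by (intro sum.cong refl) (simp only: sum_of_bool_mem PowD, simp add: b_def token_lift_def)
  also have "\<dots> = (\<Sum>u\<in>V. \<Sum>A\<in>Pow V. b A * (of_bool (u \<in> A) * x u))"
    unfolding sum_distrib_left by (rule sum.swap)
  also have "\<dots> = (\<Sum>u\<in>V. x u * (\<Sum>A\<in>Pow V. b A) - x u * (\<Sum>A\<in>Pow V. b A * of_bool (u \<notin> A)))"
  proof (rule sum.cong[OF refl])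
    fix u
    show "(\<Sum>A\<in>Pow V. b A * (of_bool (u \<in> A) * x u)) =
        x u * (\<Sum>A\<in>Pow V. b A) - x u * (\<Sum>A\<in>Pow V. b A * of_bool (u \<notin> A))"
      unfolding sum_distrib_left sum_subtractf[symmetric] by (intro sum.cong) auto
  qed
  also have "\<dots> = (\<Sum>u\<in>V. x u * (\<Sum>A\<in>Pow V. b A) - x u * (K - K * of_bool (u = v)))"
    by (intro sum.cong refl) (simp add: cnt)
  also have "\<dots> = (\<Sum>u\<in>V. x u * ((\<Sum>A\<in>Pow V. b A) - K) + K * (if u = v then x u else 0))"
    by (intro sum.cong refl) (auto simp: algebra_simps)
  also have "\<dots> = K * x v"
    using V x by (simp add: sum.distrib sum_distrib_right[symmetric] sum_distrib_left[symmetric])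
  finally show ?thesis by (simp add: K_def)
qed

lemma lift_diff_swap:
  assumes "finite V" "A \<subseteq> V" "card A = k"
  shows "token_lift k x A - token_lift k x (swap_tokens u v A) = (x u - x v) * (of_bool (u \<in> A) - of_bool (v \<in> A))"
proof -
  have fin: "finite A" using assms finite_subset by blast
  have move: "sum x A - sum x (swap_tokens a b A) = x a - x b" if "a \<in> A" "b \<notin> A" for a b
    using that fin by (simp add: swap_tokens_move sum.remove[of A a])
  consider "u \<in> A" "v \<in> A" | "u \<notin> A" "v \<notin> A" | "u \<in> A" "v \<notin> A" | "u \<notin> A" "v \<in> A" by blast
  then show ?thesis
  proof cases
    case 4
    then show ?thesis using move[of v u] assms by (simp add: token_lift_def swap_tokens_commute[of u v])
  qed (use assms move in \<open>auto simp: token_lift_def swap_tokens_inside\<close>)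
qed

lemma swap_form_eq:
  assumes "u \<in> V" "v \<in> V"
  shows "(\<Sum>A\<in>Pow V. (g A - g (swap_tokens u v A)) * (h A - h (swap_tokens u v A))) =
     2 * (\<Sum>A\<in>Pow V. g A * (h A - h (swap_tokens u v A)) :: real)"
  using sum_Pow_swap_tokens[OF assms, of "\<lambda>A. g A * (h A - h (swap_tokens u v A))"]
  by (simp add: algebra_simps sum.distrib sum_subtractf)

text \<open>A transposition changes a lift only by a multiple of \<open>x u - x v\<close>, so the
  bilinear energy sees \<open>g\<close> through its masses alone. A function of mass zero is thus
  orthogonal to lifts in the energy of every single pair.\<close>

lemma swap_form_lift:
  assumes V: "finite V" "u \<in> V" "v \<in> V" and g: "\<And>A. A \<subseteq> V \<Longrightarrow> card A \<noteq> k \<Longrightarrow> g A = 0"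
  shows "(\<Sum>A\<in>Pow V. (g A - g (swap_tokens u v A)) * (token_lift k x A - token_lift k x (swap_tokens u v A))) =
     2 * (x u - x v) * (mass V g u - mass V g v)"
proof -
  have "(\<Sum>A\<in>Pow V. g A * (token_lift k x A - token_lift k x (swap_tokens u v A))) =
      (\<Sum>A\<in>Pow V. (x u - x v) * (of_bool (u \<in> A) * g A - of_bool (v \<in> A) * g A))"
  proof (rule sum.cong[OF refl])
    fix A assume "A \<in> Pow V"
    then show "g A * (token_lift k x A - token_lift k x (swap_tokens u v A)) =
        (x u - x v) * (of_bool (u \<in> A) * g A - of_bool (v \<in> A) * g A)"
      using lift_diff_swap[of V A k x u v] g[of A] V by (cases "card A = k") simp_all
  qed
  then show ?thesis
    unfolding swap_form_eq[OF V(2,3)] mass_def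
    by (simp add: sum_distrib_left[symmetric] sum_subtractf)
qed

lemma sum_lift_power2:
  assumes "finite V" "k \<ge> 1" "sum x V = 0"
  shows "(\<Sum>A\<in>Pow V. (token_lift k x A)\<^sup>2) = real ((card V - 2) choose (k - 1)) * (\<Sum>v\<in>V. (x v)\<^sup>2)"
proof -
  have "(\<Sum>A\<in>Pow V. (token_lift k x A)\<^sup>2) = (\<Sum>A\<in>Pow V. token_lift k x A * sum x A)"
    by (intro sum.cong) (auto simp: token_lift_def power2_eq_square)
  also have "\<dots> = (\<Sum>v\<in>V. x v * mass V (token_lift k x) v)"
    using sum_mass[OF assms(1)] by simp
  also have "\<dots> = (\<Sum>v\<in>V. real ((card V - 2) choose (k - 1)) * (x v)\<^sup>2)"
    by (intro sum.cong refl) (simp only: mass_lift[OF assms(1) _ assms(2,3)] power2_eq_square mult_ac)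
  finally show ?thesis by (simp add: sum_distrib_left)
qed

text \<open>The binomial coefficient also scales the norm of a lift, so lifting preserves Rayleigh
  quotients.\<close>

lemma swap_energy_lift:
  assumes V: "finite V" "u \<in> V" "v \<in> V" and k: "k \<ge> 1" and x: "sum x V = 0"
  shows "swap_energy V (token_lift k x) u v = 2 * real ((card V - 2) choose (k - 1)) * (x u - x v)\<^sup>2"
  using swap_form_lift[OF V, of k "token_lift k x" x] assms
  by (simp add: swap_energy_def power2_eq_square mass_lift token_lift_def[of k x] algebra_simps)

lemma token_energy_lift:
  assumes V: "finite V" and k: "k \<ge> 1" and x: "sum x V = 0"
  shows "token_energy V c (token_lift k x) =
    2 * real ((card V - 2) choose (k - 1)) * (\<Sum>u\<in>V. \<Sum>v\<in>V. c u v * (x u - x v)\<^sup>2)"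
  unfolding token_energy_def sum_distrib_left
  by (intro sum.cong refl) (simp only: swap_energy_lift[OF V _ _ k x] mult_ac)

lemma sum_mass_support:
  assumes "finite V" "\<And>A. A \<subseteq> V \<Longrightarrow> card A \<noteq> k \<Longrightarrow> f A = 0"
  shows "(\<Sum>v\<in>V. mass V f v) = real k * sum f (Pow V)"
proof -
  have "(\<Sum>v\<in>V. mass V f v) = (\<Sum>A\<in>Pow V. f A * real (card A))"
    using sum_mass[OF assms(1), of "\<lambda>_. 1" f] by simp
  also have "\<dots> = (\<Sum>A\<in>Pow V. f A * real k)"
    using assms(2) by (intro sum.cong) (metis PowD mult_zero_left)+
  finally show ?thesis by (simp add: sum_distrib_left mult.commute)
qed

lemma sum_lift_eq_0:
  assumes "finite V" "k \<ge> 1" "sum x V = 0"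
  shows "sum (token_lift k x) (Pow V) = 0"
proof -
  have "real k * sum (token_lift k x) (Pow V) = (\<Sum>v\<in>V. mass V (token_lift k x) v)"
    by (rule sum_mass_support[symmetric]) (use assms in \<open>auto simp: token_lift_def\<close>)
  also have "\<dots> = (\<Sum>v\<in>V. real ((card V - 2) choose (k - 1)) * x v)"
    by (intro sum.cong refl) (simp only: mass_lift[OF assms(1) _ assms(2,3)])
  also have "\<dots> = 0" using assms by (simp add: sum_distrib_left[symmetric])
  finally show ?thesis using assms by simp
qed

text \<open>A function splits into the lift of its normalised mass and a part of mass zero,
  orthogonal for the norm and for every pair energy. The lift is controlled by
  \<open>walk_gap\<close>, which leaves the part of mass zero.\<close>

lemma token_gap_from_balanced:
  assumes V: "finite V" and c: "\<And>u v. u \<in> V \<Longrightarrow> v \<in> V \<Longrightarrow> c u v \<ge> 0"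
    and gap: "walk_gap V c t" and k: "1 \<le> k" "k < card V"
    and bal: "\<And>g. (\<And>A. A \<subseteq> V \<Longrightarrow> card A \<noteq> k \<Longrightarrow> g A = 0) \<Longrightarrow> sum g (Pow V) = 0 \<Longrightarrow>
       (\<And>v. v \<in> V \<Longrightarrow> mass V g v = 0) \<Longrightarrow> 4 * t * (\<Sum>A\<in>Pow V. (g A)\<^sup>2) \<le> token_energy V c g"
  shows "token_gap V c k t"
  unfolding token_gap_def
proof (intro allI impI)
  fix f :: "'a set \<Rightarrow> real"
  assume f: "\<forall>A\<subseteq>V. card A \<noteq> k \<longrightarrow> f A = 0" and sf: "sum f (Pow V) = 0"
  define K where "K = real ((card V - 2) choose (k - 1))"
  have K: "K > 0" using k by (simp add: K_def)
  \<comment> \<open>By \<open>mass_lift\<close> the lift of this \<open>x\<close> has the same mass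
    as \<open>f\<close>.\<close>
  define x where "x v = mass V f v / K" for v
  have sx: "sum x V = 0"
    using sum_mass_support[OF V, of k f] f sf by (simp add: x_def sum_divide_distrib[symmetric])
  define h where "h = token_lift k x"
  define g where "g A = f A - h A" for A
  have g0: "g A = 0" if "A \<subseteq> V" "card A \<noteq> k" for A
    using that f by (simp add: g_def h_def token_lift_def)
  have gs: "sum g (Pow V) = 0"
    using sf sum_lift_eq_0[OF V k(1) sx] by (simp add: g_def h_def sum_subtractf)
  have gm: "mass V g v = 0" if "v \<in> V" for v
  proof -
    have "mass V g v = mass V f v - mass V h v"
      by (simp add: mass_def g_def algebra_simps sum_subtractf)
    then show ?thesis
      using K by (simp only: h_def mass_lift[OF V that k(1) sx] K_def[symmetric]) (simp add: x_def)
  qed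
  have cross: "(\<Sum>A\<in>Pow V. g A * h A) = 0"
  proof -
    have "(\<Sum>A\<in>Pow V. g A * h A) = (\<Sum>A\<in>Pow V. g A * sum x A)"
      using g0 by (intro sum.cong) (auto simp: h_def token_lift_def)
    also have "\<dots> = (\<Sum>v\<in>V. x v * mass V g v)" using sum_mass[OF V] by simp
    finally show ?thesis by (simp add: gm)
  qed
  have fgh: "f A = g A + h A" for A by (simp add: g_def)
  have "(\<Sum>A\<in>Pow V. (f A)\<^sup>2) = (\<Sum>A\<in>Pow V. (g A)\<^sup>2) + (\<Sum>A\<in>Pow V. (h A)\<^sup>2) + 2 * (\<Sum>A\<in>Pow V. g A * h A)"
    unfolding fgh by (simp add: power2_sum sum.distrib sum_distrib_left mult_ac)
  then have norm: "(\<Sum>A\<in>Pow V. (f A)\<^sup>2) = (\<Sum>A\<in>Pow V. (g A)\<^sup>2) + (\<Sum>A\<in>Pow V. (h A)\<^sup>2)"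
    by (simp add: cross)
  have swp: "swap_energy V f u v = swap_energy V g u v + swap_energy V h u v" if "u \<in> V" "v \<in> V" for u v
  proof -
    have "swap_energy V f u v = swap_energy V g u v + swap_energy V h u v
       + 2 * (\<Sum>A\<in>Pow V. (g A - g (swap_tokens u v A)) * (h A - h (swap_tokens u v A)))"
      unfolding swap_energy_def fgh sum_distrib_left sum.distrib[symmetric]
      by (intro sum.cong refl) (simp add: power2_eq_square algebra_simps)
    moreover have "(\<Sum>A\<in>Pow V. (g A - g (swap_tokens u v A)) * (h A - h (swap_tokens u v A))) = 0"
      unfolding h_def using swap_form_lift[OF V that, of k g x] g0 gm that by simp
    ultimately show ?thesis by simp
  qed
  have en: "token_energy V c f = token_energy V c g + token_energy V c h"
    unfolding token_energy_def sum.distrib[symmetric]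
    by (intro sum.cong refl) (simp add: swp algebra_simps)
  have "4 * t * (\<Sum>A\<in>Pow V. (g A)\<^sup>2) \<le> token_energy V c g"
    by (rule bal) (use g0 gs gm in auto)
  moreover have "4 * t * (\<Sum>A\<in>Pow V. (h A)\<^sup>2) \<le> token_energy V c h"
  proof -
    have "2 * K * (2 * t * (\<Sum>v\<in>V. (x v)\<^sup>2)) \<le> 2 * K * (\<Sum>u\<in>V. \<Sum>v\<in>V. c u v * (x u - x v)\<^sup>2)"
      using gap sx K by (intro mult_left_mono) (auto simp: walk_gap_def)
    then show ?thesis
      unfolding h_def sum_lift_power2[OF V k(1) sx] token_energy_lift[OF V k(1) sx] K_def by (simp add: mult_ac)
  qed
  ultimately show "4 * t * (\<Sum>A\<in>Pow V. (f A)\<^sup>2) \<le> token_energy V c f"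
    unfolding norm en distrib_left by (rule add_mono)
qed

text \<open>At most one subset of \<open>V\<close> has size \<open>k\<close>, so a function
  supported there and of sum zero is zero.\<close>

lemma token_gap_degenerate:
  assumes V: "finite V" and k: "k = 0 \<or> k \<ge> card V" and c: "\<And>u v. u \<in> V \<Longrightarrow> v \<in> V \<Longrightarrow> c u v \<ge> 0"
  shows "token_gap V c k t"
  unfolding token_gap_def
proof (intro allI impI)
  fix f :: "'a set \<Rightarrow> real"
  assume f: "\<forall>A\<subseteq>V. card A \<noteq> k \<longrightarrow> f A = 0" and sf: "sum f (Pow V) = 0"
  define B where "B = (if k = 0 then {} else V)"
  have B: "B \<subseteq> V" by (auto simp: B_def)
  have only: "f A = 0" if "A \<subseteq> V" "A \<noteq> B" for A
  proof -
    have "card A \<noteq> k"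
      using that k V card_mono[of V A] card_subset_eq[of V A] finite_subset[of A V]
      by (auto simp: B_def split: if_splits)
    then show ?thesis using f that by blast
  qed
  have "sum f (Pow V) = sum f {B}"
    by (rule sum.mono_neutral_right) (use V B only in auto)
  then have "f B = 0" using sf by simp
  then have "f A = 0" if "A \<subseteq> V" for A using only that by blast
  then have "(\<Sum>A\<in>Pow V. (f A)\<^sup>2) = 0" by simp
  moreover have "0 \<le> token_energy V c f"
    unfolding token_energy_def by (intro sum_nonneg mult_nonneg_nonneg) (auto simp: c)
  ultimately show "4 * t * (\<Sum>A\<in>Pow V. (f A)\<^sup>2) \<le> token_energy V c f" by simp
qed

section \<open>Removing a vertex\<close>

lemma swap_energy_insert:
  assumes "finite W" "z \<notin> W" "u \<in> W" "v \<in> W"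
  shows "swap_energy (insert z W) f u v = swap_energy W f u v + swap_energy W (\<lambda>A. f (insert z A)) u v"
proof -
  have "transpose u v z = z" using assms by (intro transpose_apply_other) auto
  then show ?thesis
    unfolding swap_energy_def sum_Pow_insert[OF assms(1,2)] by (simp add: sum.distrib)
qed

text \<open>Extending \<open>x\<close> to \<open>z\<close> by its weighted mean \<open>m\<close>
  makes the energy of the star at \<open>z\<close> equal to that of the mesh replacing it. Shifting
  the extension to sum zero leaves its norm at least that of \<open>x\<close>.\<close>

lemma walk_gap_star_mesh:
  assumes W: "finite W" "z \<notin> W" and t: "t \<ge> 0"
    and sym: "\<And>u. u \<in> W \<Longrightarrow> c u z = c z u" and S: "S = (\<Sum>y\<in>W. c z y)" "S > 0"
    and gap: "walk_gap (insert z W) c t"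
  shows "walk_gap W (\<lambda>u v. c u v + c z u * c z v / S) t"
  unfolding walk_gap_def
proof (intro allI impI)
  fix x :: "'a \<Rightarrow> real" assume x: "sum x W = 0"
  let ?V = "insert z W"
  define a where "a = c z"
  define m where "m = (\<Sum>y\<in>W. a y * x y) / S"
  define n where "n = real (card W + 1)"
  \<comment> \<open>Since \<open>x\<close> has sum zero on \<open>W\<close>, the mean of the
    extended vector is \<open>m / n\<close>.\<close>
  define y where "y v = (if v = z then m else x v) - m / n" for v
  have aS: "sum a W = S" by (simp add: a_def S)
  have mS: "(\<Sum>y\<in>W. a y * x y) = S * m" using S by (simp add: m_def)
  have yz: "y z = m - m / n" and yW: "\<And>v. v \<in> W \<Longrightarrow> y v = x v - m / n"
    using W by (auto simp: y_def)
  have n: "n > 0" by (simp add: n_def)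
  have sy: "sum y ?V = 0"
  proof -
    have "sum y W = - (m / n) * real (card W)"
      using x by (simp add: yW sum_subtractf)
    then show ?thesis using W n by (simp add: yz n_def field_simps)
  qed
  have "(\<Sum>v\<in>W. (x v)\<^sup>2) \<le> (\<Sum>v\<in>?V. (y v)\<^sup>2)"
  proof -
    have "(\<Sum>v\<in>W. (y v)\<^sup>2) = (\<Sum>v\<in>W. (x v)\<^sup>2 - 2 * (m / n) * x v + (m / n)\<^sup>2)"
      by (intro sum.cong refl) (simp add: yW power2_eq_square algebra_simps)
    also have "\<dots> = (\<Sum>v\<in>W. (x v)\<^sup>2) + real (card W) * (m / n)\<^sup>2"
      by (simp only: sum.distrib sum_subtractf sum_distrib_left[symmetric] x) simp
    finally show ?thesis using W by (simp add: yz)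
  qed
  then have "2 * t * (\<Sum>v\<in>W. (x v)\<^sup>2) \<le> 2 * t * (\<Sum>v\<in>?V. (y v)\<^sup>2)"
    using t by (intro mult_left_mono) auto
  also have "\<dots> \<le> (\<Sum>u\<in>?V. \<Sum>v\<in>?V. c u v * (y u - y v)\<^sup>2)"
    using gap sy by (simp add: walk_gap_def)
  also have "\<dots> = 2 * (\<Sum>v\<in>W. a v * (m - x v)\<^sup>2) + (\<Sum>u\<in>W. \<Sum>v\<in>W. c u v * (x u - x v)\<^sup>2)"
  proof -
    have "(\<Sum>u\<in>?V. \<Sum>v\<in>?V. c u v * (y u - y v)\<^sup>2) =
       (\<Sum>v\<in>W. c z v * (y z - y v)\<^sup>2) + ((\<Sum>u\<in>W. c u z * (y u - y z)\<^sup>2) + (\<Sum>u\<in>W. \<Sum>v\<in>W. c u v * (y u - y v)\<^sup>2))"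
      using W by (simp add: sum.distrib)
    also have "(\<Sum>u\<in>W. c u z * (y u - y z)\<^sup>2) = (\<Sum>v\<in>W. a v * (m - x v)\<^sup>2)"
      by (intro sum.cong refl) (simp add: sym a_def yW yz power2_commute)
    also have "(\<Sum>v\<in>W. c z v * (y z - y v)\<^sup>2) = (\<Sum>v\<in>W. a v * (m - x v)\<^sup>2)"
      by (intro sum.cong refl) (simp add: a_def yW yz)
    also have "(\<Sum>u\<in>W. \<Sum>v\<in>W. c u v * (y u - y v)\<^sup>2) = (\<Sum>u\<in>W. \<Sum>v\<in>W. c u v * (x u - x v)\<^sup>2)"
      by (intro sum.cong refl) (simp add: yW)
    finally show ?thesis by simp
  qed
  \<comment> \<open>The weighted variance as a double sum over pairs.\<close>
  also have "2 * (\<Sum>v\<in>W. a v * (m - x v)\<^sup>2) = (\<Sum>u\<in>W. \<Sum>v\<in>W. a u * a v / S * (x u - x v)\<^sup>2)"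
  proof -
    let ?q = "\<Sum>v\<in>W. a v * (x v)\<^sup>2"
    have "(\<Sum>v\<in>W. a v * (m - x v)\<^sup>2) = (\<Sum>v\<in>W. m\<^sup>2 * a v - 2 * m * (a v * x v) + a v * (x v)\<^sup>2)"
      by (intro sum.cong refl) (simp add: power2_eq_square algebra_simps)
    also have "\<dots> = m\<^sup>2 * S - 2 * m * (S * m) + ?q"
      by (simp only: sum.distrib sum_subtractf sum_distrib_left[symmetric] aS mS)
    finally have 1: "(\<Sum>v\<in>W. a v * (m - x v)\<^sup>2) = ?q - m\<^sup>2 * S"
      by (simp add: power2_eq_square algebra_simps)
    have "(\<Sum>u\<in>W. \<Sum>v\<in>W. a u * a v * (x u - x v)\<^sup>2) =
       (\<Sum>u\<in>W. \<Sum>v\<in>W. a u * (x u)\<^sup>2 * a v - 2 * (a u * x u) * (a v * x v) + a u * (a v * (x v)\<^sup>2))"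
      by (intro sum.cong refl) (simp add: power2_eq_square algebra_simps)
    also have "\<dots> = ?q * S - 2 * (S * m) * (S * m) + S * ?q"
      by (simp only: sum.distrib sum_subtractf sum_distrib_left[symmetric] sum_distrib_right[symmetric] aS mS)
    finally have 2: "(\<Sum>u\<in>W. \<Sum>v\<in>W. a u * a v * (x u - x v)\<^sup>2) = 2 * S * (?q - m\<^sup>2 * S)"
      by (simp add: power2_eq_square algebra_simps)
    have "(\<Sum>u\<in>W. \<Sum>v\<in>W. a u * a v / S * (x u - x v)\<^sup>2) = (\<Sum>u\<in>W. \<Sum>v\<in>W. a u * a v * (x u - x v)\<^sup>2) / S"
      by (simp add: sum_divide_distrib)
    then show ?thesis using S 1 2 by simp
  qed
  finally show "2 * t * (\<Sum>v\<in>W. (x v)\<^sup>2) \<le> (\<Sum>u\<in>W. \<Sum>v\<in>W. (c u v + c z u * c z v / S) * (x u - x v)\<^sup>2)"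
    by (simp add: a_def distrib_right sum.distrib add.commute)
qed

text \<open>If no weight joins \<open>z\<close> to \<open>W\<close>, a nonzero vector of sum zero
  that is constant on \<open>W\<close> has no energy.\<close>

lemma walk_gap_isolated:
  assumes W: "finite W" "z \<notin> W" "W \<noteq> {}"
    and c: "\<And>u. u \<in> W \<Longrightarrow> c z u = 0" "\<And>u. u \<in> W \<Longrightarrow> c u z = 0"
    and gap: "walk_gap (insert z W) c t"
  shows "t \<le> 0"
proof -
  define x where "x v = (if v = z then real (card W) else - 1)" for v
  have xW: "x v = - 1" if "v \<in> W" for v using that W by (auto simp: x_def)
  have "sum x (insert z W) = 0"
    using W by (simp add: xW) (simp add: x_def)
  then have "2 * t * (\<Sum>v\<in>insert z W. (x v)\<^sup>2) \<le> (\<Sum>u\<in>insert z W. \<Sum>v\<in>insert z W. c u v * (x u - x v)\<^sup>2)"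
    using gap by (simp add: walk_gap_def)
  also have "\<dots> = 0" using W c by (simp add: xW)
  finally have "2 * t * (\<Sum>v\<in>insert z W. (x v)\<^sup>2) \<le> 0" .
  moreover have "(\<Sum>v\<in>insert z W. (x v)\<^sup>2) > 0"
    using W by (simp add: xW card_gt_0_iff add_nonneg_pos)
  ultimately show ?thesis by (simp add: mult_le_0_iff)
qed

text \<open>The induction ranges over all weights and all \<open>k\<close>, because the mesh carries
  new weights and the sets containing \<open>z\<close> lose one token.\<close>

theorem token_gap_if_walk_gap:
  assumes "finite V" "\<And>u v. u \<in> V \<Longrightarrow> v \<in> V \<Longrightarrow> c u v \<ge> 0"
    and "\<And>u v. u \<in> V \<Longrightarrow> v \<in> V \<Longrightarrow> c u v = c v u" and "walk_gap V c t"
  shows "token_gap V c k t"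
  using assms
proof (induction "card V" arbitrary: V c k rule: less_induct)
  case less
  note V = less.prems(1) and c = less.prems(2) and sym = less.prems(3) and gap = less.prems(4)
  show ?case
  proof (cases "k = 0 \<or> k \<ge> card V")
    case True
    then show ?thesis using V c by (intro token_gap_degenerate)
  next
    case False
    then have k: "1 \<le> k" "k < card V" by auto
    show ?thesis
    proof (rule token_gap_from_balanced[OF V c gap k])
      fix g assume g0: "\<And>A. A \<subseteq> V \<Longrightarrow> card A \<noteq> k \<Longrightarrow> g A = 0"
        and gs: "sum g (Pow V) = 0" and gm: "\<And>v. v \<in> V \<Longrightarrow> mass V g v = 0"
      have en: "token_energy V c g \<ge> 0"
        unfolding token_energy_def by (intro sum_nonneg mult_nonneg_nonneg) (auto simp: c)
      show "4 * t * (\<Sum>A\<in>Pow V. (g A)\<^sup>2) \<le> token_energy V c g"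
      proof (cases "t \<le> 0")
        case True
        then have "4 * t * (\<Sum>A\<in>Pow V. (g A)\<^sup>2) \<le> 0"
          by (simp add: mult_le_0_iff sum_nonneg)
        with en show ?thesis by linarith
      next
        case t: False
        from k obtain z where z: "z \<in> V" by fastforce
        define W where "W = V - {z}"
        have W: "finite W" "z \<notin> W" and Vz: "V = insert z W" using V z by (auto simp: W_def)
        have "card W = card V - 1" using V z by (simp add: W_def)
        then have cW: "card W < card V" "W \<noteq> {}" using k by auto
        define S where "S = (\<Sum>y\<in>W. c z y)"
        have "S \<ge> 0" unfolding S_def using c Vz by (intro sum_nonneg) auto
        \<comment> \<open>A positive gap excludes an isolated vertex.\<close>
        moreover have "S \<noteq> 0"
        proof
          assume "S = 0"
          then have "c z u = 0" if "u \<in> W" for u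
            using that c Vz W sum_nonneg_eq_0_iff[of W "c z"] by (auto simp: S_def)
          then have "t \<le> 0"
            using W cW gap sym Vz by (intro walk_gap_isolated[of W z c t]) auto
          with t show False by simp
        qed
        ultimately have S: "S > 0" by simp
        define c' where "c' u v = c u v + c z u * c z v / S" for u v
        have gap': "walk_gap W c' t"
          unfolding c'_def
          using W t sym gap Vz S by (intro walk_gap_star_mesh S_def) auto
        have IH: "token_gap W c' j t" for j
        proof (rule less.hyps[OF cW(1) W(1)])
          show "c' u v \<ge> 0" if "u \<in> W" "v \<in> W" for u v
            using that c Vz S by (simp add: c'_def)
          show "c' u v = c' v u" if "u \<in> W" "v \<in> W" for u v
            using that sym Vz by (simp add: c'_def mult.commute)
        qed (fact gap')
        define h where "h = (\<lambda>A. g (insert z A))"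
        have cz: "sum (c z) W = S" by (simp add: S_def)
        \<comment> \<open>Mass zero at \<open>z\<close> is what gives both halves of
          \<open>g\<close> sum zero, as the induction hypothesis requires.\<close>
        have mz: "sum h (Pow W) = 0"
        proof -
          have "mass V g z = sum h (Pow W)"
            unfolding mass_def Vz h_def sum_Pow_insert[OF W] using W by (intro sum.cong) auto
          then show ?thesis using gm z by simp
        qed
        have mg: "sum g (Pow W) = 0"
          using gs mz W unfolding Vz by (simp add: sum_Pow_insert sum.distrib h_def)
        have norm: "(\<Sum>A\<in>Pow V. (g A)\<^sup>2) = (\<Sum>A\<in>Pow W. (g A)\<^sup>2) + (\<Sum>A\<in>Pow W. (h A)\<^sup>2)"
          unfolding Vz using W by (simp add: sum_Pow_insert sum.distrib h_def)
        have "4 * t * (\<Sum>A\<in>Pow W. (g A)\<^sup>2) \<le> token_energy W c' g"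
        proof (rule IH[unfolded token_gap_def, rule_format, of k g])
          show "g A = 0" if "A \<subseteq> W" "card A \<noteq> k" for A
            using that Vz by (intro g0) auto
        qed (fact mg)
        moreover have "4 * t * (\<Sum>A\<in>Pow W. (h A)\<^sup>2) \<le> token_energy W c' h"
        proof (rule IH[unfolded token_gap_def, rule_format, of "k - 1" h])
          show "h A = 0" if "A \<subseteq> W" "card A \<noteq> k - 1" for A
          proof -
            have "card (insert z A) = Suc (card A)"
              using that W by (intro card_insert_disjoint) (auto intro: finite_subset)
            then show ?thesis unfolding h_def using that k Vz by (intro g0) auto
          qed
        qed (fact mz)
        ultimately have "4 * t * (\<Sum>A\<in>Pow V. (g A)\<^sup>2) \<le> token_energy W c' g + token_energy W c' h"
          unfolding norm distrib_left by (rule add_mono)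
        also have "\<dots> = (\<Sum>u\<in>W. \<Sum>v\<in>W. c' u v * swap_energy V g u v)"
          unfolding token_energy_def sum.distrib[symmetric]
          by (intro sum.cong refl) (simp add: Vz swap_energy_insert W h_def distrib_left)
        also have "\<dots> = (\<Sum>u\<in>W. \<Sum>v\<in>W. c z u * c z v * swap_energy V g u v) / S
            + (\<Sum>u\<in>W. \<Sum>v\<in>W. c u v * swap_energy V g u v)"
          unfolding c'_def by (simp add: distrib_right sum.distrib sum_divide_distrib add.commute)
        \<comment> \<open>Divided by \<open>S\<close>, the octopus inequality bounds the mesh energy
          by the star energy counted in both orientations.\<close>
        also have "\<dots> \<le> 2 * (\<Sum>v\<in>W. c z v * swap_energy V g z v) + (\<Sum>u\<in>W. \<Sum>v\<in>W. c u v * swap_energy V g u v)"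
        proof -
          have "(\<Sum>u\<in>W. \<Sum>v\<in>W. c z u * c z v * swap_energy V g u v)
              \<le> 2 * sum (c z) W * (\<Sum>v\<in>W. c z v * swap_energy V g z v)"
            unfolding Vz by (rule octopus_inequality[OF W]) (use c Vz cz S in auto)
          then show ?thesis using S by (simp add: cz pos_divide_le_eq mult_ac)
        qed
        also have "\<dots> = token_energy V c g"
        proof -
          have "token_energy V c g = (\<Sum>v\<in>W. c z v * swap_energy V g z v)
             + ((\<Sum>u\<in>W. c u z * swap_energy V g u z) + (\<Sum>u\<in>W. \<Sum>v\<in>W. c u v * swap_energy V g u v))"
            unfolding token_energy_def using W by (subst (1 2) Vz) (simp add: sum.distrib Vz)
          also have "(\<Sum>u\<in>W. c u z * swap_energy V g u z) = (\<Sum>v\<in>W. c z v * swap_energy V g z v)"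
            by (intro sum.cong refl) (use sym Vz in \<open>simp add: swap_energy_commute\<close>)
          finally show ?thesis by simp
        qed
        finally show ?thesis .
      qed
    qed
  qed
qed

section \<open>Diagonalisation of real symmetric matrices\<close>

text \<open>A complex eigenvector exists. Symmetry makes its Hermitian form \<open>q = l * r\<close>
  real, so the eigenvalue \<open>l\<close> is real and a root of the real characteristic
  polynomial.\<close>

lemma real_symmetric_eigenvector_exists:
  fixes A :: "real mat"
  assumes A: "A \<in> carrier_mat n n" and sym: "transpose_mat A = A" and n: "n > 0"
  obtains v e where "eigenvector A v e"
proof -
  define C where "C = map_mat complex_of_real A"
  have C: "C \<in> carrier_mat n n" using A by (simp add: C_def)
  obtain l where "l \<in> spectrum C" using spectrum_non_empty[OF C n] by auto
  then obtain z where z: "eigenvector C z l" by (auto simp: spectrum_def eigenvalue_def)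
  then have zc: "z \<in> carrier_vec n" and z0: "z \<noteq> 0\<^sub>v n" and Cz: "C *\<^sub>v z = l \<cdot>\<^sub>v z"
    using C by (auto simp: eigenvector_def)
  have aij: "A $$ (i, j) = A $$ (j, i)" if "i < n" "j < n" for i j
    using that A arg_cong[OF sym, of "\<lambda>M. M $$ (i, j)"] by simp
  define q where "q = (\<Sum>i<n. \<Sum>j<n. cnj (z $ i) * of_real (A $$ (i, j)) * z $ j)"
  define r where "r = (\<Sum>i<n. (cmod (z $ i))\<^sup>2)"
  have ev: "(\<Sum>j<n. of_real (A $$ (i, j)) * z $ j) = l * z $ i" if "i < n" for i
  proof -
    have "(C *\<^sub>v z) $ i = (\<Sum>j<n. of_real (A $$ (i, j)) * z $ j)"
      using that A zc by (simp add: C_def scalar_prod_def lessThan_atLeast0)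
    then show ?thesis using Cz that zc by simp
  qed
  have "q = (\<Sum>i<n. cnj (z $ i) * (\<Sum>j<n. of_real (A $$ (i, j)) * z $ j))"
    by (simp add: q_def sum_distrib_left mult.assoc)
  also have "\<dots> = (\<Sum>i<n. l * of_real ((cmod (z $ i))\<^sup>2))"
    by (intro sum.cong refl) (simp only: ev lessThan_iff, simp only: complex_norm_square mult_ac)
  finally have q: "q = l * of_real r" by (simp add: r_def sum_distrib_left)
  have "cnj q = (\<Sum>i<n. \<Sum>j<n. cnj (z $ j) * of_real (A $$ (i, j)) * z $ i)"
    by (simp add: q_def mult_ac)
  also have "\<dots> = (\<Sum>j<n. \<Sum>i<n. cnj (z $ j) * of_real (A $$ (i, j)) * z $ i)"
    by (rule sum.swap)
  also have "\<dots> = q"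
    unfolding q_def by (intro sum.cong refl) (simp add: aij)
  finally have "cnj q = q" .
  moreover have "r \<noteq> 0"
  proof
    assume "r = 0"
    then have "\<forall>i<n. z $ i = 0" by (simp add: r_def sum_nonneg_eq_0_iff)
    then have "z = 0\<^sub>v n" using zc by (intro eq_vecI) auto
    then show False using z0 by simp
  qed
  ultimately have "cnj l = l" by (simp add: q)
  then obtain e where e: "l = of_real e" by (metis complex_cnj_cancel_iff Reals_cnj_iff Reals_cases)
  have "poly (char_poly C) l = 0"
    using z eigenvalue_root_char_poly[OF C] by (auto simp: eigenvalue_def)
  then have "poly (map_poly complex_of_real (char_poly A)) (of_real e) = 0"
    unfolding C_def e by (simp add: of_real_hom.char_poly_hom[OF A])
  then have "poly (char_poly A) e = 0" by simp
  then obtain v where "eigenvector A v e"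
    using eigenvalue_root_char_poly[OF A] unfolding eigenvalue_def by blast
  then show ?thesis by (rule that)
qed

text \<open>Gram-Schmidt orthogonalisation keeps the first basis vector \<open>v\<close>, so that
  only normalisation remains.\<close>

lemma orthonormal_completion:
  fixes v :: "real vec"
  assumes v: "v \<in> carrier_vec n" "v \<noteq> 0\<^sub>v n" and n: "n > 0"
  obtains W where "W \<in> carrier_mat n n" "transpose_mat W * W = 1\<^sub>m n"
    "col W 0 = (1 / sqrt (v \<bullet> v)) \<cdot>\<^sub>v v"
proof -
  interpret cof_vec_space n "TYPE(real)" .
  define b where "b = basis_completion v"
  define ws where "ws = gram_schmidt n b"
  from basis_completion[OF v, folded b_def]
  have dist_b: "distinct b" and indep: "\<not> lin_dep (set b)" and b: "set b \<subseteq> carrier_vec n"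
    and hdb: "hd b = v" and len_b: "length b = n" by auto
  from hdb len_b n obtain vs where bv: "b = v # vs" by (cases b) auto
  from gram_schmidt_result[OF b dist_b indep refl, folded ws_def]
  have ws: "set ws \<subseteq> carrier_vec n" "corthogonal ws" "length ws = n" by (auto simp: len_b)
  have hdws: "hd ws = v" unfolding ws_def bv using v by simp
  define us where "us = map (\<lambda>w. (1 / sqrt (w \<bullet> w)) \<cdot>\<^sub>v w) ws"
  have wsi: "ws ! i \<in> carrier_vec n" if "i < n" for i using that ws by auto
  have usi: "us ! i \<in> carrier_vec n" if "i < n" for i using that ws wsi by (auto simp: us_def)
  have orth: "us ! i \<bullet> us ! j = (if i = j then 1 else 0)" if "i < n" "j < n" for i j
  proof -
    have *: "(ws ! i \<bullet> ws ! j = 0) = (i \<noteq> j)"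
      using corthogonalD[OF ws(2), of i j] that ws by simp
    have "ws ! i \<bullet> ws ! i \<ge> 0" by (simp add: scalar_prod_def sum_nonneg)
    moreover have "us ! i \<bullet> us ! j = (ws ! i \<bullet> ws ! j) / (sqrt (ws ! i \<bullet> ws ! i) * sqrt (ws ! j \<bullet> ws ! j))"
      using that ws wsi[OF that(1)] wsi[OF that(2)] by (simp add: us_def)
    ultimately show ?thesis using * by auto
  qed
  define W where "W = mat_of_cols n us"
  have lus: "length us = n" using ws by (simp add: us_def)
  have W: "W \<in> carrier_mat n n" using lus by (simp add: W_def mat_of_cols_def)
  have col: "col W i = us ! i" if "i < n" for i
    using that lus usi by (simp add: W_def)
  show thesis
  proof
    show "W \<in> carrier_mat n n" by fact
    show "transpose_mat W * W = 1\<^sub>m n"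
      using W by (intro eq_matI) (auto simp: col orth)
    show "col W 0 = (1 / sqrt (v \<bullet> v)) \<cdot>\<^sub>v v"
      using n ws hdws hd_conv_nth[of ws] by (auto simp: col us_def)
  qed
qed

text \<open>Deflation by an orthonormal basis starting with \<open>v\<close>. The first eigenvector
  is prescribed so that for a Laplacian it can be taken constant.\<close>

theorem real_symmetric_diagonalisation:
  fixes A :: "real mat"
  assumes "A \<in> carrier_mat n n" "transpose_mat A = A" "eigenvector A v e"
  shows "\<exists>P es. P \<in> carrier_mat n n \<and> transpose_mat P * P = 1\<^sub>m n \<and> length es = n \<and>
     A = P * mat_diag n (\<lambda>i. es ! i) * transpose_mat P \<and> es ! 0 = e \<and>
     col P 0 = (1 / sqrt (v \<bullet> v)) \<cdot>\<^sub>v v"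
  using assms
proof (induction n arbitrary: A v e)
  case 0
  then show ?case by (auto simp: eigenvector_def)
next
  case (Suc m)
  let ?n = "Suc m"
  note A = Suc.prems(1) and sym = Suc.prems(2)
  have v: "v \<in> carrier_vec ?n" "v \<noteq> 0\<^sub>v ?n" and Av: "A *\<^sub>v v = e \<cdot>\<^sub>v v"
    using Suc.prems A by (auto simp: eigenvector_def)
  obtain W where W: "W \<in> carrier_mat ?n ?n" and WW: "transpose_mat W * W = 1\<^sub>m ?n"
    and col0: "col W 0 = (1 / sqrt (v \<bullet> v)) \<cdot>\<^sub>v v"
    using orthonormal_completion[OF v] by blast
  have colW: "col W j \<in> carrier_vec ?n" for j
    using W by (metis carrier_matD(1) carrier_vecI dim_col)
  have WT: "transpose_mat W \<in> carrier_mat ?n ?n" using W by simp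
  have WW': "W * transpose_mat W = 1\<^sub>m ?n" by (rule mat_mult_left_right_inverse[OF WT W WW])
  define B where "B = transpose_mat W * A * W"
  have B: "B \<in> carrier_mat ?n ?n" using W A by (simp add: B_def)
  have Bsym: "transpose_mat B = B"
    unfolding B_def using W A sym by (simp add: transpose_mult[of _ ?n ?n _ ?n] assoc_mult_mat[of _ ?n ?n _ ?n _ ?n])
  have AB: "A = W * B * transpose_mat W"
  proof -
    have "W * B * transpose_mat W = (W * transpose_mat W) * A * (W * transpose_mat W)"
      unfolding B_def using W A WT by (simp add: assoc_mult_mat[of _ ?n ?n _ ?n _ ?n])
    then show ?thesis using A by (simp add: WW')
  qed
  \<comment> \<open>The first column of \<open>B\<close> is \<open>e\<close> times a unit vector
    and, by symmetry, so is the first row; a symmetric block of size \<open>m\<close> is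
    left.\<close>
  have B0: "B $$ (i, 0) = (if i = 0 then e else 0)" if "i < ?n" for i
  proof -
    have Aw: "A *\<^sub>v col W 0 = e \<cdot>\<^sub>v col W 0"
      unfolding col0 using v A Av by (simp add: mult_mat_vec smult_smult_assoc mult.commute)
    have "B = transpose_mat W * (A * W)" unfolding B_def using W A by (simp add: assoc_mult_mat[of _ ?n ?n _ ?n _ ?n])
    then have "B $$ (i, 0) = col W i \<bullet> (A *\<^sub>v col W 0)"
      using that W A by (simp add: col_mult2[of _ ?n ?n _ ?n] mult_mat_vec_def)
    also have "\<dots> = e * (col W i \<bullet> col W 0)"
      unfolding Aw by (rule scalar_prod_smult_distrib[OF colW colW])
    also have "col W i \<bullet> col W 0 = (transpose_mat W * W) $$ (i, 0)" using that W by simp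
    finally show ?thesis using that by (simp add: WW)
  qed
  define A3 where "A3 = mat m m (\<lambda>(i, j). B $$ (Suc i, Suc j))"
  have A3: "A3 \<in> carrier_mat m m" by (simp add: A3_def)
  have Bij: "B $$ (i, j) = B $$ (j, i)" if "i < ?n" "j < ?n" for i j
    using that B arg_cong[OF Bsym, of "\<lambda>M. M $$ (i, j)"] by simp
  have A3sym: "transpose_mat A3 = A3"
    by (rule eq_matI) (auto simp: A3_def Bij)
  define E where "E = mat 1 1 (\<lambda>_. e)"
  have E: "E \<in> carrier_mat 1 1" by (simp add: E_def)
  have Bblock: "B = four_block_mat E (0\<^sub>m 1 m) (0\<^sub>m m 1) A3"
  proof (rule eq_matI)
    fix i j assume "i < dim_row (four_block_mat E (0\<^sub>m 1 m) (0\<^sub>m m 1) A3)"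
      "j < dim_col (four_block_mat E (0\<^sub>m 1 m) (0\<^sub>m m 1) A3)"
    then have ij: "i < ?n" "j < ?n" by (auto simp: E_def A3_def)
    then show "B $$ (i, j) = four_block_mat E (0\<^sub>m 1 m) (0\<^sub>m m 1) A3 $$ (i, j)"
      using B0[of i] B0[of j] Bij[of i j]
      by (cases i; cases j) (auto simp: E_def A3_def)
  qed (use B in \<open>auto simp: E_def A3_def\<close>)
  obtain P3 es3 where P3: "P3 \<in> carrier_mat m m" "transpose_mat P3 * P3 = 1\<^sub>m m" "length es3 = m"
    "A3 = P3 * mat_diag m (\<lambda>i. es3 ! i) * transpose_mat P3"
  \<comment> \<open>An eigenvector of the remaining block is available only if the block is
    nonempty.\<close>
  proof (cases "m = 0")
    case True
    have "A3 = 1\<^sub>m 0 * mat_diag 0 ((!) []) * transpose_mat (1\<^sub>m 0)"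
      by (rule eq_matI) (use A3 True in auto)
    then show ?thesis using that[of "1\<^sub>m 0" "[]"] True by simp
  next
    case False
    then obtain v3 e3 where "eigenvector A3 v3 e3"
      using real_symmetric_eigenvector_exists[OF A3 A3sym] by blast
    then show ?thesis using Suc.IH[OF A3 A3sym] that by blast
  qed
  define P2 where "P2 = four_block_mat (1\<^sub>m 1) (0\<^sub>m 1 m) (0\<^sub>m m 1) P3"
  have P2: "P2 \<in> carrier_mat ?n ?n"
    unfolding P2_def using four_block_carrier_mat[of "1\<^sub>m 1" 1 1 P3 m m] P3 by simp
  have P2T: "transpose_mat P2 = four_block_mat (1\<^sub>m 1) (0\<^sub>m 1 m) (0\<^sub>m m 1) (transpose_mat P3)"
    unfolding P2_def using P3 by (subst transpose_four_block_mat[of _ 1 1 _ m _ m]) auto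
  have one: "four_block_mat (1\<^sub>m 1) (0\<^sub>m 1 m) (0\<^sub>m m 1) (1\<^sub>m m) = (1\<^sub>m ?n :: real mat)"
    by (rule eq_matI) auto
  have P2P2: "transpose_mat P2 * P2 = 1\<^sub>m ?n"
    unfolding P2T using P3 unfolding P2_def
    by (subst mult_four_block_mat[of _ 1 1 _ m _ m _ _ 1 _ m]) (auto simp: one)
  define D where "D = mat_diag ?n (\<lambda>i. (e # es3) ! i)"
  define D3 where "D3 = mat_diag m (\<lambda>i. es3 ! i)"
  have D: "D \<in> carrier_mat ?n ?n" and D3: "D3 \<in> carrier_mat m m" by (simp_all add: D_def D3_def)
  have Dblock: "D = four_block_mat E (0\<^sub>m 1 m) (0\<^sub>m m 1) D3"
    by (rule eq_matI) (auto simp: D_def D3_def E_def mat_diag_def nth_Cons split: nat.splits)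
  have BP: "B = P2 * D * transpose_mat P2"
  proof -
    have "P2 * D = four_block_mat E (0\<^sub>m 1 m) (0\<^sub>m m 1) (P3 * D3)"
      unfolding P2_def Dblock using P3 E D3
      by (subst mult_four_block_mat[of _ 1 1 _ m _ m _ _ 1 _ m]) auto
    moreover have "\<dots> * transpose_mat P2 = four_block_mat E (0\<^sub>m 1 m) (0\<^sub>m m 1) (P3 * D3 * transpose_mat P3)"
      unfolding P2T using P3 E D3
      by (subst mult_four_block_mat[of _ 1 1 _ m _ m _ _ 1 _ m]) auto
    ultimately show ?thesis using P3(4) by (simp add: Bblock D3_def)
  qed
  define P where "P = W * P2"
  have P: "P \<in> carrier_mat ?n ?n" using W P2 by (simp add: P_def)
  have PT: "transpose_mat P = transpose_mat P2 * transpose_mat W"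
    unfolding P_def using W P2 by (rule transpose_mult)
  have "transpose_mat P * P = transpose_mat P2 * (transpose_mat W * W) * P2"
    unfolding PT unfolding P_def using W P2 WT by (simp add: assoc_mult_mat[of _ ?n ?n _ ?n _ ?n])
  also have "\<dots> = 1\<^sub>m ?n" using P2 P2P2 by (simp add: WW)
  finally have PP: "transpose_mat P * P = 1\<^sub>m ?n" .
  have AP: "A = P * D * transpose_mat P"
    unfolding AB BP PT unfolding P_def using W P2 WT D by (simp add: assoc_mult_mat[of _ ?n ?n _ ?n _ ?n])
  have colP: "col P 0 = col W 0"
  proof -
    have "col P 0 = W *\<^sub>v col P2 0"
      unfolding P_def by (rule col_mult2[OF W P2]) simp
    also have "col P2 0 = unit_vec ?n 0"
      by (rule eq_vecI) (use P3 in \<open>auto simp: P2_def unit_vec_def\<close>)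
    also have "W *\<^sub>v unit_vec ?n 0 = col W 0"
      using W by (intro eq_vecI) (auto simp: scalar_prod_right_unit)
    finally show ?thesis .
  qed
  show ?case
    by (rule exI[of _ P], rule exI[of _ "e # es3"])
       (use P PP AP colP col0 P3 in \<open>simp add: D_def\<close>)
qed

section \<open>Algebraic connectivity as a minimum of Rayleigh quotients\<close>

definition arc_weight :: "'a pair_pre_digraph \<Rightarrow> 'a \<Rightarrow> 'a \<Rightarrow> real" where
  "arc_weight G u v = of_bool ((u, v) \<in> parcs G)"

lemma arc_weight_nonneg [simp]: "arc_weight G u v \<ge> 0"
  by (simp add: arc_weight_def)

lemma arc_weight_commute:
  assumes "pair_graph G"
  shows "arc_weight G u v = arc_weight G v u"
proof -
  interpret pair_graph G by fact
  show ?thesis using pair_sym_arcs by (auto simp: arc_weight_def symmetric_def sym_def)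
qed

lemma out_degree_eq_sum_arc_weight:
  assumes "pair_graph G"
  shows "real (out_degree (with_proj G) u) = (\<Sum>v\<in>pverts G. arc_weight G u v)"
proof -
  interpret pair_graph G by fact
  have "out_arcs (with_proj G) u = Pair u ` {v \<in> pverts G. (u, v) \<in> parcs G}"
    by (auto simp: out_arcs_def dest: in_arcsD2)
  then have "out_degree (with_proj G) u = card {v \<in> pverts G. (u, v) \<in> parcs G}"
    by (simp add: out_degree_def card_image inj_on_def)
  then show ?thesis
    using pair_finite_verts by (simp add: arc_weight_def Int_def)
qed

lemma laplacian_mat_mult_vec:
  fixes x :: "'a \<Rightarrow> real"
  assumes G: "pair_graph G" and xs: "distinct xs" "set xs = pverts G" and i: "i < length xs"
  defines "X \<equiv> vec (length xs) (\<lambda>i. x (xs ! i))"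
  shows "(laplacian_mat G xs *\<^sub>v X) $ i = (\<Sum>v\<in>pverts G. arc_weight G (xs ! i) v * (x (xs ! i) - x v))"
proof -
  interpret pair_graph G by fact
  define n where "n = length xs"
  define u where "u = xs ! i"
  define l where "l v = (if v = u then real (out_degree (with_proj G) u) else - arc_weight G u v)" for v
  have u: "u \<in> pverts G" unfolding u_def xs(2)[symmetric] using i by (rule nth_mem)
  have bij: "bij_betw (nth xs) {..<n} (pverts G)"
    using bij_betw_nth[OF xs(1), of "{..<n}" "pverts G"] xs by (simp add: n_def)
  have entry: "laplacian_mat G xs $$ (i, j) = l (xs ! j)" if "j < n" for j
  proof -
    have "i = j \<longleftrightarrow> xs ! j = u" using that i xs(1) nth_eq_iff_index_eq[of xs j i] by (auto simp: u_def n_def)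
    then show ?thesis using that i by (simp add: laplacian_mat_def l_def n_def u_def arc_weight_def)
  qed
  have L: "laplacian_mat G xs \<in> carrier_mat n n" by (simp add: laplacian_mat_def n_def)
  have "(laplacian_mat G xs *\<^sub>v X) $ i = (\<Sum>j<n. laplacian_mat G xs $$ (i, j) * x (xs ! j))"
    using i L by (simp add: X_def scalar_prod_def n_def lessThan_atLeast0)
  also have "\<dots> = (\<Sum>j<n. l (xs ! j) * x (xs ! j))"
    by (intro sum.cong refl) (simp add: entry)
  also have "\<dots> = (\<Sum>v\<in>pverts G. l v * x v)"
    by (rule sum.reindex_bij_betw[OF bij])
  also have "\<dots> = l u * x u + (\<Sum>v\<in>pverts G - {u}. l v * x v)"
    using u pair_finite_verts by (rule sum.remove[rotated])
  also have "(\<Sum>v\<in>pverts G - {u}. l v * x v) = (\<Sum>v\<in>pverts G - {u}. - arc_weight G u v * x v)"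
    by (intro sum.cong) (auto simp: l_def)
  also have "\<dots> = (\<Sum>v\<in>pverts G. - arc_weight G u v * x v)"
  proof -
    have "arc_weight G u u = 0" using no_loops' by (auto simp: arc_weight_def)
    then show ?thesis using u pair_finite_verts by (simp add: sum.remove[of "pverts G" u])
  qed
  also have "l u * x u + \<dots> = (\<Sum>v\<in>pverts G. arc_weight G u v * (x u - x v))"
    by (simp add: l_def out_degree_eq_sum_arc_weight[OF G] sum_distrib_right sum_negf sum_subtractf right_diff_distrib)
  finally show ?thesis by (simp add: u_def)
qed

text \<open>Exchanging the two endpoints and adding turns \<open>x u * (x u - x v)\<close> into a
  square, hence the factor 2.\<close>

lemma laplacian_quadratic_form:
  fixes x :: "'a \<Rightarrow> real"
  assumes G: "pair_graph G" and xs: "distinct xs" "set xs = pverts G"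
  defines "X \<equiv> vec (length xs) (\<lambda>i. x (xs ! i))"
  shows "2 * (X \<bullet> (laplacian_mat G xs *\<^sub>v X)) =
    (\<Sum>u\<in>pverts G. \<Sum>v\<in>pverts G. arc_weight G u v * (x u - x v)\<^sup>2)"
proof -
  let ?V = "pverts G"
  define n where "n = length xs"
  have bij: "bij_betw (nth xs) {..<n} ?V"
    using bij_betw_nth[OF xs(1), of "{..<n}" "pverts G"] xs by (simp add: n_def)
  have dim: "dim_row (laplacian_mat G xs) = length xs" by (simp add: laplacian_mat_def)
  define s where "s = (\<Sum>u\<in>?V. \<Sum>v\<in>?V. arc_weight G u v * (x u * (x u - x v)))"
  have "X \<bullet> (laplacian_mat G xs *\<^sub>v X) =
      (\<Sum>i<n. x (xs ! i) * (\<Sum>v\<in>?V. arc_weight G (xs ! i) v * (x (xs ! i) - x v)))"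
    unfolding scalar_prod_def
    by (rule sum.cong)
       (auto simp: X_def n_def laplacian_mat_mult_vec[OF G xs, of _ x] dim
         simp del: index_mult_mat_vec)
  also have "\<dots> = (\<Sum>u\<in>?V. x u * (\<Sum>v\<in>?V. arc_weight G u v * (x u - x v)))"
    by (rule sum.reindex_bij_betw[OF bij])
  also have "\<dots> = s" by (simp add: s_def sum_distrib_left mult_ac)
  finally have 1: "X \<bullet> (laplacian_mat G xs *\<^sub>v X) = s" .
  have "s = (\<Sum>u\<in>?V. \<Sum>v\<in>?V. arc_weight G v u * (x v * (x v - x u)))"
    unfolding s_def by (rule sum.swap)
  also have "\<dots> = (\<Sum>u\<in>?V. \<Sum>v\<in>?V. arc_weight G u v * (x v * (x v - x u)))"
    by (simp only: arc_weight_commute[OF G])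
  finally have "2 * s = (\<Sum>u\<in>?V. \<Sum>v\<in>?V. arc_weight G u v * (x u * (x u - x v)) + arc_weight G u v * (x v * (x v - x u)))"
    unfolding sum.distrib by (simp add: s_def)
  also have "\<dots> = (\<Sum>u\<in>?V. \<Sum>v\<in>?V. arc_weight G u v * (x u - x v)\<^sup>2)"
    by (intro sum.cong refl) (simp add: power2_eq_square algebra_simps)
  finally show ?thesis using 1 by simp
qed

lemma laplacian_mat_carrier [simp]: "laplacian_mat G xs \<in> carrier_mat (length xs) (length xs)"
  by (simp add: laplacian_mat_def)

lemma transpose_laplacian_mat:
  assumes "pair_graph G"
  shows "transpose_mat (laplacian_mat G xs) = laplacian_mat G xs"
proof -
  interpret pair_graph G by fact
  have "(u, v) \<in> parcs G \<longleftrightarrow> (v, u) \<in> parcs G" for u v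
    using pair_sym_arcs by (auto simp: symmetric_def sym_def)
  then show ?thesis by (intro eq_matI) (auto simp: laplacian_mat_def)
qed

text \<open>In an orthonormal eigenbasis starting with the constant vector, the functions of sum
  zero are spanned by the other eigenvectors. All eigenvalues are nonnegative and the constant has
  eigenvalue 0, so index 1 of the sorted list is the least eigenvalue of the others, also if 0 is
  multiple.\<close>

theorem algebraic_connectivity_variational:
  fixes G :: "'a pair_pre_digraph"
  assumes G: "pair_graph G" and two: "card (pverts G) \<ge> 2"
  shows walk_gap_algebraic_connectivity:
      "walk_gap (pverts G) (arc_weight G) (algebraic_connectivity G)"
    and algebraic_connectivity_attained:
      "\<exists>x. sum x (pverts G) = 0 \<and> (\<Sum>v\<in>pverts G. (x v)\<^sup>2) > 0 \<and>
         (\<Sum>u\<in>pverts G. \<Sum>v\<in>pverts G. arc_weight G u v * (x u - x v)\<^sup>2) =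
         2 * algebraic_connectivity G * (\<Sum>v\<in>pverts G. (x v)\<^sup>2)"
proof -
  interpret pair_graph G by fact
  let ?V = "pverts G"
  \<comment> \<open>The very enumeration chosen in \<open>laplacian_eigenvalues\<close>.\<close>
  define xs where "xs = (SOME xs. distinct xs \<and> set xs = ?V)"
  have "\<exists>xs. distinct xs \<and> set xs = ?V" using finite_distinct_list[OF pair_finite_verts] by blast
  then have "distinct xs \<and> set xs = ?V" unfolding xs_def by (rule someI_ex)
  then have xs: "distinct xs" "set xs = ?V" by auto
  define n where "n = length xs"
  have n: "n \<ge> 2" using two xs distinct_card[of xs] by (simp add: n_def)
  define L where "L = laplacian_mat G xs"
  have L: "L \<in> carrier_mat n n" by (simp add: L_def n_def)
  have Lsym: "transpose_mat L = L" unfolding L_def by (rule transpose_laplacian_mat) fact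
  have bij: "bij_betw (nth xs) {..<n} ?V"
    using bij_betw_nth[OF xs(1), of "{..<n}" "?V"] xs by (simp add: n_def)
  define V where "V x = vec n (\<lambda>i. x (xs ! i) :: real)" for x
  have Vc: "V x \<in> carrier_vec n" for x by (simp add: V_def)
  have inner: "V x \<bullet> V y = (\<Sum>v\<in>?V. x v * y v)" for x y
  proof -
    have "V x \<bullet> V y = (\<Sum>i<n. x (xs ! i) * y (xs ! i))"
      by (simp add: V_def scalar_prod_def lessThan_atLeast0)
    then show ?thesis using sum.reindex_bij_betw[OF bij, of "\<lambda>v. x v * y v"] by simp
  qed
  have form: "2 * (V x \<bullet> (L *\<^sub>v V x)) = (\<Sum>u\<in>?V. \<Sum>v\<in>?V. arc_weight G u v * (x u - x v)\<^sup>2)" for x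
    unfolding V_def L_def n_def by (rule laplacian_quadratic_form[OF G xs])
  have surj: "\<exists>x. V x = X" if "X \<in> carrier_vec n" for X
  proof
    show "V (\<lambda>v. X $ the_inv_into {..<n} (nth xs) v) = X"
      using that bij by (intro eq_vecI) (auto simp: V_def bij_betw_def the_inv_into_f_f)
  qed
  define one where "one = V (\<lambda>_. 1)"
  have onec: "one \<in> carrier_vec n" by (simp add: one_def Vc)
  have one0: "one \<noteq> 0\<^sub>v n"
  proof
    assume "one = 0\<^sub>v n"
    then have "one $ 0 = 0\<^sub>v n $ 0" by simp
    then show False using n by (simp add: one_def V_def)
  qed
  have "L *\<^sub>v one = 0 \<cdot>\<^sub>v one"
  proof (rule eq_vecI)
    fix i assume "i < dim_vec (0 \<cdot>\<^sub>v one)"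
    then have i: "i < length xs" by (simp add: one_def V_def n_def)
    show "(L *\<^sub>v one) $ i = (0 \<cdot>\<^sub>v one) $ i"
      using laplacian_mat_mult_vec[OF G xs i, of "\<lambda>_. 1"] i
      by (simp add: L_def one_def V_def n_def del: index_mult_mat_vec)
  qed (use L in \<open>simp add: one_def V_def\<close>)
  then have "eigenvector L one 0" using onec one0 L by (simp add: eigenvector_def)
  then obtain P es where P: "P \<in> carrier_mat n n" and PP: "transpose_mat P * P = 1\<^sub>m n"
    and es: "length es = n" and LP: "L = P * mat_diag n (\<lambda>i. es ! i) * transpose_mat P"
    and es0: "es ! 0 = 0" and P0: "col P 0 = (1 / sqrt (one \<bullet> one)) \<cdot>\<^sub>v one"
    using real_symmetric_diagonalisation[OF L Lsym] by blast
  define D where "D = mat_diag n (\<lambda>i. es ! i)"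
  have D: "D \<in> carrier_mat n n" by (simp add: D_def)
  have PT: "transpose_mat P \<in> carrier_mat n n" using P by simp
  have PP': "P * transpose_mat P = 1\<^sub>m n" by (rule mat_mult_left_right_inverse[OF PT P PP])
  have LP: "L = P * D * transpose_mat P" using LP by (simp add: D_def)
  have colP: "col P j \<in> carrier_vec n" for j
    using P by (metis carrier_matD(1) carrier_vecI dim_col)
  have orth: "col P i \<bullet> col P j = (if i = j then 1 else 0)" if "i < n" "j < n" for i j
    using that P arg_cong[OF PP, of "\<lambda>M. M $$ (i, j)"] by simp
  have "similar_mat L D"
    unfolding similar_mat_def
    by (intro exI[of _ P] exI[of _ "transpose_mat P"] similar_mat_witI[of _ _ n]) (use L D P PT PP PP' LP in auto)
  then have "char_poly L = char_poly D" by (rule char_poly_similar)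
  also have "\<dots> = (\<Prod>a\<leftarrow>es. [:- a, 1:])"
  proof -
    have "diag_mat D = es"
      using es by (intro nth_equalityI) (auto simp: diag_mat_def D_def mat_diag_def)
    moreover have "upper_triangular D" by (auto simp: D_def mat_diag_def upper_triangular_def)
    ultimately show ?thesis using char_poly_upper_triangular[OF D] by simp
  qed
  finally have cp: "char_poly L = (\<Prod>a\<leftarrow>es. [:- a, 1:])" .
  have "proots (\<Prod>a\<leftarrow>as. [:- a, 1:]) = mset as" for as :: "real list"
  proof (induction as)
    case (Cons a as)
    have "(\<Prod>a\<leftarrow>as. [:- a, 1:]) \<noteq> 0" by (auto simp: prod_list_zero_iff)
    then have "proots ([:- a, 1:] * (\<Prod>a\<leftarrow>as. [:- a, 1:])) = proots [:- a, 1:] + proots (\<Prod>a\<leftarrow>as. [:- a, 1:])"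
      by (intro proots_mult) auto
    then show ?case using Cons by simp
  qed simp
  then have ac: "algebraic_connectivity G = sort es ! 1"
    unfolding algebraic_connectivity_def laplacian_eigenvalues_def xs_def[symmetric] L_def[symmetric] cp by simp
  have quad: "X \<bullet> (L *\<^sub>v X) = (\<Sum>i<n. es ! i * (col P i \<bullet> X)\<^sup>2)" if X: "X \<in> carrier_vec n" for X
  proof -
    define Y where "Y = transpose_mat P *\<^sub>v X"
    have Y: "Y \<in> carrier_vec n" using PT X by (simp add: Y_def)
    have "L *\<^sub>v X = P *\<^sub>v (D *\<^sub>v Y)"
      unfolding LP Y_def using P D PT X by (simp add: assoc_mult_mat_vec[of _ n n _ n])
    then have "X \<bullet> (L *\<^sub>v X) = Y \<bullet> (D *\<^sub>v Y)"
      using transpose_vec_mult_scalar[OF P, of "D *\<^sub>v Y" X] D Y X by (simp add: Y_def)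
    also have "\<dots> = (\<Sum>i<n. Y $ i * (es ! i * Y $ i))"
    proof -
      have "(D *\<^sub>v Y) $ i = es ! i * Y $ i" if "i < n" for i
      proof -
        have "(D *\<^sub>v Y) $ i = (\<Sum>j<n. (if i = j then es ! j else 0) * Y $ j)"
          using that Y by (simp add: D_def mat_diag_def scalar_prod_def lessThan_atLeast0)
        also have "\<dots> = (\<Sum>j<n. if i = j then es ! j * Y $ j else 0)" by (intro sum.cong) auto
        finally show ?thesis using that by simp
      qed
      then show ?thesis
        unfolding scalar_prod_def using D by (intro sum.cong) (auto simp del: index_mult_mat_vec)
    qed
    also have "\<dots> = (\<Sum>i<n. es ! i * (col P i \<bullet> X)\<^sup>2)"
      using P X by (intro sum.cong) (auto simp: Y_def power2_eq_square)
    finally show ?thesis .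
  qed
  have norm: "X \<bullet> X = (\<Sum>i<n. (col P i \<bullet> X)\<^sup>2)" if X: "X \<in> carrier_vec n" for X
  proof -
    define Y where "Y = transpose_mat P *\<^sub>v X"
    have Y: "Y \<in> carrier_vec n" using PT X by (simp add: Y_def)
    have "P *\<^sub>v Y = X"
      unfolding Y_def using P PT X PP' by (simp add: assoc_mult_mat_vec[of _ n n _ n, symmetric])
    then have "X \<bullet> X = Y \<bullet> Y"
      using transpose_vec_mult_scalar[OF P Y X] by (simp add: Y_def)
    also have "\<dots> = (\<Sum>i<n. (col P i \<bullet> X)\<^sup>2)"
      unfolding scalar_prod_def[of Y] using P X Y by (intro sum.cong) (auto simp: Y_def power2_eq_square)
    finally show ?thesis .
  qed
  have colform: "col P i \<bullet> (L *\<^sub>v col P i) = es ! i" if "i < n" for i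
  proof -
    have "col P i \<bullet> (L *\<^sub>v col P i) = (\<Sum>j<n. if j = i then es ! j else 0)"
      unfolding quad[OF colP] using that by (intro sum.cong) (auto simp: orth)
    then show ?thesis using that by simp
  qed
  have es_nonneg: "es ! i \<ge> 0" if "i < n" for i
  proof -
    obtain x where x: "V x = col P i" using surj[OF colP] by blast
    have "0 \<le> 2 * (V x \<bullet> (L *\<^sub>v V x))"
      unfolding form by (intro sum_nonneg mult_nonneg_nonneg) auto
    then show ?thesis using colform[OF that] x by simp
  qed
  \<comment> \<open>Only the 0 belonging to the constant vector is split off; \<open>es'\<close>
    contains further zeros if the graph is disconnected.\<close>
  obtain es' where es': "es = 0 # es'" using es es0 n by (cases es) auto
  have "set es' \<noteq> {}" using es n es' by (cases es') auto
  have "sort es = 0 # sort es'"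
  proof -
    have "a \<ge> 0" if a: "a \<in> set es'" for a
    proof -
      obtain i where "i < length es" "es ! i = a" using a es' by (metis in_set_conv_nth list.set_intros(2))
      then show ?thesis using es_nonneg es by auto
    qed
    then show ?thesis by (simp add: es' insort_is_Cons)
  qed
  then have ac': "algebraic_connectivity G = sort es' ! 0" using ac by simp
  have len': "length (sort es') > 0" using \<open>set es' \<noteq> {}\<close> by (cases es') auto
  have "sort es' ! 0 \<in> set es'" using len' nth_mem[of 0 "sort es'"] by simp
  then obtain m where m: "m < length es'" "es' ! m = algebraic_connectivity G"
    using ac' by (auto simp: in_set_conv_nth)
  have min: "algebraic_connectivity G \<le> es ! i" if "0 < i" "i < n" for i
  proof -
    have "es ! i \<in> set (sort es')" using that es es' by (cases i) auto
    then obtain j where "j < length (sort es')" "sort es' ! j = es ! i"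
      unfolding in_set_conv_nth by blast
    then show ?thesis using sorted_nth_mono[of "sort es'" 0 j] ac' by simp
  qed
  have oneX: "one \<bullet> one > 0"
    using two by (simp add: one_def inner)
  show "walk_gap ?V (arc_weight G) (algebraic_connectivity G)"
    unfolding walk_gap_def
  proof (intro allI impI)
    fix x :: "'a \<Rightarrow> real" assume x: "sum x ?V = 0"
    have "one \<bullet> V x = 0" using x by (simp add: one_def inner)
    then have 0: "col P 0 \<bullet> V x = 0" unfolding P0 using onec Vc by simp
    have "algebraic_connectivity G * (V x \<bullet> V x) = (\<Sum>i<n. algebraic_connectivity G * (col P i \<bullet> V x)\<^sup>2)"
      by (simp add: norm[OF Vc] sum_distrib_left)
    also have "\<dots> \<le> (\<Sum>i<n. es ! i * (col P i \<bullet> V x)\<^sup>2)"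
    proof (rule sum_mono)
      fix i assume "i \<in> {..<n}"
      then show "algebraic_connectivity G * (col P i \<bullet> V x)\<^sup>2 \<le> es ! i * (col P i \<bullet> V x)\<^sup>2"
        using 0 min[of i] by (cases "i = 0") (auto intro: mult_right_mono)
    qed
    also have "\<dots> = V x \<bullet> (L *\<^sub>v V x)" by (simp add: quad[OF Vc])
    finally show "2 * algebraic_connectivity G * (\<Sum>v\<in>?V. (x v)\<^sup>2) \<le>
        (\<Sum>u\<in>?V. \<Sum>v\<in>?V. arc_weight G u v * (x u - x v)\<^sup>2)"
      unfolding form[symmetric] by (simp add: inner power2_eq_square)
  qed
  show "\<exists>x. sum x ?V = 0 \<and> (\<Sum>v\<in>?V. (x v)\<^sup>2) > 0 \<and>
       (\<Sum>u\<in>?V. \<Sum>v\<in>?V. arc_weight G u v * (x u - x v)\<^sup>2) =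
       2 * algebraic_connectivity G * (\<Sum>v\<in>?V. (x v)\<^sup>2)"
  proof -
    \<comment> \<open>Positions in \<open>es'\<close> are shifted by one against \<open>es\<close>,
      hence the column \<open>Suc m\<close>.\<close>
    have mn: "Suc m < n" using m es es' by simp
    obtain x where x: "V x = col P (Suc m)" using surj[OF colP] by blast
    have "col P 0 \<bullet> V x = 0" using orth[of 0 "Suc m"] mn x by simp
    then have "one \<bullet> V x = 0" unfolding P0 using onec Vc oneX by simp
    then have 1: "sum x ?V = 0" by (simp add: one_def inner)
    have 2: "(\<Sum>v\<in>?V. (x v)\<^sup>2) = 1"
      using orth[of "Suc m" "Suc m"] mn x inner[of x x] by (simp add: power2_eq_square)
    have "(\<Sum>u\<in>?V. \<Sum>v\<in>?V. arc_weight G u v * (x u - x v)\<^sup>2) = 2 * algebraic_connectivity G"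
      unfolding form[symmetric] x colform[OF mn] using m es' by simp
    with 1 2 show ?thesis by (intro exI[of _ x]) simp
  qed
qed

lemma algebraic_connectivity_le:
  assumes "pair_graph G" "card (pverts G) \<ge> 2" "sum x (pverts G) = 0" "(\<Sum>v\<in>pverts G. (x v)\<^sup>2) > 0"
    and "(\<Sum>u\<in>pverts G. \<Sum>v\<in>pverts G. arc_weight G u v * (x u - x v)\<^sup>2) \<le> 2 * t * (\<Sum>v\<in>pverts G. (x v)\<^sup>2)"
  shows "algebraic_connectivity G \<le> t"
proof -
  have "2 * algebraic_connectivity G * (\<Sum>v\<in>pverts G. (x v)\<^sup>2) \<le> 2 * t * (\<Sum>v\<in>pverts G. (x v)\<^sup>2)"
    using walk_gap_algebraic_connectivity[OF assms(1,2), unfolded walk_gap_def, rule_format, OF assms(3)] assms(5)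
    by linarith
  then show ?thesis using assms(4) by simp
qed

lemma le_algebraic_connectivity:
  assumes "pair_graph G" "card (pverts G) \<ge> 2" "walk_gap (pverts G) (arc_weight G) t"
  shows "t \<le> algebraic_connectivity G"
proof -
  obtain x where x: "sum x (pverts G) = 0" "(\<Sum>v\<in>pverts G. (x v)\<^sup>2) > 0"
     "(\<Sum>u\<in>pverts G. \<Sum>v\<in>pverts G. arc_weight G u v * (x u - x v)\<^sup>2) =
         2 * algebraic_connectivity G * (\<Sum>v\<in>pverts G. (x v)\<^sup>2)"
    using algebraic_connectivity_attained[OF assms(1,2)] by blast
  then have "2 * t * (\<Sum>v\<in>pverts G. (x v)\<^sup>2) \<le> 2 * algebraic_connectivity G * (\<Sum>v\<in>pverts G. (x v)\<^sup>2)"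
    using assms(3)[unfolded walk_gap_def, rule_format, OF x(1)] by simp
  then show ?thesis using x(2) by simp
qed

section \<open>Algebraic connectivity of token graphs\<close>

lemma pverts_token_graph: "pverts (token_graph k G) = {A. A \<subseteq> pverts G \<and> card A = k}"
  by (simp add: token_graph_def)

text \<open>Two sets of equal size whose symmetric difference has two elements differ by one element
  on each side; so an arc of the token graph moves one token along an arc of
  \<open>G\<close>.\<close>

lemma token_graph_neighbours:
  assumes G: "pair_graph G" and A: "A \<subseteq> pverts G" "card A = k"
  shows "bij_betw (\<lambda>(u, v). insert v (A - {u}))
     {(u, v). u \<in> A \<and> v \<in> pverts G - A \<and> (u, v) \<in> parcs G}
     {B. (A, B) \<in> parcs (token_graph k G)}"
proof -
  interpret pair_graph G by fact
  have fin: "finite A" using A pair_finite_verts finite_subset by blast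
  have sym: "(a, b) \<in> parcs G \<Longrightarrow> (b, a) \<in> parcs G" for a b
    using pair_sym_arcs by (auto simp: symmetric_def sym_def)
  have arc: "(A, B) \<in> parcs (token_graph k G) \<longleftrightarrow>
      B \<subseteq> pverts G \<and> card B = k \<and> (\<exists>a b. (a, b) \<in> parcs G \<and> sym_diff A B = {a, b})" for B
    using A by (simp add: token_graph_def)
  show ?thesis
  proof (rule bij_betw_imageI)
    show "inj_on (\<lambda>(u, v). insert v (A - {u})) {(u, v). u \<in> A \<and> v \<in> pverts G - A \<and> (u, v) \<in> parcs G}"
    proof (rule inj_onI, clarify)
      fix u v u' v' assume *: "u \<in> A" "v \<notin> A" "u' \<in> A" "v' \<notin> A" "insert v (A - {u}) = insert v' (A - {u'})"
      then have "v = v'" by blast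
      moreover have "u = u'"
      proof -
        have "u \<notin> insert v (A - {u})" using * by auto
        then show ?thesis unfolding *(5) using * by auto
      qed
      ultimately show "u = u' \<and> v = v'" by blast
    qed
    show "(\<lambda>(u, v). insert v (A - {u})) ` {(u, v). u \<in> A \<and> v \<in> pverts G - A \<and> (u, v) \<in> parcs G} =
       {B. (A, B) \<in> parcs (token_graph k G)}"
    proof (intro equalityI subsetI)
      fix B assume "B \<in> (\<lambda>(u, v). insert v (A - {u})) ` {(u, v). u \<in> A \<and> v \<in> pverts G - A \<and> (u, v) \<in> parcs G}"
      then obtain u v where uv: "u \<in> A" "v \<in> pverts G" "v \<notin> A" "(u, v) \<in> parcs G" and B: "B = insert v (A - {u})"
        by blast
      have "card B = k" using card_Suc_Diff1[OF fin uv(1)] uv A fin by (simp add: B)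
      moreover have "sym_diff A B = {u, v}" using uv by (auto simp: B)
      ultimately show "B \<in> {B. (A, B) \<in> parcs (token_graph k G)}"
        using uv A by (auto simp: arc B)
    next
      fix B assume "B \<in> {B. (A, B) \<in> parcs (token_graph k G)}"
      then obtain a b where B: "B \<subseteq> pverts G" "card B = k" and ab: "(a, b) \<in> parcs G" "sym_diff A B = {a, b}"
        by (auto simp: arc)
      have finB: "finite B" using B pair_finite_verts finite_subset by blast
      have "a \<noteq> b" using ab no_loops' by blast
      have eq: "card (A - B) = card (B - A)"
        using A(2) B(2) fin finB by (simp add: card_Diff_subset_Int Int_commute)
      have "card (A - B) + card (B - A) = card {a, b}"
        unfolding ab(2)[symmetric] using fin finB by (intro card_Un_disjoint[symmetric]) auto
      then have one: "card (A - B) = 1" "card (B - A) = 1" using eq \<open>a \<noteq> b\<close> by auto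
      then obtain u v where u: "A - B = {u}" and v: "B - A = {v}" by (meson card_1_singletonE)
      then have "{u, v} = {a, b}" using ab(2) by (simp add: insert_commute)
      then have "(u, v) \<in> parcs G" using ab sym by (auto simp: doubleton_eq_iff)
      moreover have "B = insert v (A - {u})" using u v by blast
      moreover have "u \<in> A" "v \<in> pverts G - A" using u v B by blast+
      ultimately show "B \<in> (\<lambda>(u, v). insert v (A - {u})) ` {(u, v). u \<in> A \<and> v \<in> pverts G - A \<and> (u, v) \<in> parcs G}"
        by blast
    qed
  qed
qed

text \<open>At a set \<open>A\<close> only pairs with exactly one endpoint in \<open>A\<close>
  contribute, each leading to a neighbour in the token graph. Both orders of a pair occur, hence the
  factor 2.\<close>

lemma token_graph_energy:
  assumes G: "pair_graph G" and f: "\<And>A. A \<subseteq> pverts G \<Longrightarrow> card A \<noteq> k \<Longrightarrow> f A = 0"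
  defines "W \<equiv> pverts (token_graph k G)"
  shows "token_energy (pverts G) (arc_weight G) f =
    2 * (\<Sum>A\<in>W. \<Sum>B\<in>W. arc_weight (token_graph k G) A B * (f A - f B)\<^sup>2)"
proof -
  interpret pair_graph G by fact
  let ?V = "pverts G" and ?c = "arc_weight G"
  have W: "W = {A. A \<subseteq> ?V \<and> card A = k}" by (simp add: W_def pverts_token_graph)
  have finW: "finite W" using pair_finite_verts by (simp add: W)
  have one: "(\<Sum>u\<in>?V. \<Sum>v\<in>?V. ?c u v * (f A - f (swap_tokens u v A))\<^sup>2) =
      2 * (\<Sum>B\<in>W. arc_weight (token_graph k G) A B * (f A - f B)\<^sup>2)" if A: "A \<in> W" for A
  proof -
    define g where "g u v = ?c u v * (f A - f (swap_tokens u v A))\<^sup>2" for u v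
    define C where "C = ?V - A"
    have AV: "A \<subseteq> ?V" "card A = k" using A by (auto simp: W)
    have fin: "finite A" "finite C"
      using finite_subset[OF AV(1) pair_finite_verts] pair_finite_verts by (simp_all add: C_def)
    have V: "?V = A \<union> C" "A \<inter> C = {}" using AV by (auto simp: C_def)
    have gsym: "g u v = g v u" for u v
      by (simp add: g_def arc_weight_commute[OF G, of u v] swap_tokens_commute[of u v])
    have "(\<Sum>u\<in>?V. \<Sum>v\<in>?V. g u v) =
        (\<Sum>u\<in>A. \<Sum>v\<in>A. g u v) + (\<Sum>u\<in>A. \<Sum>v\<in>C. g u v) + ((\<Sum>u\<in>C. \<Sum>v\<in>A. g u v) + (\<Sum>u\<in>C. \<Sum>v\<in>C. g u v))"
      using fin V(2) by (simp add: V(1) sum.union_disjoint sum.distrib)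
    also have "(\<Sum>u\<in>A. \<Sum>v\<in>A. g u v) = 0"
      by (simp add: g_def swap_tokens_inside)
    also have "(\<Sum>u\<in>C. \<Sum>v\<in>C. g u v) = 0"
      by (intro sum.neutral ballI) (auto simp: g_def C_def)
    also have "(\<Sum>u\<in>C. \<Sum>v\<in>A. g u v) = (\<Sum>u\<in>A. \<Sum>v\<in>C. g u v)"
      by (subst sum.swap) (simp add: gsym)
    finally have 1: "(\<Sum>u\<in>?V. \<Sum>v\<in>?V. g u v) = 2 * (\<Sum>u\<in>A. \<Sum>v\<in>C. g u v)" by simp
    let ?E = "{(u, v). u \<in> A \<and> v \<in> ?V - A \<and> (u, v) \<in> parcs G}"
    have "(\<Sum>u\<in>A. \<Sum>v\<in>C. g u v) = (\<Sum>p\<in>A \<times> C. g (fst p) (snd p))"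
      by (simp add: sum.cartesian_product case_prod_beta)
    also have "\<dots> = (\<Sum>p\<in>?E. g (fst p) (snd p))"
      by (rule sum.mono_neutral_right) (use fin in \<open>auto simp: C_def g_def arc_weight_def\<close>)
    also have "\<dots> = (\<Sum>p\<in>?E. (f A - f ((\<lambda>(u, v). insert v (A - {u})) p))\<^sup>2)"
      by (rule sum.cong) (auto simp: g_def arc_weight_def swap_tokens_move)
    also have "\<dots> = (\<Sum>B\<in>{B. (A, B) \<in> parcs (token_graph k G)}. (f A - f B)\<^sup>2)"
      by (rule sum.reindex_bij_betw[OF token_graph_neighbours[OF G AV]])
    also have "\<dots> = (\<Sum>B\<in>W. arc_weight (token_graph k G) A B * (f A - f B)\<^sup>2)"
    proof (rule sum.mono_neutral_cong_left[OF finW])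
      show "{B. (A, B) \<in> parcs (token_graph k G)} \<subseteq> W"
        by (auto simp: W token_graph_def)
    qed (auto simp: arc_weight_def)
    finally show ?thesis using 1 by (simp add: g_def)
  qed
  have "token_energy ?V ?c f = (\<Sum>A\<in>Pow ?V. \<Sum>u\<in>?V. \<Sum>v\<in>?V. ?c u v * (f A - f (swap_tokens u v A))\<^sup>2)"
    unfolding token_energy_def swap_energy_def sum_distrib_left
    by (subst (2) sum.swap, subst sum.swap, rule refl)
  also have "\<dots> = (\<Sum>A\<in>W. \<Sum>u\<in>?V. \<Sum>v\<in>?V. ?c u v * (f A - f (swap_tokens u v A))\<^sup>2)"
  proof (rule sum.mono_neutral_right)
    \<comment> \<open>Transpositions preserve cardinality, so both values of \<open>f\<close> are 0
      outside \<open>W\<close>.\<close>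
    show "\<forall>A\<in>Pow ?V - W. (\<Sum>u\<in>?V. \<Sum>v\<in>?V. ?c u v * (f A - f (swap_tokens u v A))\<^sup>2) = 0"
      by (intro ballI sum.neutral) (auto simp: W f swap_tokens_subset_iff)
  qed (use pair_finite_verts in \<open>auto simp: W\<close>)
  also have "\<dots> = 2 * (\<Sum>A\<in>W. \<Sum>B\<in>W. arc_weight (token_graph k G) A B * (f A - f B)\<^sup>2)"
    unfolding sum_distrib_left[of 2] by (intro sum.cong refl) (simp add: one sum_distrib_left)
  finally show ?thesis .
qed

text \<open>Pascal's rule splits the binomial coefficient into two positive summands.\<close>

lemma card_pverts_token_graph_ge_2:
  assumes G: "pair_graph G" and k: "1 \<le> k" "k < card (pverts G)"
  shows "card (pverts (token_graph k G)) \<ge> 2"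
proof -
  interpret pair_graph G by fact
  have "card (pverts (token_graph k G)) = card (pverts G) choose k"
    unfolding pverts_token_graph by (rule n_subsets[OF pair_finite_verts])
  also obtain n j where nj: "card (pverts G) = Suc n" "k = Suc j" using k by (cases "card (pverts G)"; cases k) auto
  then have "card (pverts G) choose k = (n choose j) + (n choose Suc j)" by simp
  moreover have "0 < n choose j" "0 < n choose Suc j" using k nj by auto
  ultimately show ?thesis by linarith
qed

text \<open>One inequality is the gap for set functions, applied to functions on
  \<open>k\<close>-sets extended by zero. The other comes from lifting a minimiser on the
  vertices.\<close>

theorem algebraic_connectivity_token_graph:
  assumes G: "pair_graph G" and k: "1 \<le> k" "k < card (pverts G)"
  shows "algebraic_connectivity (token_graph k G) = algebraic_connectivity G"
proof (rule antisym)
  interpret pair_graph G by fact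
  let ?V = "pverts G" and ?F = "token_graph k G"
  define W where "W = pverts ?F"
  have W: "W = {A. A \<subseteq> ?V \<and> card A = k}" by (simp add: W_def pverts_token_graph)
  have F: "pair_graph ?F" by (rule pair_graph_token_graph) fact
  have two: "card ?V \<ge> 2" using k by simp
  have twoF: "card (pverts ?F) \<ge> 2" by (rule card_pverts_token_graph_ge_2[OF G k])
  have sumW: "(\<Sum>A\<in>Pow ?V. h A) = (\<Sum>A\<in>W. h A)" if "\<And>A. A \<subseteq> ?V \<Longrightarrow> card A \<noteq> k \<Longrightarrow> h A = 0"
    for h :: "'a set \<Rightarrow> real"
    by (rule sum.mono_neutral_right) (use pair_finite_verts that in \<open>auto simp: W\<close>)
  show "algebraic_connectivity G \<le> algebraic_connectivity ?F"
  proof (rule le_algebraic_connectivity[OF F twoF])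
    have gap: "token_gap ?V (arc_weight G) k (algebraic_connectivity G)"
      by (rule token_gap_if_walk_gap)
         (use pair_finite_verts arc_weight_commute[OF G] walk_gap_algebraic_connectivity[OF G two] in auto)
    show "walk_gap (pverts ?F) (arc_weight ?F) (algebraic_connectivity G)"
      unfolding walk_gap_def W_def[symmetric]
    proof (intro allI impI)
      fix f :: "'a set \<Rightarrow> real" assume f: "sum f W = 0"
      define h where "h A = (if card A = k then f A else 0)" for A
      have h0: "h A = 0" if "A \<subseteq> ?V" "card A \<noteq> k" for A using that by (simp add: h_def)
      have hW: "h A = f A" if "A \<in> W" for A using that by (simp add: h_def W)
      have "sum h (Pow ?V) = 0" using sumW[of h] h0 f hW by simp
      then have "4 * algebraic_connectivity G * (\<Sum>A\<in>Pow ?V. (h A)\<^sup>2) \<le> token_energy ?V (arc_weight G) h"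
        using h0 by (intro gap[unfolded token_gap_def, rule_format]) auto
      moreover have "(\<Sum>A\<in>Pow ?V. (h A)\<^sup>2) = (\<Sum>A\<in>W. (f A)\<^sup>2)"
        using sumW[of "\<lambda>A. (h A)\<^sup>2"] h0 hW by simp
      moreover have "token_energy ?V (arc_weight G) h =
          2 * (\<Sum>A\<in>W. \<Sum>B\<in>W. arc_weight ?F A B * (f A - f B)\<^sup>2)"
        using token_graph_energy[OF G, of k h] h0 hW unfolding W_def[symmetric] by simp
      ultimately show "2 * algebraic_connectivity G * (\<Sum>A\<in>W. (f A)\<^sup>2) \<le>
          (\<Sum>A\<in>W. \<Sum>B\<in>W. arc_weight ?F A B * (f A - f B)\<^sup>2)" by simp
    qed
  qed
  show "algebraic_connectivity ?F \<le> algebraic_connectivity G"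
  proof -
    define K where "K = real ((card ?V - 2) choose (k - 1))"
    have K: "K > 0" using k by (simp add: K_def)
    obtain x where x: "sum x ?V = 0" "(\<Sum>v\<in>?V. (x v)\<^sup>2) > 0"
       "(\<Sum>u\<in>?V. \<Sum>v\<in>?V. arc_weight G u v * (x u - x v)\<^sup>2) = 2 * algebraic_connectivity G * (\<Sum>v\<in>?V. (x v)\<^sup>2)"
      using algebraic_connectivity_attained[OF G two] by blast
    define h where "h = token_lift k x"
    have h0: "h A = 0" if "A \<subseteq> ?V" "card A \<noteq> k" for A using that by (simp add: h_def token_lift_def)
    have n: "(\<Sum>A\<in>W. (h A)\<^sup>2) = K * (\<Sum>v\<in>?V. (x v)\<^sup>2)"
      using sumW[of "\<lambda>A. (h A)\<^sup>2"] h0 sum_lift_power2[OF pair_finite_verts k(1) x(1)]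
      by (simp add: h_def K_def)
    have "sum h W = 0"
      using sumW[of h] h0 sum_lift_eq_0[OF pair_finite_verts k(1) x(1)] by (simp add: h_def)
    moreover have "(\<Sum>A\<in>W. (h A)\<^sup>2) > 0" using n K x(2) by simp
    moreover have "(\<Sum>A\<in>W. \<Sum>B\<in>W. arc_weight ?F A B * (h A - h B)\<^sup>2) \<le> 2 * algebraic_connectivity G * (\<Sum>A\<in>W. (h A)\<^sup>2)"
    proof -
      have "2 * (\<Sum>A\<in>W. \<Sum>B\<in>W. arc_weight ?F A B * (h A - h B)\<^sup>2) = token_energy ?V (arc_weight G) h"
        using token_graph_energy[OF G, of k h] h0 unfolding W_def[symmetric] by simp
      also have "\<dots> = 2 * K * (2 * algebraic_connectivity G * (\<Sum>v\<in>?V. (x v)\<^sup>2))"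
        unfolding h_def token_energy_lift[OF pair_finite_verts k(1) x(1)] x(3) K_def ..
      finally show ?thesis by (simp add: n)
    qed
    ultimately show ?thesis
      by (intro algebraic_connectivity_le[OF F twoF, of h]) (simp_all add: W_def)
  qed
qed

section \<open>Paths with one Dirichlet end\<close>

text \<open>Summation by parts: the boundary term at 0 vanishes, the one at \<open>m\<close>
  remains.\<close>

lemma path_dirichlet_eq:
  fixes p :: "nat \<Rightarrow> real"
  assumes p0: "p 0 = 0" and rec: "\<And>j. j \<ge> 1 \<Longrightarrow> t * p j = 2 * p j - p (j - 1) - p (j + 1)"
  shows "(\<Sum>j=1..m. (p j - p (j - 1))\<^sup>2) = t * (\<Sum>j=1..m. (p j)\<^sup>2) + p m * (p (m + 1) - p m)"
proof (induction m)
  case 0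
  then show ?case by (simp add: p0)
next
  case (Suc m)
  have r: "t * p (Suc m) = 2 * p (Suc m) - p m - p (Suc (Suc m))" using rec[of "Suc m"] by simp
  have "t * (p (Suc m))\<^sup>2 = (2 * p (Suc m) - p m - p (Suc (Suc m))) * p (Suc m)"
    unfolding r[symmetric] by (simp add: power2_eq_square)
  then show ?case using Suc by (simp add: power2_eq_square algebra_simps)
qed

text \<open>Discrete Picone inequality: the positive solution \<open>p\<close> of the recurrence serves as ground state.\<close>

lemma path_dirichlet_ge:
  fixes p y :: "nat \<Rightarrow> real"
  assumes p0: "p 0 = 0" and rec: "\<And>j. j \<ge> 1 \<Longrightarrow> t * p j = 2 * p j - p (j - 1) - p (j + 1)"
    and pos: "\<And>j. 1 \<le> j \<Longrightarrow> j \<le> r \<Longrightarrow> p j > 0" and y0: "y 0 = 0"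
    and m: "1 \<le> m" "m \<le> r"
  shows "(\<Sum>j=1..m. (y j - y (j - 1))\<^sup>2) \<ge> t * (\<Sum>j=1..m. (y j)\<^sup>2) + (y m)\<^sup>2 * (p (m + 1) - p m) / p m"
  using m
proof (induction m rule: nat_induct_at_least)
  case base
  have "p 1 > 0" using pos[of 1] base by simp
  moreover have "t * p 1 = 2 * p 1 - p 2" using rec[of 1] p0 by (simp add: numeral_2_eq_2)
  ultimately have "t + (p 2 - p 1) / p 1 = 1" by (simp add: field_simps)
  then have "t * (y 1)\<^sup>2 + (y 1)\<^sup>2 * (p 2 - p 1) / p 1 = (y 1)\<^sup>2"
    by (metis (no_types, opaque_lifting) distrib_right mult.commute mult_1 times_divide_eq_right)
  then show ?case by (simp add: y0 numeral_2_eq_2)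
next
  case (Suc m)
  have P: "p m > 0" "p (Suc m) > 0" using pos[of m] pos[of "Suc m"] Suc by auto
  have r: "t * p (Suc m) = 2 * p (Suc m) - p m - p (Suc (Suc m))" using rec[of "Suc m"] by simp
  have t: "t + (p (Suc (Suc m)) - p (Suc m)) / p (Suc m) = (p (Suc m) - p m) / p (Suc m)"
  proof -
    have "t = (2 * p (Suc m) - p m - p (Suc (Suc m))) / p (Suc m)" using r P by (simp add: field_simps)
    then show ?thesis by (simp add: add_divide_distrib[symmetric])
  qed
  \<comment> \<open>Completing the square, which measures how far \<open>y\<close> is from being
    proportional to \<open>p\<close>.\<close>
  have sq: "(y (Suc m) - y m)\<^sup>2 + (y m)\<^sup>2 * (p (Suc m) - p m) / p m - (y (Suc m))\<^sup>2 * ((p (Suc m) - p m) / p (Suc m))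
      = (y m * p (Suc m) - y (Suc m) * p m)\<^sup>2 / (p m * p (Suc m))"
    using P by (simp add: field_simps power2_eq_square)
  have "0 \<le> (y m * p (Suc m) - y (Suc m) * p m)\<^sup>2 / (p m * p (Suc m))" using P by simp
  then have "(y (Suc m))\<^sup>2 * ((p (Suc m) - p m) / p (Suc m)) \<le> (y (Suc m) - y m)\<^sup>2 + (y m)\<^sup>2 * (p (Suc m) - p m) / p m"
    unfolding sq[symmetric] by simp
  then have "t * (y (Suc m))\<^sup>2 + (y (Suc m))\<^sup>2 * (p (Suc (Suc m)) - p (Suc m)) / p (Suc m)
      \<le> (y (Suc m) - y m)\<^sup>2 + (y m)\<^sup>2 * (p (Suc m) - p m) / p m"
    unfolding t[symmetric] by (simp add: algebra_simps)
  moreover have "t * (\<Sum>j=1..m. (y j)\<^sup>2) + (y m)\<^sup>2 * (p (Suc m) - p m) / p m \<le> (\<Sum>j=1..m. (y j - y (j - 1))\<^sup>2)"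
    using Suc by simp
  ultimately show ?case by (simp add: distrib_left)
qed

text \<open>The least positive frequency for which \<open>sin (j * tail_angle r)\<close>, which is 0
  at \<open>j = 0\<close>, takes equal values at \<open>r\<close> and \<open>r + 1\<close>, that is,
  has a free end at \<open>r\<close>.\<close>

definition tail_angle :: "nat \<Rightarrow> real" where
  "tail_angle r = pi / (2 * real r + 1)"

text \<open>The eigenvalue of the negative second difference at this frequency.\<close>

definition tail_value :: "nat \<Rightarrow> real" where
  "tail_value r = 2 - 2 * cos (tail_angle r)"

lemma tail_value_eq: "tail_value r = 2 + 2 * cos (2 * real r * pi / (2 * real r + 1))"
proof -
  have "2 * real r * pi / (2 * real r + 1) = pi - tail_angle r"
    by (simp add: tail_angle_def field_simps)
  then show ?thesis by (simp add: tail_value_def)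
qed

lemma sin_tail_recurrence:
  assumes "j \<ge> 1"
  shows "tail_value r * sin (real j * tail_angle r) =
    2 * sin (real j * tail_angle r) - sin (real (j - 1) * tail_angle r) - sin (real (j + 1) * tail_angle r)"
proof -
  let ?a = "real j * tail_angle r" and ?b = "tail_angle r"
  have "real (j - 1) * ?b = ?a - ?b" "real (j + 1) * ?b = ?a + ?b"
    using assms by (simp_all add: algebra_simps of_nat_diff)
  then show ?thesis by (simp only: sin_add sin_diff tail_value_def) (simp add: algebra_simps)
qed

lemma sin_tail_pos:
  assumes "1 \<le> j" "j \<le> r"
  shows "sin (real j * tail_angle r) > 0"
proof (rule sin_gt_zero)
  show "0 < real j * tail_angle r" using assms by (simp add: tail_angle_def)
  have "real j * pi < (2 * real r + 1) * pi" using assms by (intro mult_strict_right_mono) auto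
  then show "real j * tail_angle r < pi" by (simp add: tail_angle_def field_simps)
qed

text \<open>The two angles add up to \<open>pi\<close>. This makes the boundary term at the free end
  vanish in the energy identity and in the Poincare inequality.\<close>

lemma sin_tail_end: "sin (real (r + 1) * tail_angle r) = sin (real r * tail_angle r)"
proof -
  have "real (r + 1) * tail_angle r = pi - real r * tail_angle r"
    by (simp add: tail_angle_def field_simps)
  then show ?thesis by simp
qed

lemma sin_tail_energy:
  "(\<Sum>j=1..r. (sin (real j * tail_angle r) - sin (real (j - 1) * tail_angle r))\<^sup>2) =
   tail_value r * (\<Sum>j=1..r. (sin (real j * tail_angle r))\<^sup>2)"
  using path_dirichlet_eq[of "\<lambda>j. sin (real j * tail_angle r)" "tail_value r" r]
    sin_tail_recurrence[of _ r] sin_tail_end[of r] by simp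

lemma tail_poincare:
  fixes y :: "nat \<Rightarrow> real"
  assumes "y 0 = 0"
  shows "tail_value r * (\<Sum>j=1..r. (y j)\<^sup>2) \<le> (\<Sum>j=1..r. (y j - y (j - 1))\<^sup>2)"
proof (cases "r = 0")
  case False
  then show ?thesis
    using path_dirichlet_ge[of "\<lambda>j. sin (real j * tail_angle r)" "tail_value r" r y r]
      sin_tail_recurrence[of _ r] sin_tail_pos[of _ r] sin_tail_end[of r] assms by simp
qed simp

section \<open>Kite graphs\<close>

text \<open>Each edge is counted once per arc, hence twice, as in the double sum of
  \<open>walk_gap\<close>.\<close>

definition arc_energy :: "'a pair_pre_digraph \<Rightarrow> ('a \<Rightarrow> real) \<Rightarrow> real" where
  "arc_energy G x = (\<Sum>(a, b)\<in>parcs G. (x a - x b)\<^sup>2)"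

lemma sum_arc_weight_eq_arc_energy:
  assumes "pair_graph G"
  shows "(\<Sum>u\<in>pverts G. \<Sum>v\<in>pverts G. arc_weight G u v * (x u - x v)\<^sup>2) = arc_energy G x"
proof -
  interpret pair_graph G by fact
  have "(\<Sum>u\<in>pverts G. \<Sum>v\<in>pverts G. arc_weight G u v * (x u - x v)\<^sup>2) =
      (\<Sum>(u, v)\<in>pverts G \<times> pverts G. arc_weight G u v * (x u - x v)\<^sup>2)"
    by (rule sum.cartesian_product)
  also have "\<dots> = arc_energy G x"
    unfolding arc_energy_def
    by (rule sum.mono_neutral_cong_right)
       (use pair_finite_verts in \<open>auto simp: arc_weight_def dest: in_arcsD1 in_arcsD2\<close>)
  finally show ?thesis .
qed

lemma arc_energy_add_edges:
  assumes G': "adds_edges_within G S G'" and eq: "\<And>a b. (a, b) \<in> S \<Longrightarrow> x a = x b"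
  shows "arc_energy G' x = arc_energy G x"
proof -
  interpret pair_graph G' using G' by (simp add: adds_edges_within_def)
  show ?thesis
    unfolding arc_energy_def
    by (rule sum.mono_neutral_right) (use G' eq in \<open>auto simp: adds_edges_within_def\<close>)
qed

lemma algebraic_connectivity_mono:
  assumes G: "pair_graph G" "card (pverts G) \<ge> 2" and G': "adds_edges_within G S G'"
  shows "algebraic_connectivity G \<le> algebraic_connectivity G'"
proof (rule le_algebraic_connectivity)
  show PG': "pair_graph G'" and two: "card (pverts G') \<ge> 2"
    using G G' by (auto simp: adds_edges_within_def)
  interpret G': pair_graph G' by fact
  have V: "pverts G' = pverts G" and sub: "parcs G \<subseteq> parcs G'" using G' by (auto simp: adds_edges_within_def)
  have "arc_energy G x \<le> arc_energy G' x" for x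
    unfolding arc_energy_def by (rule sum_mono2) (use sub in auto)
  then show "walk_gap (pverts G') (arc_weight G') (algebraic_connectivity G)"
    using walk_gap_algebraic_connectivity[OF G]
    unfolding walk_gap_def sum_arc_weight_eq_arc_energy[OF PG'] sum_arc_weight_eq_arc_energy[OF G(1)]
    unfolding V using order_trans by blast
qed

text \<open>Level 0 is the common end-vertex, so that each tail is one sequence of levels from 0 to
  \<open>r\<close>.\<close>

definition tail_node :: "'a \<Rightarrow> (nat \<Rightarrow> nat \<Rightarrow> 'a) \<Rightarrow> nat \<Rightarrow> nat \<Rightarrow> 'a" where
  "tail_node v w i j = (if j = 0 then v else w i j)"

section \<open>Vectors and energies on a kite\<close>

context
  fixes H :: "'a pair_pre_digraph" and v :: 'a and w :: "nat \<Rightarrow> nat \<Rightarrow> 'a" and s r :: nat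
  assumes H: "pair_graph H" and lab: "kite_labelling H v w s r" and r: "r \<ge> 1"
begin

interpretation H: pair_graph H by (rule H)

lemma head_arcD: "(a, b) \<in> parcs H \<Longrightarrow> a \<in> pverts H \<and> b \<in> pverts H"
  by (auto dest: H.in_arcsD1 H.in_arcsD2)

lemma v_in_head: "v \<in> pverts H"
  using lab by (simp add: kite_labelling_def)

lemma label_notin_head: "i \<in> {1..s} \<Longrightarrow> j \<in> {1..r} \<Longrightarrow> w i j \<notin> pverts H"
  using lab unfolding kite_labelling_def by blast

lemma label_inj:
  assumes "w i j = w i' j'" "i \<in> {1..s}" "j \<in> {1..r}" "i' \<in> {1..s}" "j' \<in> {1..r}"
  shows "i = i' \<and> j = j'"
proof -
  have "inj_on (\<lambda>(i, j). w i j) ({1..s} \<times> {1..r})" using lab by (simp add: kite_labelling_def)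
  from inj_onD[OF this, of "(i, j)" "(i', j')"] show ?thesis using assms by auto
qed

lemma sum_pverts_kite:
  fixes g :: "'a \<Rightarrow> real"
  shows "sum g (pverts (kite H v w s r)) = sum g (pverts H) + (\<Sum>i=1..s. \<Sum>j=1..r. g (w i j))"
proof -
  let ?T = "(\<lambda>(i, j). w i j) ` ({1..s} \<times> {1..r})"
  have V: "pverts (kite H v w s r) = pverts H \<union> ?T" by (force simp: kite_def)
  have "sum g (pverts (kite H v w s r)) = sum g (pverts H) + sum g ?T"
    unfolding V by (rule sum.union_disjoint) (use H.pair_finite_verts label_notin_head in auto)
  also have "sum g ?T = (\<Sum>p\<in>{1..s} \<times> {1..r}. g ((\<lambda>(i, j). w i j) p))"
    using lab by (intro sum.reindex[unfolded o_def]) (simp add: kite_labelling_def)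
  also have "\<dots> = (\<Sum>i=1..s. \<Sum>j=1..r. g (w i j))"
    by (simp add: sum.cartesian_product case_prod_beta)
  finally show ?thesis .
qed

lemma kite_function_exists:
  fixes a :: "'a \<Rightarrow> real" and z :: "nat \<Rightarrow> nat \<Rightarrow> real"
  obtains x where "\<And>u. u \<in> pverts H \<Longrightarrow> x u = a u"
    "\<And>i j. i \<in> {1..s} \<Longrightarrow> j \<in> {1..r} \<Longrightarrow> x (w i j) = z i j"
proof -
  define l where "l = the_inv_into ({1..s} \<times> {1..r}) (\<lambda>(i, j). w i j)"
  define x where "x u = (if u \<in> pverts H then a u else z (fst (l u)) (snd (l u)))" for u
  have inj: "inj_on (\<lambda>(i, j). w i j) ({1..s} \<times> {1..r})" using lab by (simp add: kite_labelling_def)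
  have "l (w i j) = (i, j)" if "i \<in> {1..s}" "j \<in> {1..r}" for i j
    using the_inv_into_f_f[OF inj, of "(i, j)"] that unfolding l_def by simp
  then have "x (w i j) = z i j" if "i \<in> {1..s}" "j \<in> {1..r}" for i j
    using that label_notin_head by (simp add: x_def)
  moreover have "x u = a u" if "u \<in> pverts H" for u using that by (simp add: x_def)
  ultimately show ?thesis using that by blast
qed

lemma arc_energy_kite:
  "arc_energy (kite H v w s r) x =
     arc_energy H x + 2 * (\<Sum>i=1..s. \<Sum>j=1..r. (x (tail_node v w i j) - x (tail_node v w i (j - 1)))\<^sup>2)"
proof -
  define I where "I = {1..s} \<times> {1..r}"
  \<comment> \<open>The arc of the tail \<open>fst p\<close> that leads up to level
    \<open>snd p\<close>.\<close>
  define f where "f p = (tail_node v w (fst p) (snd p - 1), tail_node v w (fst p) (snd p))" for p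
  have nodeH: "tail_node v w i j \<in> pverts H \<longleftrightarrow> j = 0" if "i \<in> {1..s}" "j \<le> r" for i j
    using that label_notin_head v_in_head by (auto simp: tail_node_def)
  have node_inj: "i = i' \<and> j = j'"
    if "tail_node v w i j = tail_node v w i' j'" "i \<in> {1..s}" "i' \<in> {1..s}" "1 \<le> j" "j \<le> r" "j' \<le> r" for i j i' j'
  proof -
    have "j' \<noteq> 0" using that nodeH[of i j] nodeH[of i' j'] by auto
    then show ?thesis using that label_inj[of i j i' j'] by (auto simp: tail_node_def)
  qed
  have R: "{(v, w i 1) | i. i \<in> {1..s} \<and> 1 \<le> r} \<union> {(w i j, w i (j + 1)) | i j. i \<in> {1..s} \<and> j \<in> {1..<r}} = f ` I"
    (is "?R = _")
  proof (intro equalityI subsetI)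
    fix p assume "p \<in> ?R"
    then consider i where "p = (v, w i 1)" "i \<in> {1..s}" "1 \<le> r" | i j where "p = (w i j, w i (j + 1))" "i \<in> {1..s}" "j \<in> {1..<r}"
      by blast
    then show "p \<in> f ` I"
    proof cases
      case 1
      then show ?thesis by (intro image_eqI[of _ _ "(i, 1)"]) (auto simp: f_def I_def tail_node_def)
    next
      case 2
      then show ?thesis by (intro image_eqI[of _ _ "(i, j + 1)"]) (auto simp: f_def I_def tail_node_def)
    qed
  next
    fix p assume "p \<in> f ` I"
    then obtain i j where ij: "i \<in> {1..s}" "j \<in> {1..r}" "p = f (i, j)" by (auto simp: I_def)
    show "p \<in> ?R"
    proof (cases "j = 1")
      case True
      then show ?thesis using ij by (auto simp: f_def tail_node_def)
    next
      case False
      define j' where "j' = j - 1"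
      have "p = (w i j', w i (j' + 1))" "j' \<in> {1..<r}"
        using False ij by (auto simp: f_def tail_node_def j'_def)
      then show ?thesis using ij by blast
    qed
  qed
  have arcs: "parcs (kite H v w s r) = parcs H \<union> (f ` I \<union> prod.swap ` f ` I)"
  proof -
    have "(\<lambda>(a, b). (b, a)) = (prod.swap :: 'a \<times> 'a \<Rightarrow> 'a \<times> 'a)" by auto
    then show ?thesis unfolding kite_def R by (simp add: symcl_def)
  qed
  have inj: "inj_on f I"
  proof (rule inj_onI)
    fix p q assume "p \<in> I" "q \<in> I" "f p = f q"
    then have "fst p = fst q \<and> snd p = snd q"
      by (intro node_inj) (auto simp: f_def I_def)
    then show "p = q" by (simp add: prod_eq_iff)
  qed
  have disj1: "parcs H \<inter> (f ` I \<union> prod.swap ` f ` I) = {}"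
  proof -
    have "snd (f p) \<notin> pverts H" if "p \<in> I" for p
      using that nodeH[of "fst p" "snd p"] by (auto simp: f_def I_def)
    then show ?thesis
      by (auto simp: f_def dest: H.in_arcsD1 H.in_arcsD2)
  qed
  \<comment> \<open>A common arc would make each of two levels the predecessor of the other.\<close>
  have disj2: "f ` I \<inter> prod.swap ` f ` I = {}"
  proof -
    have "f p \<noteq> prod.swap (f q)" if "p \<in> I" "q \<in> I" for p q
    proof
      assume "f p = prod.swap (f q)"
      then have e: "tail_node v w (fst p) (snd p) = tail_node v w (fst q) (snd q - 1)"
          "tail_node v w (fst q) (snd q) = tail_node v w (fst p) (snd p - 1)"
        by (auto simp: f_def)
      have "snd p = snd q - 1" using node_inj[OF e(1)] that by (auto simp: I_def)
      moreover have "snd q = snd p - 1" using node_inj[OF e(2)] that by (auto simp: I_def)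
      ultimately show False using that by (auto simp: I_def)
    qed
    then show ?thesis by blast
  qed
  define g where "g = (\<lambda>(a, b). (x a - x b)\<^sup>2)"
  have fin: "finite I" by (simp add: I_def)
  have "arc_energy (kite H v w s r) x = sum g (parcs H) + (sum g (f ` I) + sum g (prod.swap ` f ` I))"
    unfolding arc_energy_def g_def[symmetric] arcs
    using fin disj1 disj2 by (simp add: sum.union_disjoint)
  also have "sum g (prod.swap ` f ` I) = sum g (f ` I)"
    by (subst sum.reindex) (auto simp: g_def power2_commute intro!: sum.cong)
  also have "sum g (f ` I) = (\<Sum>p\<in>I. g (f p))"
    using inj by (simp add: sum.reindex)
  also have "\<dots> = (\<Sum>i=1..s. \<Sum>j=1..r. (x (tail_node v w i j) - x (tail_node v w i (j - 1)))\<^sup>2)"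
    unfolding I_def by (simp add: sum.cartesian_product g_def f_def case_prod_beta power2_commute)
  finally show ?thesis by (simp add: arc_energy_def g_def)
qed

text \<open>Each tail carries the sine mode with amplitude \<open>c i\<close>. The modes vanish at
  \<open>v\<close>, so they fit together with the value 0 on the head, and each has the Rayleigh
  quotient \<open>tail_value r\<close>.\<close>

lemma kite_tail_vector:
  fixes c :: "nat \<Rightarrow> real"
  assumes c: "sum c {1..s} = 0" "(\<Sum>i=1..s. (c i)\<^sup>2) > 0"
  obtains x where "\<And>u. u \<in> pverts H \<Longrightarrow> x u = 0"
    "\<And>i j. i \<in> {1..s} \<Longrightarrow> j \<in> {1..r} \<Longrightarrow> x (w i j) = c i * sin (real j * tail_angle r)"
    "sum x (pverts (kite H v w s r)) = 0" "(\<Sum>u\<in>pverts (kite H v w s r). (x u)\<^sup>2) > 0"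
    "arc_energy (kite H v w s r) x = 2 * tail_value r * (\<Sum>u\<in>pverts (kite H v w s r). (x u)\<^sup>2)"
proof -
  define p where "p j = sin (real j * tail_angle r)" for j
  obtain x where xH: "\<And>u. u \<in> pverts H \<Longrightarrow> x u = 0"
    and xw: "\<And>i j. i \<in> {1..s} \<Longrightarrow> j \<in> {1..r} \<Longrightarrow> x (w i j) = c i * p j"
    using kite_function_exists[of "\<lambda>_. 0" "\<lambda>i j. c i * p j"] by blast
  let ?C = "\<Sum>i=1..s. (c i)\<^sup>2" and ?P = "\<Sum>j=1..r. (p j)\<^sup>2"
  have node: "x (tail_node v w i j) = c i * p j" if "i \<in> {1..s}" "j \<le> r" for i j
    using that xH[OF v_in_head] xw by (auto simp: tail_node_def p_def)
  have "(\<Sum>i=1..s. \<Sum>j=1..r. x (w i j)) = (\<Sum>i=1..s. \<Sum>j=1..r. c i * p j)"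
    by (intro sum.cong refl) (simp add: xw)
  also have "\<dots> = sum c {1..s} * sum p {1..r}"
    by (simp add: sum_product)
  finally have sum0: "sum x (pverts (kite H v w s r)) = 0"
    unfolding sum_pverts_kite using c xH by simp
  have "(\<Sum>i=1..s. \<Sum>j=1..r. (x (w i j))\<^sup>2) = (\<Sum>i=1..s. \<Sum>j=1..r. (c i)\<^sup>2 * (p j)\<^sup>2)"
    by (intro sum.cong refl) (simp add: xw power_mult_distrib)
  also have "\<dots> = ?C * ?P" by (simp add: sum_product)
  finally have norm: "(\<Sum>u\<in>pverts (kite H v w s r). (x u)\<^sup>2) = ?C * ?P"
    unfolding sum_pverts_kite using xH by simp
  have "p 1 > 0" unfolding p_def by (rule sin_tail_pos) (use r in auto)
  then have "?P > 0" using r by (intro sum_pos2[of _ 1]) auto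
  with c norm have pos: "(\<Sum>u\<in>pverts (kite H v w s r). (x u)\<^sup>2) > 0" by simp
  have "arc_energy H x = 0"
    unfolding arc_energy_def
    by (intro sum.neutral) (auto simp: xH dest!: head_arcD)
  moreover have "(\<Sum>i=1..s. \<Sum>j=1..r. (x (tail_node v w i j) - x (tail_node v w i (j - 1)))\<^sup>2) =
      (\<Sum>i=1..s. \<Sum>j=1..r. (c i)\<^sup>2 * (p j - p (j - 1))\<^sup>2)"
  proof (intro sum.cong refl)
    fix i j assume ij: "i \<in> {1..s}" "j \<in> {1..r}"
    have "x (tail_node v w i j) = c i * p j" "x (tail_node v w i (j - 1)) = c i * p (j - 1)"
      by (rule node; use ij in auto)+
    then show "(x (tail_node v w i j) - x (tail_node v w i (j - 1)))\<^sup>2 = (c i)\<^sup>2 * (p j - p (j - 1))\<^sup>2"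
      by (simp add: right_diff_distrib[symmetric] power_mult_distrib)
  qed
  moreover have "\<dots> = ?C * (\<Sum>j=1..r. (p j - p (j - 1))\<^sup>2)"
    by (simp add: sum_product)
  moreover have "(\<Sum>j=1..r. (p j - p (j - 1))\<^sup>2) = tail_value r * ?P"
    unfolding p_def by (rule sin_tail_energy)
  ultimately have "arc_energy (kite H v w s r) x = 2 * tail_value r * (\<Sum>u\<in>pverts (kite H v w s r). (x u)\<^sup>2)"
    unfolding arc_energy_kite norm by simp
  then show ?thesis using that[OF xH _ sum0 pos] xw unfolding p_def by blast
qed

section \<open>Upper bounds for kites with added edges\<close>

lemma card_pverts_kite: "card (pverts H) \<le> card (pverts (kite H v w s r))"
proof -
  interpret pair_graph "kite H v w s r" by (rule pair_graph_kite[OF H lab])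
  show ?thesis by (rule card_mono) (use pair_finite_verts in \<open>auto simp: kite_def\<close>)
qed

text \<open>A tail vector with equal amplitudes on the tails from 2 to \<open>s\<close> does not see
  the added edges.\<close>

lemma algebraic_connectivity_kite_plus_le:
  assumes s: "s \<ge> 2" and two: "card (pverts H) \<ge> 2"
    and G': "adds_edges_within (kite H v w s r) (pverts H \<times> pverts H \<union> level_pairs w {2..s} r) G'"
  shows "algebraic_connectivity G' \<le> tail_value r"
proof -
  let ?K = "kite H v w s r"
  \<comment> \<open>The first tail balances the common amplitude -1 of the other
    \<open>s - 1\<close> tails.\<close>
  define c where "c i = (if i = 1 then real (s - 1) else - 1)" for i :: nat
  have split: "{1..s} = insert 1 {2..s}" using s by auto
  have "sum c {2..s} = - real (s - 1)" using s by (simp add: c_def)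
  then have c0: "sum c {1..s} = 0" unfolding split by (simp add: c_def)
  have "(\<Sum>i=1..s. (c i)\<^sup>2) > 0"
    unfolding split using s by (simp add: c_def add_pos_nonneg sum_nonneg)
  with c0 obtain x where xH: "\<And>u. u \<in> pverts H \<Longrightarrow> x u = 0"
    and xw: "\<And>i j. i \<in> {1..s} \<Longrightarrow> j \<in> {1..r} \<Longrightarrow> x (w i j) = c i * sin (real j * tail_angle r)"
    and x: "sum x (pverts ?K) = 0" "(\<Sum>u\<in>pverts ?K. (x u)\<^sup>2) > 0"
    "arc_energy ?K x = 2 * tail_value r * (\<Sum>u\<in>pverts ?K. (x u)\<^sup>2)"
    using kite_tail_vector[of c] by blast
  have PG': "pair_graph G'" and V: "pverts G' = pverts ?K" using G' by (auto simp: adds_edges_within_def)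
  have "arc_energy G' x = arc_energy ?K x"
  proof (rule arc_energy_add_edges[OF G'])
    fix a b assume "(a, b) \<in> pverts H \<times> pverts H \<union> level_pairs w {2..s} r"
    then show "x a = x b"
    proof
      assume "(a, b) \<in> level_pairs w {2..s} r"
      then obtain i i' j where "a = w i j" "b = w i' j" "i \<in> {2..s}" "i' \<in> {2..s}" "j \<in> {1..r}"
        unfolding level_pairs_def by blast
      then show ?thesis using xw[of i j] xw[of i' j] by (simp add: c_def)
    qed (use xH in auto)
  qed
  then show ?thesis
    using card_pverts_kite two x
    by (intro algebraic_connectivity_le[OF PG', of x]) (simp_all add: V sum_arc_weight_eq_arc_energy[OF PG', unfolded V])
qed

text \<open>
  Exchanging two tails preserves energies, and the antisymmetric part of a minimiser is supported on
  these tails, where its Rayleigh quotient is at least \<open>tail_value r\<close>; hence it vanishes.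
\<close>

lemma kite_minimiser_level_constant:
  assumes two: "card (pverts H) \<ge> 2" and lt: "algebraic_connectivity (kite H v w s r) < tail_value r"
    and x: "sum x (pverts (kite H v w s r)) = 0"
      "arc_energy (kite H v w s r) x =
        2 * algebraic_connectivity (kite H v w s r) * (\<Sum>u\<in>pverts (kite H v w s r). (x u)\<^sup>2)"
    and i: "i \<in> {1..s}" "i' \<in> {1..s}" and j: "j \<in> {1..r}"
  shows "x (w i j) = x (w i' j)"
proof -
  let ?K = "kite H v w s r"
  let ?V = "pverts ?K" and ?a = "algebraic_connectivity ?K"
  have K: "pair_graph ?K" by (rule pair_graph_kite[OF H lab])
  have twoK: "card ?V \<ge> 2" using card_pverts_kite two by linarith
  \<comment> \<open>The exchange of the two tails; \<open>x'\<close> below is \<open>x\<close> after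
    this exchange.\<close>
  define \<tau> where "\<tau> = transpose i i'"
  have \<tau>: "\<tau> l \<in> {1..s}" if "l \<in> {1..s}" for l
    using that i by (auto simp: \<tau>_def transpose_def)
  have re: "(\<Sum>l=1..s. h (\<tau> l)) = (\<Sum>l=1..s. h l)" for h :: "nat \<Rightarrow> real"
    by (rule sum.reindex_bij_witness[of _ \<tau> \<tau>]) (use \<tau> in \<open>auto simp: \<tau>_def\<close>)
  obtain x' where x'H: "\<And>u. u \<in> pverts H \<Longrightarrow> x' u = x u"
    and x'w: "\<And>l j. l \<in> {1..s} \<Longrightarrow> j \<in> {1..r} \<Longrightarrow> x' (w l j) = x (w (\<tau> l) j)"
    using kite_function_exists[of x "\<lambda>l j. x (w (\<tau> l) j)"] by blast
  have x'node: "x' (tail_node v w l j) = x (tail_node v w (\<tau> l) j)" if "l \<in> {1..s}" "j \<le> r" for l j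
    using that x'H[OF v_in_head] x'w by (auto simp: tail_node_def)
  have sum_x': "(\<Sum>u\<in>?V. h (x' u)) = (\<Sum>u\<in>?V. h (x u))" for h :: "real \<Rightarrow> real"
  proof -
    have "(\<Sum>l=1..s. \<Sum>j=1..r. h (x' (w l j))) = (\<Sum>l=1..s. \<Sum>j=1..r. h (x (w (\<tau> l) j)))"
      by (intro sum.cong refl) (simp add: x'w)
    also have "\<dots> = (\<Sum>l=1..s. \<Sum>j=1..r. h (x (w l j)))" by (rule re)
    finally show ?thesis unfolding sum_pverts_kite by (simp add: x'H)
  qed
  have ex': "arc_energy ?K x' = arc_energy ?K x"
  proof -
    have "arc_energy H x' = arc_energy H x"
      unfolding arc_energy_def by (intro sum.cong refl) (auto simp: x'H dest!: head_arcD)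
    moreover have "(\<Sum>l=1..s. \<Sum>j=1..r. (x' (tail_node v w l j) - x' (tail_node v w l (j - 1)))\<^sup>2) =
       (\<Sum>l=1..s. \<Sum>j=1..r. (x (tail_node v w (\<tau> l) j) - x (tail_node v w (\<tau> l) (j - 1)))\<^sup>2)"
      by (intro sum.cong refl arg_cong[where f = "\<lambda>z. z\<^sup>2"] arg_cong2[where f = "(-)"] x'node) auto
    moreover have "\<dots> = (\<Sum>l=1..s. \<Sum>j=1..r. (x (tail_node v w l j) - x (tail_node v w l (j - 1)))\<^sup>2)"
      by (rule re)
    ultimately show ?thesis unfolding arc_energy_kite by simp
  qed
  \<comment> \<open>Symmetric and antisymmetric part, up to a factor 2. By the parallelogram law
    their norms, and likewise their energies, add up to four times that of \<open>x\<close>.\<close>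
  define p where "p u = x u + x' u" for u
  define q where "q u = x u - x' u" for u
  let ?N = "\<lambda>z. \<Sum>u\<in>?V. (z u)\<^sup>2"
  have Npq: "?N p + ?N q = 4 * ?N x"
  proof -
    have "?N p + ?N q = 2 * ?N x + 2 * ?N x'"
      unfolding sum_distrib_left sum.distrib[symmetric]
      by (intro sum.cong refl) (simp add: p_def q_def power2_eq_square algebra_simps)
    then show ?thesis using sum_x'[of "\<lambda>z. z\<^sup>2"] by simp
  qed
  have Epq: "arc_energy ?K p + arc_energy ?K q = 4 * arc_energy ?K x"
  proof -
    have "arc_energy ?K p + arc_energy ?K q = 2 * arc_energy ?K x + 2 * arc_energy ?K x'"
      unfolding arc_energy_def sum_distrib_left sum.distrib[symmetric]
      by (intro sum.cong refl) (auto simp: p_def q_def power2_eq_square algebra_simps)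
    then show ?thesis using ex' by simp
  qed
  have "sum p ?V = 0" using x(1) sum_x'[of "\<lambda>z. z"] by (simp add: p_def sum.distrib)
  then have Ep: "2 * ?a * ?N p \<le> arc_energy ?K p"
    using walk_gap_algebraic_connectivity[OF K twoK, unfolded walk_gap_def, rule_format, of p]
    unfolding sum_arc_weight_eq_arc_energy[OF K] by simp
  have qH: "q u = 0" if "u \<in> pverts H" for u using that by (simp add: q_def x'H)
  have Nq: "?N q = (\<Sum>l=1..s. \<Sum>j=1..r. (q (w l j))\<^sup>2)"
    unfolding sum_pverts_kite by (simp add: qH)
  \<comment> \<open>\<open>q\<close> vanishes on the head, in particular at \<open>v\<close>, so the
    Poincare inequality applies along each tail.\<close>
  have Eq: "2 * tail_value r * ?N q \<le> arc_energy ?K q"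
  proof -
    have "tail_value r * (\<Sum>j=1..r. (q (w l j))\<^sup>2) \<le>
        (\<Sum>j=1..r. (q (tail_node v w l j) - q (tail_node v w l (j - 1)))\<^sup>2)" for l
    proof -
      have "(\<Sum>j=1..r. (q (w l j))\<^sup>2) = (\<Sum>j=1..r. (q (tail_node v w l j))\<^sup>2)"
        by (intro sum.cong refl) (auto simp: tail_node_def)
      moreover have "q (tail_node v w l 0) = 0" by (simp add: tail_node_def qH v_in_head)
      ultimately show ?thesis using tail_poincare[of "\<lambda>j. q (tail_node v w l j)" r] by simp
    qed
    then have "tail_value r * ?N q \<le> (\<Sum>l=1..s. \<Sum>j=1..r. (q (tail_node v w l j) - q (tail_node v w l (j - 1)))\<^sup>2)"
      unfolding Nq sum_distrib_left[of "tail_value r" _ "{1..s}"] by (intro sum_mono)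
    moreover have "arc_energy H q \<ge> 0"
      unfolding arc_energy_def by (intro sum_nonneg) auto
    ultimately show ?thesis unfolding arc_energy_kite by linarith
  qed
  \<comment> \<open>Minimality of \<open>x\<close> leaves no room for an excess energy of
    \<open>q\<close> over the least Rayleigh quotient.\<close>
  have "2 * (tail_value r - ?a) * ?N q \<le> 0"
  proof -
    have "2 * ?a * ?N p + 2 * tail_value r * ?N q \<le> 4 * (2 * ?a * ?N x)"
      using Ep Eq Epq x(2) by linarith
    also have "\<dots> = 2 * ?a * (?N p + ?N q)" unfolding Npq by simp
    finally show ?thesis by (simp only: distrib_left left_diff_distrib right_diff_distrib)
  qed
  moreover have "?N q \<ge> 0" by (simp add: sum_nonneg)
  ultimately have "?N q = 0" using lt by (simp add: mult_le_0_iff)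
  moreover have "finite ?V"
    by (rule card_ge_0_finite) (use twoK in simp)
  ultimately have "\<forall>u\<in>?V. q u = 0" by (simp add: sum_nonneg_eq_0_iff)
  moreover have "w i j \<in> ?V" using i j by (auto simp: kite_def)
  ultimately have "q (w i j) = 0" by blast
  then show ?thesis using x'w[of i j] i j by (simp add: q_def \<tau>_def)
qed

lemma algebraic_connectivity_kite_tail_plus_le:
  assumes two: "card (pverts H) \<ge> 2" and lt: "algebraic_connectivity (kite H v w s r) < tail_value r"
    and G': "adds_edges_within (kite H v w s r) (level_pairs w {1..s} r) G'"
  shows "algebraic_connectivity G' \<le> algebraic_connectivity (kite H v w s r)"
proof -
  let ?K = "kite H v w s r"
  have K: "pair_graph ?K" by (rule pair_graph_kite[OF H lab])
  have twoK: "card (pverts ?K) \<ge> 2" using card_pverts_kite two by linarith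
  obtain x where x: "sum x (pverts ?K) = 0" "(\<Sum>u\<in>pverts ?K. (x u)\<^sup>2) > 0"
    "arc_energy ?K x = 2 * algebraic_connectivity ?K * (\<Sum>u\<in>pverts ?K. (x u)\<^sup>2)"
    using algebraic_connectivity_attained[OF K twoK] unfolding sum_arc_weight_eq_arc_energy[OF K] by blast
  have PG': "pair_graph G'" and V: "pverts G' = pverts ?K" using G' by (auto simp: adds_edges_within_def)
  have "arc_energy G' x = arc_energy ?K x"
  proof (rule arc_energy_add_edges[OF G'])
    fix a b assume "(a, b) \<in> level_pairs w {1..s} r"
    then obtain i i' j where "a = w i j" "b = w i' j" "i \<in> {1..s}" "i' \<in> {1..s}" "j \<in> {1..r}"
      unfolding level_pairs_def by blast
    then show "x a = x b" using kite_minimiser_level_constant[OF two lt x(1,3), of i i' j] by blast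
  qed
  then show ?thesis
    using twoK x
    by (intro algebraic_connectivity_le[OF PG', of x]) (simp_all add: V sum_arc_weight_eq_arc_energy[OF PG', unfolded V])
qed

end

theorem theorem4p7:
  fixes H G GT GP :: "'a pair_pre_digraph"
    and v :: 'a and w :: "nat \<Rightarrow> nat \<Rightarrow> 'a"
    and s r k :: nat
  assumes "pair_graph H"
    and "s \<ge> 2" and "r \<ge> 1"
    and "kite_labelling H v w s r"
    and "G = kite H v w s r"
    and "is_kite_tail_plus H v w s r GT"
    and "is_kite_plus H v w s r GP"
    and "1 \<le> k" and "k \<le> card (pverts H) - 1"
    and "algebraic_connectivity H = algebraic_connectivity (token_graph k H)"
  shows "(algebraic_connectivity G \<noteq> 2 + 2 * cos (2 * real r * pi / (2 * real r + 1)) \<longrightarrow>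
            algebraic_connectivity (token_graph k GT) = algebraic_connectivity GT \<and>
            algebraic_connectivity GT = algebraic_connectivity G) \<and>
         (algebraic_connectivity G = 2 + 2 * cos (2 * real r * pi / (2 * real r + 1)) \<longrightarrow>
            algebraic_connectivity (token_graph k GP) = algebraic_connectivity GP \<and>
            algebraic_connectivity GP = algebraic_connectivity G \<and>
            algebraic_connectivity G = 2 + 2 * cos (2 * real r * pi / (2 * real r + 1)))"
proof -
  note kite = \<open>pair_graph H\<close> \<open>kite_labelling H v w s r\<close> \<open>r \<ge> 1\<close>
  \<comment> \<open>\<open>1 \<le> k\<close> makes the truncated difference positive.\<close>
  have two: "card (pverts H) \<ge> 2" using \<open>1 \<le> k\<close> \<open>k \<le> card (pverts H) - 1\<close> by linarith
  have G: "pair_graph G" unfolding \<open>G = kite H v w s r\<close> by (rule pair_graph_kite[OF kite(1,2)])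
  have HG: "card (pverts H) \<le> card (pverts G)"
    unfolding \<open>G = kite H v w s r\<close> by (rule card_pverts_kite[OF kite])
  have GT: "adds_edges_within G (level_pairs w {1..s} r) GT"
    using \<open>is_kite_tail_plus H v w s r GT\<close> \<open>G = kite H v w s r\<close> by (simp add: is_kite_tail_plus_def)
  have GP: "adds_edges_within G (pverts H \<times> pverts H \<union> level_pairs w {2..s} r) GP"
    using \<open>is_kite_plus H v w s r GP\<close> \<open>G = kite H v w s r\<close> by (simp add: is_kite_plus_def)
  have le_tail: "algebraic_connectivity G' \<le> tail_value r"
    if "adds_edges_within G (pverts H \<times> pverts H \<union> level_pairs w {2..s} r) G'" for G'
    using algebraic_connectivity_kite_plus_le[OF kite \<open>s \<ge> 2\<close> two] that \<open>G = kite H v w s r\<close> by simp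
  \<comment> \<open>\<open>G\<close> itself is the case of no added edges, so its connectivity is at
    most \<open>tail_value r\<close>, and differing from this value means being smaller.\<close>
  have "adds_edges_within G (pverts H \<times> pverts H \<union> level_pairs w {2..s} r) G"
    using G by (simp add: adds_edges_within_def)
  then have G_le: "algebraic_connectivity G \<le> tail_value r" by (rule le_tail)
  \<comment> \<open>Adding edges keeps the vertex set, which is at least as large as that of
    \<open>H\<close>; hence \<open>k\<close> stays in the range where a graph and its token graph
    have the same connectivity.\<close>
  have token: "algebraic_connectivity (token_graph k G') = algebraic_connectivity G'"
    and mono: "algebraic_connectivity G \<le> algebraic_connectivity G'"
    if "adds_edges_within G S G'" for S G'
  proof -
    have "pair_graph G'" "pverts G' = pverts G" using that by (auto simp: adds_edges_within_def)
    then show "algebraic_connectivity (token_graph k G') = algebraic_connectivity G'"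
      using HG two \<open>1 \<le> k\<close> \<open>k \<le> card (pverts H) - 1\<close>
      by (intro algebraic_connectivity_token_graph) auto
    show "algebraic_connectivity G \<le> algebraic_connectivity G'"
      using HG two by (intro algebraic_connectivity_mono[OF G _ that]) simp
  qed
  have "algebraic_connectivity GT = algebraic_connectivity G" if "algebraic_connectivity G \<noteq> tail_value r"
  proof (rule antisym)
    show "algebraic_connectivity GT \<le> algebraic_connectivity G"
      using algebraic_connectivity_kite_tail_plus_le[OF kite two] GT that G_le \<open>G = kite H v w s r\<close> by simp
  qed (rule mono[OF GT])
  \<comment> \<open>Here the connectivity is squeezed between that of \<open>G\<close> and
    \<open>tail_value r\<close>.\<close>
  moreover have "algebraic_connectivity GP = algebraic_connectivity G" if "algebraic_connectivity G = tail_value r"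
    using that le_tail[OF GP] mono[OF GP] by simp
  ultimately show ?thesis
    unfolding tail_value_eq[symmetric] using token[OF GT] token[OF GP] by simp
qed

end
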